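(* Two Denjoy systems are eventually flow equivalent if and only if they are topologically conjugate.
   Context: A system $(X,S)$ is a non-empty compact metric space $X$ with a homeomorphism $S$. Topological conjugacy of $(X,S)$ and $(Y,T)$ means existence of a homeomorphism $h:X\to Y$ with $hS=Th$. Denjoy systems. Let $\mathbb{T}=\mathbb{R}/\mathbb{Z}$ and $R_\alpha(t)=t+\alpha$. A Denjoy homeomorphism is an orientation-preserving homeomorphism $F$ of $\mathbb{T}$ with irrational rotation number $\alpha$ that is not conjugate to $R_\alpha$. Then $F$ has a unique minimal set $\mathcal{D}_F\subset\mathbb{T}$, which is a Cantor set, and the Denjoy system associated to $F$ is $(\mathcal{D}_F,F|_{\mathcal{D}_F})$. Flow equivalence. The suspension of $(X,S)$ is $\Sigma_SX=(X\times\mathbb{R})/\mathbb{Z}$, where $n\cdot(x,s)=(S^n(x),s-n)$, with flow $(x,s)\mapsto(x,s+s')$. Two systems are flow equivalent if there is a homeomorphism between their suspensions mapping flow orbits onto flow orbits and preserving their orientation. $(X,S)$ and $(Y,T)$ are eventually flow equivalent if $(X,S^n)$ and $(Y,T^n)$ are flow equivalent for all but finitely many $n\in\mathbb{N}$. *)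

theory Defs
  imports "HOL-Analysis.Analysis"
begin

text \<open>
  A system is given by a topology \<open>X\<close> (its points being \<open>topspace X\<close>) and a
  function \<open>S\<close>, of which only the values on \<open>topspace X\<close> matter.
\<close>

definition quotient_topology :: "'a topology \<Rightarrow> ('a \<Rightarrow> 'b) \<Rightarrow> 'b topology" where
  "quotient_topology X q =
     topology (\<lambda>U. U \<subseteq> q ` topspace X \<and> openin X {x \<in> topspace X. q x \<in> U})"

lemma openin_quotient_topology:
  "openin (quotient_topology X q) U \<longleftrightarrow>
     U \<subseteq> q ` topspace X \<and> openin X {x \<in> topspace X. q x \<in> U}"
proof -
  have "istopology (\<lambda>U. U \<subseteq> q ` topspace X \<and> openin X {x \<in> topspace X. q x \<in> U})"
    unfolding istopology_def
  proof (intro conjI allI impI)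
    fix U V
    assume U: "U \<subseteq> q ` topspace X \<and> openin X {x \<in> topspace X. q x \<in> U}"
      and V: "V \<subseteq> q ` topspace X \<and> openin X {x \<in> topspace X. q x \<in> V}"
    have eq: "{x \<in> topspace X. q x \<in> U \<inter> V}
        = {x \<in> topspace X. q x \<in> U} \<inter> {x \<in> topspace X. q x \<in> V}" by auto
    show "openin X {x \<in> topspace X. q x \<in> U \<inter> V}"
      unfolding eq using U V by blast
  next
    fix \<K>
    assume K: "\<forall>U\<in>\<K>. U \<subseteq> q ` topspace X \<and> openin X {x \<in> topspace X. q x \<in> U}"
    have eq: "{x \<in> topspace X. q x \<in> \<Union>\<K>}
        = \<Union>((\<lambda>U. {x \<in> topspace X. q x \<in> U}) ` \<K>)" by auto
    show "openin X {x \<in> topspace X. q x \<in> \<Union>\<K>}"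
      unfolding eq using K by (intro openin_Union) auto
  qed blast+
  then show ?thesis
    unfolding quotient_topology_def by simp
qed

lemma topspace_quotient_topology: "topspace (quotient_topology X q) = q ` topspace X"
proof
  show "topspace (quotient_topology X q) \<subseteq> q ` topspace X"
    using openin_topspace[of "quotient_topology X q"] unfolding openin_quotient_topology by blast
  have "{x \<in> topspace X. q x \<in> q ` topspace X} = topspace X" by auto
  then have "openin (quotient_topology X q) (q ` topspace X)"
    by (simp add: openin_quotient_topology)
  then show "q ` topspace X \<subseteq> topspace (quotient_topology X q)"
    by (rule openin_subset)
qed

lemma quotient_map_quotient_topology: "quotient_map X (quotient_topology X q) q"
  by (auto simp: quotient_map_def topspace_quotient_topology openin_quotient_topology)

definition topologically_conjugate ::
    "'a topology \<Rightarrow> ('a \<Rightarrow> 'a) \<Rightarrow> 'b topology \<Rightarrow> ('b \<Rightarrow> 'b) \<Rightarrow> bool" where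
  "topologically_conjugate X S Y T \<longleftrightarrow>
     (\<exists>h. homeomorphic_map X Y h \<and> (\<forall>x \<in> topspace X. h (S x) = T (h x)))"

definition minimal_set :: "'a topology \<Rightarrow> ('a \<Rightarrow> 'a) \<Rightarrow> 'a set \<Rightarrow> bool" where
  "minimal_set X S D \<longleftrightarrow>
     D \<noteq> {} \<and> closedin X D \<and> S ` D = D \<and>
     (\<forall>E. E \<noteq> {} \<and> closedin X E \<and> S ` E = E \<and> E \<subseteq> D \<longrightarrow> E = D)"


subsection \<open>Denjoy systems\<close>

text \<open>The points of \<open>\<real>/\<int>\<close> are the cosets of \<open>\<int>\<close> in \<open>\<real>\<close>.\<close>

definition circle_proj :: "real \<Rightarrow> real set" where
  "circle_proj t = {t + of_int n | n :: int. True}"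

lemma circle_proj_eq_iff: "circle_proj s = circle_proj t \<longleftrightarrow> s - t \<in> \<int>"
proof
  assume "circle_proj s = circle_proj t"
  moreover have "s \<in> circle_proj s"
    unfolding circle_proj_def by (rule CollectI, rule exI[of _ 0]) simp
  ultimately show "s - t \<in> \<int>"
    by (auto simp: circle_proj_def)
next
  assume "s - t \<in> \<int>"
  then obtain k where k: "s = t + of_int k"
    by (metis Ints_cases add_diff_cancel_left' diff_add_cancel add.commute)
  have "t + of_int n = s + of_int (n - k)" "s + of_int n = t + of_int (n + k)" for n
    using k by simp_all
  then show "circle_proj s = circle_proj t"
    unfolding circle_proj_def by blast
qed

definition circle :: "real set topology" where
  "circle = quotient_topology euclideanreal circle_proj"

definition circle_rotation :: "real \<Rightarrow> real set \<Rightarrow> real set" where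
  "circle_rotation \<alpha> c = (\<lambda>t. t + \<alpha>) ` c"

lemma circle_rotation_proj: "circle_rotation \<alpha> (circle_proj t) = circle_proj (t + \<alpha>)"
  by (auto simp: circle_rotation_def circle_proj_def image_iff algebra_simps)

text \<open>
  If \<open>F\<close> is a homeomorphism of \<open>\<real>/\<int>\<close>, an increasing lift
  \<open>f\<close> automatically satisfies \<open>f (x + 1) = f x + 1\<close>.
\<close>

definition increasing_lift :: "(real \<Rightarrow> real) \<Rightarrow> (real set \<Rightarrow> real set) \<Rightarrow> bool" where
  "increasing_lift f F \<longleftrightarrow>
     continuous_on UNIV f \<and> strict_mono f \<and> (\<forall>x. F (circle_proj x) = circle_proj (f x))"

definition orientation_preserving_homeo :: "(real set \<Rightarrow> real set) \<Rightarrow> bool" where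
  "orientation_preserving_homeo F \<longleftrightarrow>
     homeomorphic_map circle circle F \<and> (\<exists>f. increasing_lift f F)"

text \<open>The rotation number is an element of \<open>\<real>/\<int>\<close>; here \<open>\<alpha>\<close> is any
  real representative of it.\<close>

definition has_rotation_number :: "(real set \<Rightarrow> real set) \<Rightarrow> real \<Rightarrow> bool" where
  "has_rotation_number F \<alpha> \<longleftrightarrow>
     (\<exists>f. increasing_lift f F \<and> (\<forall>x. (\<lambda>n. ((f ^^ n) x - x) / real n) \<longlonglongrightarrow> \<alpha>))"

definition denjoy_homeo :: "(real set \<Rightarrow> real set) \<Rightarrow> bool" where
  "denjoy_homeo F \<longleftrightarrow>
     orientation_preserving_homeo F \<and>
     (\<exists>\<alpha>. \<alpha> \<notin> \<rat> \<and> has_rotation_number F \<alpha> \<and>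
          \<not> topologically_conjugate circle F circle (circle_rotation \<alpha>))"

text \<open>The minimal set \<open>D\<close> of a Denjoy homeomorphism is unique.\<close>

definition denjoy_system :: "real set topology \<Rightarrow> (real set \<Rightarrow> real set) \<Rightarrow> bool" where
  "denjoy_system X S \<longleftrightarrow>
     (\<exists>F D. denjoy_homeo F \<and> minimal_set circle F D \<and>
            X = subtopology circle D \<and> (\<forall>x \<in> D. S x = F x))"


subsection \<open>Suspensions and flow equivalence\<close>

definition int_iterate :: "'a topology \<Rightarrow> ('a \<Rightarrow> 'a) \<Rightarrow> int \<Rightarrow> 'a \<Rightarrow> 'a" where
  "int_iterate X S n =
     (if n \<ge> 0 then S ^^ nat n else inv_into (topspace X) S ^^ nat (- n))"

text \<open>The points of the suspension are the orbits of the \<open>\<int>\<close>-action on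
  \<open>X \<times> \<real>\<close>.\<close>

definition suspension_proj :: "'a topology \<Rightarrow> ('a \<Rightarrow> 'a) \<Rightarrow> 'a \<times> real \<Rightarrow> ('a \<times> real) set" where
  "suspension_proj X S = (\<lambda>(x, s). {(int_iterate X S n x, s - of_int n) | n :: int. True})"

definition suspension :: "'a topology \<Rightarrow> ('a \<Rightarrow> 'a) \<Rightarrow> ('a \<times> real) set topology" where
  "suspension X S = quotient_topology (prod_topology X euclideanreal) (suspension_proj X S)"

definition suspension_flow :: "real \<Rightarrow> ('a \<times> real) set \<Rightarrow> ('a \<times> real) set" where
  "suspension_flow t c = (\<lambda>(x, s). (x, s + t)) ` c"

lemma suspension_flow_proj:
  "suspension_flow t (suspension_proj X S (x, s)) = suspension_proj X S (x, s + t)"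
  by (force simp: suspension_flow_def suspension_proj_def image_iff algebra_simps)

definition flow_orbit :: "('a \<times> real) set \<Rightarrow> ('a \<times> real) set set" where
  "flow_orbit c = range (\<lambda>t. suspension_flow t c)"

text \<open>Orientation is preserved when, along each orbit, \<open>h\<close> is given by an
  increasing change \<open>\<tau>\<close> of the time parameter; \<open>\<tau>\<close> may depend on the orbit.\<close>

definition flow_equivalent ::
    "'a topology \<Rightarrow> ('a \<Rightarrow> 'a) \<Rightarrow> 'b topology \<Rightarrow> ('b \<Rightarrow> 'b) \<Rightarrow> bool" where
  "flow_equivalent X S Y T \<longleftrightarrow>
     (\<exists>h. homeomorphic_map (suspension X S) (suspension Y T) h \<and>
          (\<forall>c \<in> topspace (suspension X S).
             h ` flow_orbit c = flow_orbit (h c) \<and>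
             (\<exists>\<tau> :: real \<Rightarrow> real. continuous_on UNIV \<tau> \<and> strict_mono \<tau> \<and>
                (\<forall>t. h (suspension_flow t c) = suspension_flow (\<tau> t) (h c)))))"

definition eventually_flow_equivalent ::
    "'a topology \<Rightarrow> ('a \<Rightarrow> 'a) \<Rightarrow> 'b topology \<Rightarrow> ('b \<Rightarrow> 'b) \<Rightarrow> bool" where
  "eventually_flow_equivalent X S Y T \<longleftrightarrow>
     finite {n :: nat. \<not> flow_equivalent X (S ^^ n) Y (T ^^ n)}"

end

theory Submission
  imports Defs
begin

text \<open>
  A Denjoy homeomorphism lifts to an increasing map \<open>f\<close> of the line with a monotone semiconjugacy \<open>P\<close>
  onto the translation by \<open>\<alpha>\<close>. The Denjoy minimal set consists of the end points of the fibres
  of \<open>P\<close>, and up to conjugacy the system is determined by \<open>\<alpha>\<close> and the set \<open>Q\<close> of values with a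
  nondegenerate fibre. The \<open>n\<close>-th power has the data \<open>n\<alpha>\<close> and \<open>Q\<close>.

  A flow equivalence induces a map of end points into the circle which is equivariant up to an integer
  cocycle. Across a gap this map jumps by a multiple of \<open>\<beta>\<close>, and only finitely many gaps have a
  nonzero jump. Removing the jumps gives a continuous map on the line which translations by
  \<open>\<int> + \<alpha>\<int>\<close> change by constants; hence it is affine, with slope \<open>l\<close>, say. The inverse flow equivalence shows
  \<open>l(\<int> + \<alpha>\<int>) = \<int> + \<beta>\<int>\<close> and \<open>Q' = l Q + c\<close>.

  For all large \<open>n\<close> this gives \<open>l\<^sub>n(\<int> + n\<alpha>\<int>) = \<int> + n\<beta>\<int>\<close> and \<open>Q' = l\<^sub>n Q + c\<^sub>n\<close>. If \<open>l\<^sub>n\<close> is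
  rational for two consecutive \<open>n\<close>, it is \<open>\<plusminus>1\<close> and \<open>\<beta> \<equiv> \<plusminus>\<alpha>\<close> modulo \<open>1\<close>. Otherwise \<open>\<beta>\<close> is quadratic and the
  \<open>l\<^sub>n\<close> have the same norm up to sign, which yields a unit \<open>\<epsilon>\<close>. When \<open>n\<close> is the \<open>m\<close>-th term of the Lucas
  sequence of \<open>\<epsilon>\<close>, a size estimate forces \<open>l\<^sub>n = \<plusminus>\<epsilon>\<^sup>m\<^sup>j\<close>; consecutive terms are coprime, which gives
  \<open>\<beta> \<equiv> \<plusminus>\<alpha>\<close>, and comparing several \<open>m\<close> removes the power of \<open>\<epsilon>\<close> from \<open>Q' = l\<^sub>n Q + c\<^sub>n\<close>.
\<close>

subsection \<open>Monotone degree one maps of the line\<close>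

text \<open>A single flow equivalence yields only that \<open>\<alpha>\<close> and
  \<open>\<beta>\<close> are related by a fractional linear map of determinant \<plusminus>1. The
  gain from all powers is that the slope for \<open>n\<close> is
  \<open>p + r * (n * \<beta>)\<close>, so its \<open>\<beta>\<close>-coordinate is zero or at least
  \<open>n\<close> in absolute value. In the quadratic case, multiplication by powers of
  \<open>\<epsilon> ^ m\<close> balances the slope against its conjugate: both become at most a
  constant times the square root of \<open>\<epsilon> ^ m\<close>. As \<open>\<epsilon> ^ m\<close>
  is at most of the order of \<open>n\<close>, a nonzero coordinate is then impossible.

  A flow equivalence says nothing about the gaps of the Cantor set. All functions therefore live on
  end points, and continuity across a gap has to be earned by removing jumps. The orientation of the
  flow survives as the sign of \<open>d - r * \<alpha>\<close>; this is what excludes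
  \<open>d = -1\<close> once the slope is an integer.\<close>

definition lo :: "(real \<Rightarrow> real) \<Rightarrow> real \<Rightarrow> real" where
  "lo P t = Inf {x. P x = t}"

definition hi :: "(real \<Rightarrow> real) \<Rightarrow> real \<Rightarrow> real" where
  "hi P t = Sup {x. P x = t}"

definition endpoints :: "(real \<Rightarrow> real) \<Rightarrow> real set" where
  "endpoints P = range (lo P) \<union> range (hi P)"

definition gaps :: "(real \<Rightarrow> real) \<Rightarrow> real set" where
  "gaps P = {t. lo P t < hi P t}"

lemma add_int_of_add_1:
  fixes g :: "real \<Rightarrow> real"
  assumes "\<And>x. g (x + 1) = g x + 1"
  shows "g (x + of_int m) = g x + of_int m"
proof (induction m rule: int_induct[of _ 0])
  case (step1 i)
  then show ?case using assms[of "x + of_int i"] by (simp add: add.assoc)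
next
  case (step2 i)
  then show ?case using assms[of "x + of_int (i - 1)"] by (simp add: algebra_simps)
qed simp

locale degree_one =
  fixes P :: "real \<Rightarrow> real"
  assumes P_mono: "mono P" and P_cont: "continuous_on UNIV P" and P_add_1: "P (x + 1) = P x + 1"
begin

lemma P_add_int: "P (x + of_int m) = P x + of_int m"
  using P_add_1 by (rule add_int_of_add_1)

lemma P_le: "x \<le> y \<Longrightarrow> P x \<le> P y"
  using P_mono by (simp add: monoD)

lemma P_less_imp: "P x < P y \<Longrightarrow> x < y"
  using P_le by (meson not_le)

lemma P_bound: "\<bar>P x - x - P 0\<bar> \<le> 1"
proof -
  have "P (of_int \<lfloor>x\<rfloor>) \<le> P x" "P x \<le> P (of_int (\<lfloor>x\<rfloor> + 1))"
    by (intro P_le; linarith)+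
  then have "P 0 + of_int \<lfloor>x\<rfloor> \<le> P x" "P x \<le> P 0 + of_int (\<lfloor>x\<rfloor> + 1)"
    using P_add_int[of 0] by (metis add_0)+
  then show ?thesis by (simp add: abs_le_iff) linarith
qed

lemma P_surj: "\<exists>x. P x = t"
proof -
  have "P (t - P 0 - 1) \<le> t" "t \<le> P (t - P 0 + 1)"
    using P_bound[of "t - P 0 - 1"] P_bound[of "t - P 0 + 1"] by linarith+
  then show ?thesis
    using IVT'[of P "t - P 0 - 1" t "t - P 0 + 1"] continuous_on_subset[OF P_cont]
    by auto
qed

lemma fibre: "P x = t \<longleftrightarrow> lo P t \<le> x \<and> x \<le> hi P t"
  and P_lo [simp]: "P (lo P t) = t" and P_hi [simp]: "P (hi P t) = t"
proof -
  let ?S = "{x. P x = t}"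
  have "?S = P -` {t}" by auto
  moreover have "closed (P -` {t})"
    using P_cont by (intro continuous_closed_vimage) (auto simp: continuous_on_eq_continuous_at)
  ultimately have cl: "closed ?S" by simp
  have ne: "?S \<noteq> {}" using P_surj by auto
  have "\<bar>x\<bar> \<le> \<bar>t\<bar> + \<bar>P 0\<bar> + 1" if "x \<in> ?S" for x
    using that P_bound[of x] by auto
  then have bdd: "bounded ?S" unfolding bounded_iff by (metis real_norm_def)
  have bb: "bdd_below ?S" "bdd_above ?S"
    by (rule bounded_imp_bdd_below[OF bdd] bounded_imp_bdd_above[OF bdd])+
  show lo: "P (lo P t) = t"
    using closed_contains_Inf[OF ne bb(1) cl] by (simp add: lo_def)
  show hi: "P (hi P t) = t"
    using closed_contains_Sup[OF ne bb(2) cl] by (simp add: hi_def)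
  show "P x = t \<longleftrightarrow> lo P t \<le> x \<and> x \<le> hi P t"
  proof
    assume "P x = t"
    then show "lo P t \<le> x \<and> x \<le> hi P t"
      unfolding lo_def hi_def using cInf_lower[OF _ bb(1), of x] cSup_upper[OF _ bb(2), of x] by simp
  next
    assume "lo P t \<le> x \<and> x \<le> hi P t"
    then show "P x = t" using P_le[of "lo P t" x] P_le[of x "hi P t"] lo hi by simp
  qed
qed

lemma lo_le_hi: "lo P t \<le> hi P t"
  using fibre[of "lo P t" t] by simp

lemma lo_le: "lo P (P x) \<le> x" and hi_ge: "x \<le> hi P (P x)"
  using fibre[of x "P x"] by auto

lemma hi_less_lo: "s < t \<Longrightarrow> hi P s < lo P t"
  by (rule P_less_imp) simp

lemma lo_less: "s < t \<Longrightarrow> lo P s < lo P t" and hi_less: "s < t \<Longrightarrow> hi P s < hi P t"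
  by (rule P_less_imp, simp)+

lemma endpoints_iff: "x \<in> endpoints P \<longleftrightarrow> x = lo P (P x) \<or> x = hi P (P x)"
  by (auto simp: endpoints_def)

lemma lo_in [simp]: "lo P t \<in> endpoints P" and hi_in [simp]: "hi P t \<in> endpoints P"
  by (auto simp: endpoints_def)

text \<open>An increasing bijection that shifts \<open>P\<close> by a constant permutes the fibres
  in order, so it carries left ends to left ends and right ends to right ends. Integer translations
  and \<open>f\<close> are the two instances.\<close>

lemma shift_eqI:
  assumes "strict_mono g" "surj g" "\<And>x. P (g x) = P x + a"
  shows "lo P (t + a) = g (lo P t)" "hi P (t + a) = g (hi P t)"
proof -
  have le: "g x \<le> g y \<longleftrightarrow> x \<le> y" for x y using assms(1) strict_mono_less_eq by blast
  obtain u v where uv: "lo P (t + a) = g u" "hi P (t + a) = g v" using assms(2) by (meson surjD)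
  have fg: "P x = t \<longleftrightarrow> u \<le> x \<and> x \<le> v" for x
    using fibre[of "g x" "t + a"] uv le assms(3) by simp
  have "u \<le> v" using lo_le_hi[of "t + a"] uv le by simp
  then have "u \<le> lo P t" "hi P t \<le> v" "lo P t \<le> u" "v \<le> hi P t"
    using fg[of "lo P t"] fg[of "hi P t"] fg[of u] fg[of v] fibre[of u t] fibre[of v t] by simp_all
  then have "lo P t = u \<and> hi P t = v" by simp
  with uv show "lo P (t + a) = g (lo P t)" "hi P (t + a) = g (hi P t)" by auto
qed

lemma lo_add_int: "lo P (t + of_int m) = lo P t + of_int m"
  and hi_add_int: "hi P (t + of_int m) = hi P t + of_int m"
proof -
  have "surj (\<lambda>x::real. x + of_int m)" by (rule surjI[of _ "\<lambda>x. x - of_int m"]) simp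
  then show "lo P (t + of_int m) = lo P t + of_int m" "hi P (t + of_int m) = hi P t + of_int m"
    using shift_eqI[of "\<lambda>x. x + of_int m" "of_int m" t] by (auto simp: strict_mono_def P_add_int)
qed

lemma endpoints_add_int [simp]: "x + of_int m \<in> endpoints P \<longleftrightarrow> x \<in> endpoints P"
  by (simp add: endpoints_iff P_add_int lo_add_int hi_add_int)

lemma endpoints_add_1 [simp]: "x + 1 \<in> endpoints P \<longleftrightarrow> x \<in> endpoints P"
  using endpoints_add_int[of x 1] by simp

lemma gaps_add_int [simp]: "t + of_int m \<in> gaps P \<longleftrightarrow> t \<in> gaps P"
  by (simp add: gaps_def lo_add_int hi_add_int)

text \<open>What is missing from the line is the union of the open interiors of the fibres.\<close>

lemma closed_endpoints: "closed (endpoints P)"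
proof -
  have "- endpoints P = (\<Union>t. {lo P t<..<hi P t})"
  proof (intro set_eqI iffI)
    fix x assume "x \<in> - endpoints P"
    then have "lo P (P x) < x \<and> x < hi P (P x)"
      using lo_le[of x] hi_ge[of x] by (auto simp: endpoints_iff)
    then show "x \<in> (\<Union>t. {lo P t<..<hi P t})" by auto
  next
    fix x assume "x \<in> (\<Union>t. {lo P t<..<hi P t})"
    then obtain t where t: "lo P t < x" "x < hi P t" by auto
    then have "P x = t" using fibre[of x t] by auto
    with t show "x \<in> - endpoints P" by (auto simp: endpoints_iff)
  qed
  moreover have "open (\<Union>t. {lo P t<..<hi P t})" by (intro open_UN ballI open_greaterThanLessThan)
  ultimately show ?thesis by (simp add: closed_def)
qed

lemma no_endpoint_between: "x \<in> endpoints P \<Longrightarrow> lo P t < x \<Longrightarrow> x < hi P t \<Longrightarrow> False"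
  using fibre[of x t] by (auto simp: endpoints_iff)

text \<open>Used by contradiction: a strictly increasing \<open>P\<close> would be a conjugacy with
  the rotation, which a Denjoy homeomorphism excludes.\<close>

lemma no_gaps_imp_strict_mono: "gaps P = {} \<Longrightarrow> strict_mono P"
proof -
  assume "gaps P = {}"
  then have eq: "lo P t = hi P t" for t using lo_le_hi[of t] using \<open>gaps P = {}\<close> by (simp add: gaps_def set_eq_iff not_less antisym)
  show "strict_mono P"
  proof (rule strict_monoI)
    fix x y :: real assume "x < y"
    have "P x \<noteq> P y"
      using fibre[of x "P x"] fibre[of y "P x"] eq[of "P x"] \<open>x < y\<close> by auto
    then show "P x < P y" using P_le[of x y] \<open>x < y\<close> by simp
  qed
qed

end

section \<open>Irrational translations and Denjoy lifts\<close>

lemma int_dense_irrational: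
  assumes "\<alpha> \<notin> \<rat>" "a < b"
  obtains i :: nat and m :: int where "i > 0" "a < real i * \<alpha> + of_int m" "real i * \<alpha> + of_int m < b"
proof -
  obtain h k where k: "k > 0" "\<bar>of_int k * \<alpha> - of_int h - (a + b) / 2\<bar> < (b - a) / 2"
    using sequence_of_fractional_parts_is_dense[of \<alpha> "(b - a) / 2" "(a + b) / 2"] assms
    by (metis diff_gt_0_iff_gt half_gt_zero)
  show thesis
  proof (rule that[of "nat k" "-h"])
    show "nat k > 0" using k by simp
    show "a < real (nat k) * \<alpha> + of_int (- h)" "real (nat k) * \<alpha> + of_int (- h) < b"
      using k by (auto simp: abs_less_iff field_simps)
  qed
qed

lemma irrational_comb_eq:
  assumes "\<alpha> \<notin> \<rat>" "of_int a + of_int b * \<alpha> = of_int c + of_int d * \<alpha>"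
  shows "a = c \<and> b = d"
proof -
  have "b = d"
  proof (rule ccontr)
    assume "b \<noteq> d"
    then have "\<alpha> = (of_int c - of_int a) / (of_int b - of_int d)"
      using assms(2) by (simp add: field_simps)
    then show False using assms(1) by simp
  qed
  then show ?thesis using assms(2) by simp
qed

text \<open>Positivity of \<open>\<alpha>\<close> is no restriction, since an integer can be added to the lift; it makes the
  orbits of \<open>f\<close> run to the right, so that half-lines are forward invariant.\<close>

locale denjoy_lift = degree_one P for P +
  fixes f :: "real \<Rightarrow> real" and \<alpha> :: real
  assumes f_mono: "strict_mono f" and f_cont: "continuous_on UNIV f" and f_add_1: "f (x + 1) = f x + 1"
    and P_f: "P (f x) = P x + \<alpha>"
    and irrational: "\<alpha> \<notin> \<rat>" and pos: "\<alpha> > 0"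
    and gaps_nonempty: "gaps P \<noteq> {}"
begin

sublocale f: degree_one f
  using f_mono f_cont f_add_1 by unfold_locales (auto intro: strict_mono_mono)

lemma f_surj: "surj f"
  using f.P_surj by (metis surj_def)

lemma bij_f: "bij f"
  using f_surj f_mono by (simp add: bij_def strict_mono_imp_inj_on)

lemma lo_f: "lo P (t + \<alpha>) = f (lo P t)" and hi_f: "hi P (t + \<alpha>) = f (hi P t)"
  using shift_eqI[OF f_mono f_surj P_f] by auto

lemma f_eq_iff [simp]: "f x = f y \<longleftrightarrow> x = y"
  using f_mono strict_mono_eq by blast

lemma f_endpoints_iff [simp]: "f x \<in> endpoints P \<longleftrightarrow> x \<in> endpoints P"
  by (simp add: endpoints_iff P_f lo_f hi_f)

lemma f_image_endpoints: "f ` endpoints P = endpoints P"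
proof
  show "endpoints P \<subseteq> f ` endpoints P"
  proof
    fix x assume x: "x \<in> endpoints P"
    obtain y where "x = f y" using f_surj by (meson surjD)
    then show "x \<in> f ` endpoints P" using x by simp
  qed
qed (simp add: image_subset_iff)

lemma gaps_add_alpha [simp]: "t + \<alpha> \<in> gaps P \<longleftrightarrow> t \<in> gaps P"
  using f_mono by (simp add: gaps_def lo_f hi_f strict_mono_less)

lemma funpow_add_int: "(f ^^ i) (x + of_int m) = (f ^^ i) x + of_int m"
  by (induction i) (auto simp: f.P_add_int)

lemma P_funpow: "P ((f ^^ i) x) = P x + real i * \<alpha>"
  by (induction i) (auto simp: P_f algebra_simps)

lemma funpow_endpoints [simp]: "(f ^^ i) x \<in> endpoints P \<longleftrightarrow> x \<in> endpoints P"
  by (induction i) auto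

lemma lo_funpow: "lo P (t + real i * \<alpha>) = (f ^^ i) (lo P t)"
  and hi_funpow: "hi P (t + real i * \<alpha>) = (f ^^ i) (hi P t)"
proof (induction i)
  case (Suc i)
  have e: "t + real (Suc i) * \<alpha> = (t + real i * \<alpha>) + \<alpha>" by (simp add: algebra_simps)
  { case 1 show ?case using Suc unfolding e lo_f by simp }
  { case 2 show ?case using Suc unfolding e hi_f by simp }
qed simp_all

lemma power:
  assumes "n > 0"
  shows "denjoy_lift P (f ^^ n) (real n * \<alpha>)"
proof unfold_locales
  show "strict_mono (f ^^ n)"
    by (induction n) (use f_mono in \<open>auto simp: strict_mono_def\<close>)
  show "continuous_on UNIV (f ^^ n)"
  proof (induction n)
    case (Suc n)
    have "continuous_on UNIV (f \<circ> (f ^^ n))"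
      using Suc f_cont by (intro continuous_on_compose) (auto intro: continuous_on_subset)
    then show ?case by simp
  qed (simp add: id_def)
  show "(f ^^ n) (x + 1) = (f ^^ n) x + 1" for x using funpow_add_int[of n x 1] by simp
  show "P ((f ^^ n) x) = P x + real n * \<alpha>" for x by (rule P_funpow)
  show "real n * \<alpha> \<notin> \<rat>"
  proof
    assume "real n * \<alpha> \<in> \<rat>"
    then have "(real n * \<alpha>) / real n \<in> \<rat>" by (intro Rats_divide) auto
    then show False using assms irrational by simp
  qed
  show "real n * \<alpha> > 0" using assms pos by simp
qed (rule gaps_nonempty)

end

subsection \<open>Circle-valued functions\<close>

text \<open>The circle inside the complex plane serves for functions on the systems: values can be
  divided there, and theorems on continuous logarithms apply. The period is normalised to 1.\<close>

definition ee :: "real \<Rightarrow> complex" where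
  "ee t = cis (2 * pi * t)"

lemma ee_add: "ee (s + t) = ee s * ee t"
  by (simp add: ee_def cis_mult ring_distribs)

lemma ee_0 [simp]: "ee 0 = 1"
  by (simp add: ee_def)

lemma ee_minus: "ee (- t) = inverse (ee t)"
  by (simp add: ee_def)

lemma ee_diff: "ee (s - t) = ee s / ee t"
  using ee_add[of s "-t"] by (simp add: ee_minus divide_inverse)

lemma norm_ee [simp]: "norm (ee t) = 1"
  by (simp add: ee_def)

lemma ee_nonzero [simp]: "ee t \<noteq> 0"
  by (simp add: ee_def)

lemma ee_of_int [simp]: "ee (of_int n) = 1"
  by (simp add: ee_def)

lemma ee_add_int [simp]: "ee (t + of_int n) = ee t"
  by (simp add: ee_add)

lemma continuous_on_ee [continuous_intros]: "continuous_on S g \<Longrightarrow> continuous_on S (\<lambda>x. ee (g x))"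
  unfolding ee_def by (intro continuous_intros)

lemma ee_eq_iff: "ee s = ee t \<longleftrightarrow> (\<exists>n::int. s = t + of_int n)"
proof
  assume "ee s = ee t"
  then obtain n :: int where "\<i> * of_real (2 * pi * s) = \<i> * of_real (2 * pi * t) + (of_int (2 * n) * pi) * \<i>"
    unfolding ee_def cis_conv_exp exp_eq by blast
  then have "\<i> * of_real (2 * pi * s) = \<i> * of_real (2 * pi * (t + of_int n))"
    by (simp add: algebra_simps)
  then have "2 * pi * s = 2 * pi * (t + of_int n)"
    by (metis complex_i_not_zero mult_cancel_left of_real_eq_iff)
  then show "\<exists>n::int. s = t + of_int n" by (intro exI[of _ n]) simp
qed auto

lemma ee_irrational_cancel:
  assumes "\<beta> \<notin> \<rat>" "ee (\<beta> * of_int a) = ee (\<beta> * of_int b)"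
  shows "a = b"
proof -
  obtain n :: int where "\<beta> * of_int a = \<beta> * of_int b + of_int n"
    using assms(2) ee_eq_iff by blast
  then show ?thesis
    using irrational_comb_eq[OF assms(1), of 0 a n b] by (simp add: algebra_simps)
qed

text \<open>Irrationality keeps the finitely many values with nonzero bounded \<open>j\<close> away
  from 1. This turns closeness on the circle into equality of bounded integers.\<close>

lemma ee_separated:
  assumes "\<beta> \<notin> \<rat>"
  obtains \<eta> where "\<eta> > 0" "\<And>j::int. \<bar>j\<bar> \<le> C \<Longrightarrow> norm (ee (\<beta> * of_int j) - 1) < \<eta> \<Longrightarrow> j = 0"
proof -
  let ?A = "(\<lambda>j. norm (ee (\<beta> * of_int j) - 1)) ` ({-C..C} - {0})"
  have pos: "y > 0" if "y \<in> ?A" for y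
    using that ee_irrational_cancel[OF assms, of _ 0] by auto
  \<comment> \<open>The extra element 1 keeps the minimum meaningful when there is no nonzero
    \<open>j\<close> in range.\<close>
  show thesis
  proof (rule that[of "Min (insert 1 ?A)"])
    show "Min (insert 1 ?A) > 0" using pos by simp
    fix j :: int
    assume j: "\<bar>j\<bar> \<le> C" "norm (ee (\<beta> * of_int j) - 1) < Min (insert 1 ?A)"
    show "j = 0"
    proof (rule ccontr)
      assume "j \<noteq> 0"
      then have "norm (ee (\<beta> * of_int j) - 1) \<in> insert 1 ?A" using j(1) by (intro insertI2 imageI) auto
      then have "Min (insert 1 ?A) \<le> norm (ee (\<beta> * of_int j) - 1)"
        by (intro Min_le) auto
      with j(2) show False by linarith
    qed
  qed
qed

lemma continuous_ee_lift_convex: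
  fixes g :: "real \<Rightarrow> complex"
  assumes "convex S" "continuous_on S g" "\<And>x. x \<in> S \<Longrightarrow> norm (g x) = 1"
  obtains h where "continuous_on S h" "\<And>x. x \<in> S \<Longrightarrow> g x = ee (h x)"
proof -
  have "Borsukian S" using assms(1) by (rule convex_imp_Borsukian)
  then obtain h where h: "continuous_on S (complex_of_real \<circ> h)" "\<forall>x\<in>S. g x = exp (\<i> * of_real (h x))"
    unfolding Borsukian_continuous_logarithm_circle_real using assms(2,3) by (auto simp: Pi_iff)
  have "continuous_on S (\<lambda>x. Re ((complex_of_real \<circ> h) x) / (2 * pi))"
    using h(1) by (intro continuous_intros) auto
  then show thesis
    using h(2) by (intro that[of "\<lambda>x. h x / (2 * pi)"]) (auto simp: ee_def cis_conv_exp)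
qed

text \<open>A compact subset of the real axis does not separate the plane: each open half-plane can
  be enlarged by the rest of the axis and stays connected. By Borsuk's criterion, circle-valued maps
  on such a set have continuous logarithms.\<close>

lemma continuous_ee_lift_compact:
  fixes g :: "real \<Rightarrow> complex"
  assumes "compact K" "continuous_on K g" "\<And>x. x \<in> K \<Longrightarrow> norm (g x) = 1"
  obtains h where "continuous_on K h" "\<And>x. x \<in> K \<Longrightarrow> g x = ee (h x)"
proof -
  let ?L = "complex_of_real ` K"
  have cK: "compact ?L" using assms(1) by (intro compact_continuous_image continuous_intros) auto
  let ?R = "{z. Im z = 0} - ?L"
  have halfspace: "connected (H \<union> ?R)" if "convex H" "{z. Im z = 0} \<subseteq> closure H" for H
  proof (rule connected_intermediate_closure)
    show "connected H" using that(1) by (rule convex_connected)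
    show "H \<union> ?R \<subseteq> closure H" using that(2) closure_subset by auto
  qed simp
  have axis: "z \<in> closure {w. Im w > 0}" "z \<in> closure {w. Im w < 0}" if "Im z = 0" for z
  proof -
    have "dist (z + \<i> * of_real (e / 2)) z < e" "dist (z - \<i> * of_real (e / 2)) z < e" if "e > 0" for e
      using that by (simp_all add: dist_norm norm_mult)
    moreover have "Im (z + \<i> * of_real (e / 2)) > 0" "Im (z - \<i> * of_real (e / 2)) < 0" if "e > 0" for e
      using that \<open>Im z = 0\<close> by simp_all
    ultimately show "z \<in> closure {w. Im w > 0}" "z \<in> closure {w. Im w < 0}"
      unfolding closure_approachable by blast+
  qed
  have conn: "connected ({z. Im z > 0} \<union> ?R)" "connected ({z. Im z < 0} \<union> ?R)"
    by (intro halfspace convex_halfspace_Im_gt convex_halfspace_Im_lt subsetI axis, simp)+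
  obtain b where b: "\<And>x. x \<in> K \<Longrightarrow> \<bar>x\<bar> \<le> b"
    using compact_imp_bounded[OF assms(1)] by (auto simp: bounded_iff)
  \<comment> \<open>This point of the axis lies in both enlarged half-planes and connects
    them.\<close>
  have "\<bar>b\<bar> + 1 \<notin> K" using b[of "\<bar>b\<bar> + 1"] by auto
  then have "complex_of_real (\<bar>b\<bar> + 1) \<in> ?R" by (auto simp del: of_real_add)
  then have "({z. Im z > 0} \<union> ?R) \<inter> ({z. Im z < 0} \<union> ?R) \<noteq> {}" by blast
  then have "connected (({z. Im z > 0} \<union> ?R) \<union> ({z. Im z < 0} \<union> ?R))"
    by (rule connected_Un[OF conn])
  moreover have "({z. Im z > 0} \<union> ?R) \<union> ({z. Im z < 0} \<union> ?R) = - ?L"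
  proof (rule set_eqI)
    fix z :: complex
    have "Im z = 0" if "z \<in> ?L" using that by auto
    then show "z \<in> ({z. Im z > 0} \<union> ?R) \<union> ({z. Im z < 0} \<union> ?R) \<longleftrightarrow> z \<in> - ?L"
      by (cases "z \<in> ?L") (simp_all, linarith)
  qed
  ultimately have "connected (- ?L)" by simp
  then have "Borsukian ?L" using Borsukian_separation_compact[OF cK] by simp
  moreover have "continuous_on ?L (g \<circ> Re)"
    unfolding o_def
    by (rule continuous_on_compose2[OF assms(2) continuous_on_Re[OF continuous_on_id]]) auto
  moreover have "(g \<circ> Re) \<in> ?L \<rightarrow> sphere 0 1" using assms(3) by auto
  ultimately obtain h where h: "continuous_on ?L (complex_of_real \<circ> h)"
      "\<forall>x\<in>?L. (g \<circ> Re) x = exp (\<i> * of_real (h x))"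
    unfolding Borsukian_continuous_logarithm_circle_real by blast
  have "continuous_on ?L h" using h(1) by simp
  then have "continuous_on K (\<lambda>x. h (of_real x))"
    by (rule continuous_on_compose2) (auto intro: continuous_on_of_real continuous_on_id)
  then have "continuous_on K (\<lambda>x. h (of_real x) / (2 * pi))"
    by (intro continuous_intros) auto
  moreover have "g x = ee (h (of_real x) / (2 * pi))" if "x \<in> K" for x
    using bspec[OF h(2) imageI[OF that]] by (simp add: ee_def cis_conv_exp)
  ultimately show thesis by (rule that)
qed

text \<open>Subtracting the linear function with the same value at 1 leaves an additive function
  that vanishes at 1. It is determined by its values on [0, 1], hence bounded, and a bounded
  additive function vanishes.\<close>

lemma additive_continuous_linear:
  fixes \<phi> :: "real \<Rightarrow> real"
  assumes cont: "continuous_on {0..} \<phi>"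
    and add: "\<And>s t. s \<ge> 0 \<Longrightarrow> t \<ge> 0 \<Longrightarrow> \<phi> (s + t) = \<phi> s + \<phi> t"
    and "t \<ge> 0"
  shows "\<phi> t = t * \<phi> 1"
proof -
  define \<psi> where "\<psi> t = \<phi> t - t * \<phi> 1" for t
  have \<psi>_add: "\<psi> (s + t) = \<psi> s + \<psi> t" if "s \<ge> 0" "t \<ge> 0" for s t
    using add[OF that] by (simp add: \<psi>_def algebra_simps)
  have "\<psi> 1 = 0" by (simp add: \<psi>_def)
  have mult: "\<psi> (real n * s) = real n * \<psi> s" if "s \<ge> 0" for n s
  proof (induction n)
    case 0
    show ?case using \<psi>_add[of 0 0] by simp
  next
    case (Suc n)
    have "\<psi> (real (Suc n) * s) = \<psi> (real n * s + s)" by (simp add: algebra_simps)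
    then show ?case using Suc \<psi>_add[of "real n * s" s] that by (simp add: algebra_simps)
  qed
  have "continuous_on {0..1} \<psi>"
    unfolding \<psi>_def by (intro continuous_intros continuous_on_subset[OF cont]) auto
  then have "bounded (\<psi> ` {0..1})"
    by (intro compact_imp_bounded compact_continuous_image) auto
  then obtain B where "\<forall>s\<in>{0..1}. \<bar>\<psi> s\<bar> \<le> B"
    by (auto simp: bounded_iff)
  then have B: "\<And>s. 0 \<le> s \<Longrightarrow> s \<le> 1 \<Longrightarrow> \<bar>\<psi> s\<bar> \<le> B" by simp
  have bound: "\<bar>\<psi> s\<bar> \<le> B" if "s \<ge> 0" for s
  proof -
    have "\<psi> s = \<psi> (real (nat \<lfloor>s\<rfloor>) * 1 + frac s)"
      using that by (simp add: frac_def)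
    also have "\<dots> = \<psi> (frac s)"
      using \<psi>_add[of "real (nat \<lfloor>s\<rfloor>) * 1" "frac s"] mult[of 1 "nat \<lfloor>s\<rfloor>"] \<open>\<psi> 1 = 0\<close> by simp
    finally show ?thesis using B[of "frac s"] frac_lt_1[of s] by simp
  qed
  have "\<psi> t = 0"
  proof (rule ccontr)
    assume "\<psi> t \<noteq> 0"
    then obtain n :: nat where "real n * \<bar>\<psi> t\<bar> > B"
      using reals_Archimedean3[of "\<bar>\<psi> t\<bar>"] by auto
    moreover have "real n * \<bar>\<psi> t\<bar> = \<bar>\<psi> (real n * t)\<bar>"
      using mult[OF assms(3), of n] by (simp add: abs_mult)
    ultimately show False using bound[of "real n * t"] assms(3) by simp
  qed
  then show ?thesis by (simp add: \<psi>_def)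
qed

text \<open>A continuous lift is additive up to an integer defect, and continuity in one variable
  makes this defect constant. The domain is a half-line because jumps will be counted from
  0.\<close>

lemma continuous_hom_ee:
  fixes w :: "real \<Rightarrow> complex"
  assumes cont: "continuous_on {0..} w" and norm1: "\<And>t. t \<ge> 0 \<Longrightarrow> norm (w t) = 1"
    and mult: "\<And>s t. s \<ge> 0 \<Longrightarrow> t \<ge> 0 \<Longrightarrow> w (s + t) = w s * w t"
  obtains c where "\<And>t. t \<ge> 0 \<Longrightarrow> w t = ee (c * t)"
proof -
  obtain g where g: "continuous_on {0..} g" "\<And>t. t \<in> {0..} \<Longrightarrow> w t = ee (g t)"
    by (rule continuous_ee_lift_convex[OF convex_real_interval(1) cont]) (simp_all add: norm1)
  have "w 0 * w 0 = w 0" using mult[of 0 0] by (metis add_0 order_refl)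
  moreover have "w 0 \<noteq> 0" using norm1[of 0] by auto
  ultimately have "w 0 = 1" by simp
  define \<phi> where "\<phi> t = g t - g 0" for t
  have ee\<phi>: "w t = ee (\<phi> t)" if "t \<ge> 0" for t
    using g(2)[of t] g(2)[of 0] that \<open>w 0 = 1\<close> by (simp add: \<phi>_def ee_diff)
  have cont\<phi>: "continuous_on {0..} \<phi>"
    unfolding \<phi>_def using g(1) by (intro continuous_intros)
  have "\<phi> (s + t) = \<phi> s + \<phi> t" if s: "s \<ge> 0" and t: "t \<ge> 0" for s t
  proof -
    define \<delta> where "\<delta> t = \<phi> (s + t) - \<phi> s - \<phi> t" for t
    have "continuous_on {0..} (\<lambda>t. \<phi> (s + t))"
      by (rule continuous_on_compose2[OF cont\<phi>]) (use s in \<open>auto intro: continuous_on_add continuous_on_id\<close>)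
    then have "continuous_on {0..} \<delta>" unfolding \<delta>_def
      by (intro continuous_on_diff cont\<phi> continuous_on_const)
    then have conn: "connected (\<delta> ` {0..})"
      by (rule connected_continuous_image) (rule connected_Ici)
    have "\<delta> t \<in> range (of_int :: int \<Rightarrow> real)" if "t \<ge> 0" for t
    proof -
      have "ee (\<phi> (s + t)) = ee (\<phi> s + \<phi> t)"
        using mult[of s t] ee\<phi>[of s] ee\<phi>[of t] ee\<phi>[of "s + t"] s that by (simp add: ee_add)
      then show ?thesis unfolding ee_eq_iff \<delta>_def by auto
    qed
    then have "\<delta> ` {0..} \<subseteq> range (of_int :: int \<Rightarrow> real)"
      by (intro image_subsetI) simp
    \<comment> \<open>A countable connected set of reals has at most one point.\<close>
    then have "countable (\<delta> ` {0..})"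
      by (rule countable_subset) simp
    moreover have "\<delta> t \<in> \<delta> ` {0..}" "\<delta> 0 \<in> \<delta> ` {0..}" using t by (intro imageI, simp)+
    ultimately have "\<delta> t = \<delta> 0"
      using connected_uncountable[OF conn, of "\<delta> t" "\<delta> 0"] by metis
    then show ?thesis by (simp add: \<delta>_def \<phi>_def)
  qed
  note additive = this
  show thesis
  proof (rule that)
    fix t :: real assume t: "t \<ge> 0"
    have "\<phi> t = t * \<phi> 1" by (rule additive_continuous_linear[OF cont\<phi> additive t])
    then show "w t = ee (\<phi> 1 * t)" using ee\<phi>[OF t] by (simp only: mult.commute)
  qed
qed

subsection \<open>Integer cocycles over a Denjoy lift\<close>

context degree_one
begin

lemma compact_endpoints_Icc: "compact (endpoints P \<inter> {a..b})"
  using closed_endpoints by (simp add: closed_Int_compact)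

lemma periodic_add_int:
  assumes "\<And>x. x \<in> endpoints P \<Longrightarrow> g (x + 1) = g x" "x \<in> endpoints P"
  shows "g (x + of_int m) = g x"
proof (induction m rule: int_induct[of _ 0])
  case base
  show ?case by simp
next
  case (step1 i)
  have "g (x + of_int (i + 1)) = g ((x + of_int i) + 1)" by (simp add: add.assoc)
  then show ?case using assms(1)[of "x + of_int i"] assms(2) step1 by simp
next
  case (step2 i)
  have "x + of_int (i - 1) \<in> endpoints P" using assms(2) by (simp only: endpoints_add_int)
  then have "g (x + of_int (i - 1)) = g (x + of_int (i - 1) + 1)" using assms(1) by metis
  also have "x + of_int (i - 1) + 1 = x + of_int i" by simp
  finally show ?case using step2 by simp
qed

text \<open>The window \<open>{-1..2}\<close> extends a unit beyond the period [0, 1] on both sides,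
  so one integer translation brings two points at distance below 1 into it. Compactness there gives
  both claims.\<close>

lemma
  fixes g :: "real \<Rightarrow> 'b::real_normed_vector"
  assumes cont: "continuous_on (endpoints P) g"
    and periodic: "\<And>x. x \<in> endpoints P \<Longrightarrow> g (x + 1) = g x"
  shows periodic_bounded: "bounded (g ` endpoints P)"
    and periodic_uniformly_continuous: "uniformly_continuous_on (endpoints P) g"
proof -
  let ?K = "endpoints P \<inter> {-1..2}"
  have contK: "continuous_on ?K g" using cont by (rule continuous_on_subset) auto
  have shift: "g (x - of_int m) = g x" if "x \<in> endpoints P" for x m
    using periodic_add_int[of g x "-m"] periodic that by simp
  have mem: "x - of_int m \<in> endpoints P" if "x \<in> endpoints P" for x m
    using endpoints_add_int[of x "-m"] that by simp
  have "g ` endpoints P \<subseteq> g ` ?K"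
  proof (rule image_subsetI)
    fix x assume x: "x \<in> endpoints P"
    have "x - of_int \<lfloor>x\<rfloor> \<in> ?K" using mem[OF x, of "\<lfloor>x\<rfloor>"] by simp linarith
    then show "g x \<in> g ` ?K" using shift[OF x, of "\<lfloor>x\<rfloor>"] by (metis imageI)
  qed
  then show "bounded (g ` endpoints P)"
    using compact_imp_bounded[OF compact_continuous_image[OF contK compact_endpoints_Icc]]
    by (rule bounded_subset[rotated])
  have uc: "uniformly_continuous_on ?K g"
    by (rule compact_uniformly_continuous[OF contK compact_endpoints_Icc])
  show "uniformly_continuous_on (endpoints P) g"
    unfolding uniformly_continuous_on_def
  proof (intro allI impI)
    fix e :: real assume "e > 0"
    then obtain d where d: "d > 0" "\<And>x x'. x \<in> ?K \<Longrightarrow> x' \<in> ?K \<Longrightarrow> dist x' x < d \<Longrightarrow> dist (g x') (g x) < e"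
      using uc unfolding uniformly_continuous_on_def by metis
    have "dist (g x') (g x) < e"
      if x: "x \<in> endpoints P" and x': "x' \<in> endpoints P" and dx: "dist x' x < min d 1" for x x'
    proof -
      let ?m = "\<lfloor>x\<rfloor>"
      have r: "0 \<le> x - of_int ?m" "x - of_int ?m < 1" by linarith+
      have "\<bar>x' - x\<bar> < 1" using dx by (simp add: dist_real_def)
      then have "-1 \<le> x - of_int ?m" "-1 \<le> x' - of_int ?m" "x' - of_int ?m \<le> 2" "x - of_int ?m \<le> 2"
        using r by linarith+
      then have "x - of_int ?m \<in> ?K" "x' - of_int ?m \<in> ?K"
        using mem[OF x] mem[OF x'] by simp_all
      moreover have "dist (x' - of_int ?m) (x - of_int ?m) < d" using dx by (simp add: dist_real_def)
      ultimately show ?thesis using d(2)[of "x - of_int ?m" "x' - of_int ?m"] shift x x' by simp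
    qed
    then show "\<exists>d>0. \<forall>x\<in>endpoints P. \<forall>x'\<in>endpoints P. dist x' x < d \<longrightarrow> dist (g x') (g x) < e"
      using \<open>d > 0\<close> by (intro exI[of _ "min d 1"]) auto
  qed
qed

text \<open>Fibres are disjoint intervals, so two of length at least \<open>\<delta>\<close> have
  left ends more than \<open>\<delta>\<close> apart and fall into different cells of width
  \<open>\<delta>\<close>.\<close>

lemma finite_large_gaps:
  assumes "\<delta> > 0"
  shows "finite {t. lo P t \<in> {a..b} \<and> hi P t - lo P t \<ge> \<delta>}" (is "finite ?G")
    and "card {t. lo P t \<in> {a..b} \<and> hi P t - lo P t \<ge> \<delta>} \<le> nat (\<lfloor>b / \<delta>\<rfloor> - \<lfloor>a / \<delta>\<rfloor> + 1)"
proof -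
  let ?h = "\<lambda>t. \<lfloor>lo P t / \<delta>\<rfloor>"
  have "?h ` ?G \<subseteq> {\<lfloor>a / \<delta>\<rfloor>..\<lfloor>b / \<delta>\<rfloor>}"
    using assms by (auto intro!: floor_mono divide_right_mono)
  moreover have "inj_on ?h ?G"
  proof (rule linorder_inj_onI)
    fix s t assume st: "s < t" "s \<in> ?G"
    have "lo P s + \<delta> \<le> hi P s" using st(2) by simp
    also have "hi P s < lo P t" using st(1) by (rule hi_less_lo)
    finally have "(lo P s + \<delta>) / \<delta> < lo P t / \<delta>" using assms by (rule divide_strict_right_mono)
    then have "lo P s / \<delta> + 1 < lo P t / \<delta>" using assms by (simp add: add_divide_distrib)
    then show "?h s \<noteq> ?h t" by linarith
  qed auto
  ultimately show "finite ?G" "card ?G \<le> nat (\<lfloor>b / \<delta>\<rfloor> - \<lfloor>a / \<delta>\<rfloor> + 1)"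
    using inj_on_finite[of ?h ?G] card_inj_on_le[of ?h ?G "{\<lfloor>a / \<delta>\<rfloor>..\<lfloor>b / \<delta>\<rfloor>}"] by auto
qed

end

context denjoy_lift
begin

text \<open>Each iterate is translated by an integer so that its left end lies in [0, 1], and
  irrationality keeps the translated gaps distinct. The bound does not depend on \<open>t\<close>,
  which makes the later bound on jumps uniform.\<close>

lemma gap_iterates_large:
  fixes t :: real
  assumes "\<delta> > 0"
  defines "I \<equiv> {i. hi P (t + real i * \<alpha>) - lo P (t + real i * \<alpha>) \<ge> \<delta>}"
  shows "finite I" "card I \<le> nat (\<lfloor>1 / \<delta>\<rfloor> + 1)"
proof -
  let ?G = "{t. lo P t \<in> {0..1} \<and> hi P t - lo P t \<ge> \<delta>}"
  define m where "m i = \<lfloor>lo P (t + real i * \<alpha>)\<rfloor>" for i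
  define h where "h i = t + real i * \<alpha> + of_int (- m i)" for i
  have "h ` I \<subseteq> ?G"
  proof (rule image_subsetI)
    fix i assume "i \<in> I"
    moreover have "lo P (h i) = lo P (t + real i * \<alpha>) - of_int (m i)"
      "hi P (h i) = hi P (t + real i * \<alpha>) - of_int (m i)"
      unfolding h_def lo_add_int hi_add_int by simp_all
    moreover have "of_int (m i) \<le> lo P (t + real i * \<alpha>)" "lo P (t + real i * \<alpha>) \<le> of_int (m i) + 1"
      unfolding m_def by linarith+
    ultimately show "h i \<in> ?G" by (simp add: I_def)
  qed
  moreover have "inj_on h I"
  proof (rule inj_onI)
    fix i j assume "h i = h j"
    then have "of_int (- m i) + of_int (int i) * \<alpha> = of_int (- m j) + of_int (int j) * \<alpha>"
      by (simp add: h_def)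
    then show "i = j" using irrational_comb_eq[OF irrational] by (metis of_nat_eq_iff)
  qed
  ultimately show "finite I" "card I \<le> nat (\<lfloor>1 / \<delta>\<rfloor> + 1)"
    using finite_large_gaps[OF assms(1), of 0 1] inj_on_finite[of h I ?G] card_inj_on_le[of h I ?G]
    by auto
qed

end

text \<open>In the application, the image of the point over \<open>x\<close> is moved along the flow
  by its lifted height down to the base of the target. Then \<open>u x\<close> is the angle reached
  there, and \<open>k x\<close> is the net number of base crossings on the way from the base point
  for \<open>x\<close> to the one for \<open>f x\<close>.\<close>

locale int_cocycle = denjoy_lift P f \<alpha> for P f \<alpha> +
  fixes \<beta> :: real and u :: "real \<Rightarrow> complex" and k :: "real \<Rightarrow> int" and C :: int
  assumes beta_irrational: "\<beta> \<notin> \<rat>"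
    and u_cont: "continuous_on (endpoints P) u"
    and u_norm: "x \<in> endpoints P \<Longrightarrow> norm (u x) = 1"
    and u_add_1: "x \<in> endpoints P \<Longrightarrow> u (x + 1) = u x"
    and k_bound: "x \<in> endpoints P \<Longrightarrow> \<bar>k x\<bar> \<le> C"
    and u_f: "x \<in> endpoints P \<Longrightarrow> u (f x) = u x * ee (\<beta> * of_int (k x))"
begin

lemma u_nonzero: "x \<in> endpoints P \<Longrightarrow> u x \<noteq> 0"
  using u_norm by fastforce

lemma u_close:
  assumes "e > 0"
  obtains d where "d > 0" "\<And>x y. x \<in> endpoints P \<Longrightarrow> y \<in> endpoints P \<Longrightarrow> \<bar>x - y\<bar> < d \<Longrightarrow> norm (u x - u y) < e"
  using periodic_uniformly_continuous[OF u_cont u_add_1] assms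
  unfolding uniformly_continuous_on_def dist_norm real_norm_def by metis

text \<open>The factor \<open>ee (\<beta> * of_int (k x))\<close> is the quotient of
  \<open>u (f x)\<close> by \<open>u x\<close>, hence uniformly continuous. Its exponent is a
  bounded integer, so \<open>ee_separated\<close> forbids small changes.\<close>

lemma k_locally_constant:
  obtains d where "d > 0" "\<And>x y. x \<in> endpoints P \<Longrightarrow> y \<in> endpoints P \<Longrightarrow> \<bar>x - y\<bar> < d \<Longrightarrow> k x = k y"
proof -
  define U where "U x = u (f x) / u x" for x
  have U: "U x = ee (\<beta> * of_int (k x))" if "x \<in> endpoints P" for x
    using u_f[OF that] u_nonzero[OF that] by (simp add: U_def)
  have contf: "continuous_on (endpoints P) f" using f_cont by (rule continuous_on_subset) simp
  have "continuous_on (endpoints P) (\<lambda>x. u (f x))"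
    by (rule continuous_on_compose2[OF u_cont contf]) auto
  then have "continuous_on (endpoints P) U"
    unfolding U_def using u_cont u_nonzero by (intro continuous_on_divide) auto
  moreover have "U (x + 1) = U x" if "x \<in> endpoints P" for x
    using that by (simp add: U_def f_add_1 u_add_1)
  ultimately have uc: "uniformly_continuous_on (endpoints P) U"
    by (rule periodic_uniformly_continuous)
  obtain \<eta> where \<eta>: "\<eta> > 0" "\<And>j::int. \<bar>j\<bar> \<le> 2 * C \<Longrightarrow> norm (ee (\<beta> * of_int j) - 1) < \<eta> \<Longrightarrow> j = 0"
    using ee_separated[OF beta_irrational] by metis
  obtain d where d: "d > 0" "\<And>x y. x \<in> endpoints P \<Longrightarrow> y \<in> endpoints P \<Longrightarrow> \<bar>x - y\<bar> < d \<Longrightarrow> norm (U x - U y) < \<eta>"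
    using uc \<open>\<eta> > 0\<close> unfolding uniformly_continuous_on_def dist_norm real_norm_def by metis
  show thesis
  proof (rule that[OF \<open>d > 0\<close>])
    fix x y assume xy: "x \<in> endpoints P" "y \<in> endpoints P" "\<bar>x - y\<bar> < d"
    have "U x - U y = (ee (\<beta> * of_int (k x - k y)) - 1) * ee (\<beta> * of_int (k y))"
      using U xy by (simp add: ee_diff right_diff_distrib left_diff_distrib)
    then have "norm (ee (\<beta> * of_int (k x - k y)) - 1) = norm (U x - U y)"
      by (simp add: norm_mult)
    then have "norm (ee (\<beta> * of_int (k x - k y)) - 1) < \<eta>" using d(2)[OF xy] by simp
    moreover have "\<bar>k x - k y\<bar> \<le> 2 * C" using k_bound xy by (smt (verit))
    ultimately show "k x = k y" using \<eta>(2)[of "k x - k y"] by simp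
  qed
qed

text \<open>Birkhoff sums of \<open>k\<close> along the orbit of \<open>x\<close>.\<close>

definition K :: "nat \<Rightarrow> real \<Rightarrow> int" where
  "K i x = (\<Sum>l<i. k ((f ^^ l) x))"

lemma u_funpow: "x \<in> endpoints P \<Longrightarrow> u ((f ^^ i) x) = u x * ee (\<beta> * of_int (K i x))"
  by (induction i) (simp_all add: K_def u_f ee_add ring_distribs)

text \<open>Along the two end points of a gap the cocycle \<open>k\<close> differs only while the iterated gap is long,
  which happens a bounded number of times because the iterates are disjoint modulo \<open>\<int>\<close>.\<close>

lemma jump_bounded:
  obtains J where "\<And>t. \<exists>j::int. \<bar>j\<bar> \<le> J \<and> u (hi P t) = u (lo P t) * ee (\<beta> * of_int j)"
proof -
  obtain d where d: "d > 0" "\<And>x y. x \<in> endpoints P \<Longrightarrow> y \<in> endpoints P \<Longrightarrow> \<bar>x - y\<bar> < d \<Longrightarrow> k x = k y"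
    using k_locally_constant by blast
  define L where "L = nat (\<lfloor>1 / d\<rfloor> + 1)"
  have "\<exists>j::int. \<bar>j\<bar> \<le> 2 * C * int L \<and> u (hi P t) = u (lo P t) * ee (\<beta> * of_int j)" for t
  proof -
    let ?a = "lo P t" and ?b = "hi P t"
    let ?len = "\<lambda>i. hi P (t + real i * \<alpha>) - lo P (t + real i * \<alpha>)"
    have len: "?len i = (f ^^ i) ?b - (f ^^ i) ?a" "?len i \<ge> 0" for i
      by (simp_all only: lo_funpow hi_funpow) (metis lo_funpow hi_funpow lo_le_hi diff_ge_0_iff_ge)
    define g where "g l = k ((f ^^ l) ?a) - k ((f ^^ l) ?b)" for l
    define I where "I = {i. ?len i \<ge> d}"
    have I: "finite I" "card I \<le> L"
      using gap_iterates_large[OF \<open>d > 0\<close>, of t] by (simp_all add: I_def L_def)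
    have g0: "g l = 0" if "l \<notin> I" for l
    proof -
      have "\<bar>(f ^^ l) ?a - (f ^^ l) ?b\<bar> < d" using that len[of l] by (simp add: I_def)
      then show ?thesis using d(2)[of "(f ^^ l) ?a" "(f ^^ l) ?b"] by (simp add: g_def)
    qed
    have g1: "\<bar>g l\<bar> \<le> 2 * C" for l
      using k_bound[of "(f ^^ l) ?a"] k_bound[of "(f ^^ l) ?b"] by (simp add: g_def)
    define j where "j = (\<Sum>l\<in>I. g l)"
    have "\<bar>j\<bar> \<le> (\<Sum>l\<in>I. 2 * C)"
      unfolding j_def by (rule order_trans[OF sum_abs sum_mono]) (rule g1)
    also have "\<dots> = int (card I) * (2 * C)" by simp
    also have "\<dots> \<le> int L * (2 * C)"
      using I(2) k_bound[of ?a] by (intro mult_right_mono) auto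
    also have "\<dots> = 2 * C * int L" by simp
    finally have jb: "\<bar>j\<bar> \<le> 2 * C * int L" .
    \<comment> \<open>After the last long iterate of the gap, the Birkhoff sums at its two ends
      differ by the constant \<open>j\<close>.\<close>
    obtain i0 where i0: "\<And>i. i \<in> I \<Longrightarrow> i < i0"
      using I(1) by (metis finite_nat_set_iff_bounded)
    have Kdiff: "K i ?a - K i ?b = j" if "i \<ge> i0" for i
    proof -
      have "K i ?a - K i ?b = (\<Sum>l<i. g l)" by (simp add: K_def g_def sum_subtractf)
      also have "\<dots> = j"
        unfolding j_def using i0 that g0 by (intro sum.mono_neutral_right) force+
      finally show ?thesis .
    qed
    \<comment> \<open>Late iterates of the gap are arbitrarily short, so \<open>u\<close> nearly
      agrees at their ends. The two values there carry a common factor of modulus 1, and dividing by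
      it brings the estimate back to the gap itself.\<close>
    have "norm (u ?b - u ?a * ee (\<beta> * of_int j)) < e" if "e > 0" for e
    proof -
      obtain d' where d': "d' > 0" "\<And>x y. x \<in> endpoints P \<Longrightarrow> y \<in> endpoints P \<Longrightarrow> \<bar>x - y\<bar> < d' \<Longrightarrow> norm (u x - u y) < e"
        using u_close[OF \<open>e > 0\<close>] by blast
      have "finite ({i. ?len i \<ge> d'} \<union> {..<i0})"
        using gap_iterates_large(1)[OF \<open>d' > 0\<close>, of t] by simp
      then obtain i where "i \<notin> {i. ?len i \<ge> d'} \<union> {..<i0}" using ex_new_if_finite[OF infinite_UNIV_nat] by blast
      then have i: "?len i < d'" "i \<ge> i0" by auto
      have "u ((f ^^ i) ?b) - u ((f ^^ i) ?a) = u ?b * ee (\<beta> * of_int (K i ?b)) - u ?a * ee (\<beta> * of_int (K i ?a))"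
        by (simp add: u_funpow)
      also have "K i ?a = K i ?b + j" using Kdiff[OF i(2)] by simp
      finally have "u ((f ^^ i) ?b) - u ((f ^^ i) ?a) = (u ?b - u ?a * ee (\<beta> * of_int j)) * ee (\<beta> * of_int (K i ?b))"
        by (simp add: ee_add ring_distribs)
      then have "norm (u ((f ^^ i) ?b) - u ((f ^^ i) ?a)) = norm (u ?b - u ?a * ee (\<beta> * of_int j))"
        by (simp add: norm_mult)
      moreover have "norm (u ((f ^^ i) ?b) - u ((f ^^ i) ?a)) < e"
        using i(1) len[of i] by (intro d'(2)) auto
      ultimately show ?thesis by simp
    qed
    then have "u ?b = u ?a * ee (\<beta> * of_int j)"
      by (metis less_irrefl norm_eq_zero norm_ge_zero order_le_less right_minus_eq)
    then show ?thesis using jb by blast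
  qed
  then show thesis by (rule that)
qed

definition jump :: "real \<Rightarrow> int" where
  "jump t = (SOME j. u (hi P t) = u (lo P t) * ee (\<beta> * of_int j))"

lemma u_hi: "u (hi P t) = u (lo P t) * ee (\<beta> * of_int (jump t))"
proof -
  have "\<exists>j. u (hi P t) = u (lo P t) * ee (\<beta> * of_int j)" using jump_bounded by metis
  then show ?thesis unfolding jump_def by (rule someI_ex)
qed

lemma jump_eqI: "u (hi P t) = u (lo P t) * ee (\<beta> * of_int j) \<Longrightarrow> jump t = j"
  using u_hi[of t] u_nonzero[of "lo P t"] ee_irrational_cancel[OF beta_irrational] by simp

lemma jump_eq_0: "lo P t = hi P t \<Longrightarrow> jump t = 0"
  by (rule jump_eqI) simp

text \<open>Jumps are bounded integers and \<open>u\<close> varies little across a short gap, so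
  \<open>ee_separated\<close> leaves only the value 0.\<close>

lemma jump_small_gap:
  obtains d where "d > 0" "\<And>t. hi P t - lo P t < d \<Longrightarrow> jump t = 0"
proof -
  obtain J where J: "\<And>t. \<exists>j::int. \<bar>j\<bar> \<le> J \<and> u (hi P t) = u (lo P t) * ee (\<beta> * of_int j)"
    using jump_bounded by blast
  have jb: "\<bar>jump t\<bar> \<le> J" for t using J[of t] jump_eqI by blast
  obtain \<eta> where \<eta>: "\<eta> > 0" "\<And>j::int. \<bar>j\<bar> \<le> J \<Longrightarrow> norm (ee (\<beta> * of_int j) - 1) < \<eta> \<Longrightarrow> j = 0"
    using ee_separated[OF beta_irrational] by metis
  obtain d where d: "d > 0" "\<And>x y. x \<in> endpoints P \<Longrightarrow> y \<in> endpoints P \<Longrightarrow> \<bar>x - y\<bar> < d \<Longrightarrow> norm (u x - u y) < \<eta>"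
    using u_close[OF \<open>\<eta> > 0\<close>] by blast
  show thesis
  proof (rule that[OF \<open>d > 0\<close>])
    fix t assume "hi P t - lo P t < d"
    then have "norm (u (hi P t) - u (lo P t)) < \<eta>" using lo_le_hi[of t] by (intro d(2)) auto
    moreover have "u (hi P t) - u (lo P t) = u (lo P t) * (ee (\<beta> * of_int (jump t)) - 1)"
      using u_hi[of t] by (simp add: right_diff_distrib)
    ultimately have "norm (ee (\<beta> * of_int (jump t)) - 1) < \<eta>"
      by (simp add: norm_mult u_norm)
    then show "jump t = 0" using \<eta>(2) jb by blast
  qed
qed

end

section \<open>Removing the jumps\<close>

context int_cocycle
begin

text \<open>Only finitely many gaps modulo \<open>\<int>\<close> carry a jump of \<open>u\<close>. Subtracting the jumps to the left of
  \<open>x\<close> turns \<open>u\<close> into a function that factors through \<open>P\<close>; jumps are counted from \<open>0\<close> on, so this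
  works over \<open>[0, \<infinity>)\<close> only.\<close>

definition bad :: "real \<Rightarrow> real set" where
  "bad x = {t. t \<ge> 0 \<and> jump t \<noteq> 0 \<and> hi P t \<le> x}"

definition N :: "real \<Rightarrow> int" where
  "N x = sum jump (bad x)"

lemma finite_bad: "finite (bad x)"
proof -
  obtain d where d: "d > 0" "\<And>t. hi P t - lo P t < d \<Longrightarrow> jump t = 0"
    using jump_small_gap by blast
  have "bad x \<subseteq> {t. lo P t \<in> {lo P 0..x} \<and> hi P t - lo P t \<ge> d}"
  proof
    fix t assume t: "t \<in> bad x"
    then have "hi P t - lo P t \<ge> d" using d(2)[of t] by (cases "hi P t - lo P t < d") (auto simp: bad_def)
    moreover have "lo P 0 \<le> lo P t" using t lo_less[of 0 t] by (cases "t = 0") (auto simp: bad_def)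
    moreover have "lo P t \<le> x" using t lo_le_hi[of t] by (auto simp: bad_def)
    ultimately show "t \<in> {t. lo P t \<in> {lo P 0..x} \<and> hi P t - lo P t \<ge> d}" by simp
  qed
  then show ?thesis using finite_large_gaps(1)[OF \<open>d > 0\<close>] by (rule finite_subset)
qed

text \<open>If the counts at two end points differ, a gap with nonzero jump lies between them, and
  such gaps have length bounded below.\<close>

lemma N_locally_constant:
  obtains d where "d > 0" "\<And>x y. x \<in> endpoints P \<Longrightarrow> y \<in> endpoints P \<Longrightarrow> \<bar>x - y\<bar> < d \<Longrightarrow> N x = N y"
proof -
  obtain d where d: "d > 0" "\<And>t. hi P t - lo P t < d \<Longrightarrow> jump t = 0"
    using jump_small_gap by blast
  have "bad y \<subseteq> bad x" if x: "x \<in> endpoints P" and xy: "\<bar>x - y\<bar> < d" for x y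
  proof
    fix t assume t: "t \<in> bad y"
    show "t \<in> bad x"
    proof (rule ccontr)
      assume "t \<notin> bad x"
      then have "x < hi P t" using t by (auto simp: bad_def)
      then have "x \<le> lo P t" using no_endpoint_between[OF x, of t] by force
      moreover have "hi P t \<le> y" "hi P t - lo P t \<ge> d"
        using t d(2)[of t] by (cases "hi P t - lo P t < d"; auto simp: bad_def)+
      ultimately show False using xy by linarith
    qed
  qed
  then have "N x = N y" if "x \<in> endpoints P" "y \<in> endpoints P" "\<bar>x - y\<bar> < d" for x y
    unfolding N_def using that by (metis abs_minus_commute subset_antisym)
  then show thesis using d(1) that by blast
qed

text \<open>Only \<open>t\<close> itself can enter the sum between the two ends of its fibre,
  because every other fibre lies entirely to one side.\<close>

lemma N_hi:
  assumes "t \<ge> 0"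
  shows "N (hi P t) = N (lo P t) + jump t"
proof -
  have other: "s \<in> bad (hi P t) \<longleftrightarrow> s \<in> bad (lo P t)" if "s \<noteq> t" for s
  proof (cases "s < t")
    case True
    then show ?thesis using hi_less_lo[of s t] lo_le_hi[of t] by (simp add: bad_def)
  next
    case False
    then show ?thesis using that hi_less[of t s] lo_le_hi[of t] by (auto simp: bad_def)
  qed
  show ?thesis
  proof (cases "jump t = 0")
    case True
    then have "t \<notin> bad x" for x by (simp add: bad_def)
    then have "bad (hi P t) = bad (lo P t)" using other by (intro set_eqI) metis
    then show ?thesis using True by (simp add: N_def)
  next
    case False
    then have "lo P t < hi P t" using jump_eq_0[of t] lo_le_hi[of t] by force
    then have "t \<notin> bad (lo P t)" "t \<in> bad (hi P t)" using False assms by (simp_all add: bad_def)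
    moreover from this have "bad (hi P t) = insert t (bad (lo P t))"
      using other by (intro set_eqI) (metis insert_iff)
    ultimately show ?thesis using finite_bad[of "lo P t"] by (simp add: N_def)
  qed
qed

definition W :: "real \<Rightarrow> complex" where
  "W x = u x * ee (- (\<beta> * of_int (N x)))"

definition w :: "real \<Rightarrow> complex" where
  "w t = W (lo P t)"

lemma u_eq_W: "u x = W x * ee (\<beta> * of_int (N x))"
  by (simp add: W_def ee_minus)

lemma norm_w [simp]: "norm (w t) = 1"
  by (simp add: w_def W_def norm_mult u_norm)

lemma w_nonzero [simp]: "w t \<noteq> 0"
  using norm_w[of t] by fastforce

text \<open>Across a fibre the jump of \<open>u\<close> is cancelled by the change of
  \<open>N\<close>.\<close>

lemma W_eq_w:
  assumes "x \<in> endpoints P" "P x \<ge> 0"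
  shows "W x = w (P x)"
proof -
  have "W (hi P t) = w t" if "t \<ge> 0" for t
  proof -
    have "ee (\<beta> * of_int (jump t)) * ee (- (\<beta> * of_int (N (lo P t) + jump t))) = ee (- (\<beta> * of_int (N (lo P t))))"
      unfolding ee_add[symmetric] by (simp add: algebra_simps)
    then show ?thesis by (simp add: w_def W_def u_hi[of t] N_hi[OF that])
  qed
  then show ?thesis using assms unfolding endpoints_iff w_def by metis
qed

text \<open>Nearby fibres are compared through their facing ends, where \<open>W\<close> varies
  little; \<open>W_eq_w\<close> then replaces a right end by the left end that defines
  \<open>w\<close>.\<close>

lemma w_continuous: "continuous_on {0..} w"
  unfolding continuous_on_iff dist_norm
proof (intro ballI allI impI)
  fix t e :: real assume t: "t \<in> {0..}" and e: "e > 0"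
  obtain d1 where d1: "d1 > 0" "\<And>x y. x \<in> endpoints P \<Longrightarrow> y \<in> endpoints P \<Longrightarrow> \<bar>x - y\<bar> < d1 \<Longrightarrow> norm (u x - u y) < e"
    using u_close[OF e] by blast
  obtain d2 where d2: "d2 > 0" "\<And>x y. x \<in> endpoints P \<Longrightarrow> y \<in> endpoints P \<Longrightarrow> \<bar>x - y\<bar> < d2 \<Longrightarrow> N x = N y"
    using N_locally_constant by blast
  define d where "d = min d1 d2"
  have "d > 0" using d1 d2 by (simp add: d_def)
  have W: "norm (W x - W y) < e" if "x \<in> endpoints P" "y \<in> endpoints P" "\<bar>x - y\<bar> < d" for x y
  proof -
    have "N x = N y" using d2(2) that by (simp add: d_def)
    then have "norm (W x - W y) = norm (u x - u y)"
      unfolding W_def by (simp add: norm_mult flip: left_diff_distrib)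
    then show ?thesis using d1(2) that by (simp add: d_def)
  qed
  \<comment> \<open>Outside the fibre of \<open>t\<close> the value of \<open>P\<close> differs
    strictly from \<open>t\<close>, so a small change of this value keeps the facing ends within
    \<open>d\<close> of each other.\<close>
  define y0 y1 where "y0 = lo P t - d / 2" and "y1 = hi P t + d / 2"
  have y: "P y0 < t" "t < P y1"
    using P_le[of y0 "lo P t"] P_le[of "hi P t" y1] fibre[of y0 t] fibre[of y1 t] \<open>d > 0\<close>
    by (auto simp: y0_def y1_def order_less_le)
  have "norm (w t' - w t) < e" if t': "t' \<in> {0..}" and near: "norm (t' - t) < min (P y1 - t) (t - P y0)" for t'
  proof (cases t' t rule: linorder_cases)
    case less
    have "y0 < hi P t'" by (rule P_less_imp) (use near in \<open>simp add: abs_less_iff\<close>)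
    moreover have "hi P t' < lo P t" using less by (rule hi_less_lo)
    ultimately have "\<bar>hi P t' - lo P t\<bar> < d" using \<open>d > 0\<close> by (simp add: y0_def)
    then have "norm (W (hi P t') - W (lo P t)) < e" by (intro W) auto
    then show ?thesis using W_eq_w[of "hi P t'"] t' by (simp add: w_def)
  next
    case greater
    have "lo P t' < y1" by (rule P_less_imp) (use near in \<open>simp add: abs_less_iff\<close>)
    moreover have "hi P t < lo P t'" using greater by (rule hi_less_lo)
    ultimately have "\<bar>lo P t' - hi P t\<bar> < d" using \<open>d > 0\<close> by (simp add: y1_def)
    then have "norm (W (lo P t') - W (hi P t)) < e" by (intro W) auto
    then show ?thesis using W_eq_w[of "hi P t"] t by (simp add: w_def)
  qed (use e in simp)
  then show "\<exists>d>0. \<forall>x'\<in>{0..}. norm (x' - t) < d \<longrightarrow> norm (w x' - w t) < e"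
    using y by (intro exI[of _ "min (P y1 - t) (t - P y0)"]) auto
qed

lemma u_add_int: "x \<in> endpoints P \<Longrightarrow> u (x + of_int m) = u x"
  using u_add_1 by (rule periodic_add_int)

lemma w_shift:
  obtains n :: int where "w (t + (real i * \<alpha> + of_int m)) = w t * ee (\<beta> * of_int n)"
proof -
  let ?x = "lo P t" and ?y = "lo P (t + real i * \<alpha>) + of_int m"
  have "lo P (t + (real i * \<alpha> + of_int m)) = ?y"
    using lo_add_int[of "t + real i * \<alpha>" m] by (simp add: add.assoc)
  then have "w (t + (real i * \<alpha> + of_int m)) = u ?y * ee (- (\<beta> * of_int (N ?y)))"
    by (simp add: w_def W_def)
  also have "u ?y = u ((f ^^ i) ?x)"
    using u_add_int[of "lo P (t + real i * \<alpha>)" m] by (simp add: lo_funpow)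
  also have "\<dots> = u ?x * ee (\<beta> * of_int (K i ?x))" by (simp add: u_funpow)
  also have "u ?x = w t * ee (\<beta> * of_int (N ?x))" by (simp add: w_def u_eq_W)
  finally have "w (t + (real i * \<alpha> + of_int m)) = w t * ee (\<beta> * of_int (N ?x + K i ?x - N ?y))"
    by (simp add: ee_add ee_diff ee_minus divide_inverse ring_distribs mult.assoc)
  then show thesis by (rule that)
qed

text \<open>The quotient of \<open>w (t + \<gamma>)\<close> by \<open>w t\<close> is continuous on a
  half-line and takes only the countably many values \<open>ee (\<beta> * of_int n)\<close>, hence
  it is constant.\<close>

lemma w_shift_constant:
  assumes "t \<ge> 0" and "\<gamma> \<ge> 0" and \<gamma>: "\<gamma> = real i * \<alpha> + of_int m"
  shows "w (t + \<gamma>) * w 0 = w t * w \<gamma>"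
proof -
  define q where "q t = w (t + \<gamma>) / w t" for t
  have "continuous_on {0..} (\<lambda>t. w (t + \<gamma>))"
    by (rule continuous_on_compose2[OF w_continuous])
      (use assms(2) in \<open>auto intro: continuous_on_add continuous_on_id\<close>)
  then have "continuous_on {0..} q"
    unfolding q_def by (rule continuous_on_divide[OF _ w_continuous]) simp
  then have conn: "connected (q ` {0..})"
    by (rule connected_continuous_image) (rule connected_Ici)
  have "q ` {0..} \<subseteq> range (\<lambda>n::int. ee (\<beta> * of_int n))"
  proof (rule image_subsetI)
    fix t :: real
    obtain n :: int where "w (t + \<gamma>) = w t * ee (\<beta> * of_int n)"
      unfolding \<gamma> by (rule w_shift)
    then have "q t = ee (\<beta> * of_int n)" by (simp add: q_def)
    then show "q t \<in> range (\<lambda>n::int. ee (\<beta> * of_int n))" by blast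
  qed
  then have "countable (q ` {0..})" by (rule countable_subset) simp
  moreover have "q t \<in> q ` {0..}" "q 0 \<in> q ` {0..}" using assms(1) by (intro imageI, simp)+
  ultimately have "q t = q 0" using connected_uncountable[OF conn, of "q t" "q 0"] by metis
  then show ?thesis by (simp add: q_def field_simps)
qed

lemma w_add:
  assumes "s \<ge> 0" "t \<ge> 0"
  shows "w (s + t) * w 0 = w s * w t"
proof -
  \<comment> \<open>Shifts from the dense group approximate \<open>t\<close> from above, so that
    they stay in the half-line where \<open>w\<close> is controlled.\<close>
  have "\<exists>\<gamma>. t < \<gamma> \<and> \<gamma> < t + inverse (real (Suc n)) \<and> w (s + \<gamma>) * w 0 = w s * w \<gamma>" for n
  proof -
    have "t < t + inverse (real (Suc n))" by simp
    then obtain i :: nat and m :: int where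
      im: "t < real i * \<alpha> + of_int m" "real i * \<alpha> + of_int m < t + inverse (real (Suc n))"
      using int_dense_irrational[OF irrational] by metis
    moreover have "w (s + (real i * \<alpha> + of_int m)) * w 0 = w s * w (real i * \<alpha> + of_int m)"
      by (rule w_shift_constant[OF assms(1) _ refl]) (use im assms(2) in linarith)
    ultimately show ?thesis by blast
  qed
  then obtain g where g: "\<And>n. t < g n" "\<And>n. g n < t + inverse (real (Suc n))"
    "\<And>n. w (s + g n) * w 0 = w s * w (g n)" by metis
  have lim: "g \<longlonglongrightarrow> t"
  proof (rule tendsto_sandwich)
    show "(\<lambda>n. t) \<longlonglongrightarrow> t" by simp
    show "(\<lambda>n. t + inverse (real (Suc n))) \<longlonglongrightarrow> t" by (rule LIMSEQ_inverse_real_of_nat_add)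
  qed (use g in \<open>auto intro!: always_eventually less_imp_le\<close>)
  have g0: "g n \<ge> 0" for n using g(1)[of n] assms by simp
  have "(\<lambda>n. w (g n)) \<longlonglongrightarrow> w t"
    by (rule continuous_on_tendsto_compose[OF w_continuous lim]) (use g0 assms in auto)
  then have "(\<lambda>n. w s * w (g n)) \<longlonglongrightarrow> w s * w t" by (rule tendsto_mult_left)
  moreover have "(\<lambda>n. w (s + g n)) \<longlonglongrightarrow> w (s + t)"
    by (rule continuous_on_tendsto_compose[OF w_continuous tendsto_add[OF tendsto_const lim]])
      (use g0 assms in \<open>auto intro!: always_eventually\<close>)
  then have "(\<lambda>n. w (s + g n) * w 0) \<longlonglongrightarrow> w (s + t) * w 0" by (rule tendsto_mult_right)
  ultimately show ?thesis unfolding g(3) using LIMSEQ_unique by blast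
qed

lemma w_slope:
  obtains l where "\<And>t. t \<ge> 0 \<Longrightarrow> w t = w 0 * ee (l * t)"
proof -
  have cont: "continuous_on {0..} (\<lambda>t. w t / w 0)"
    by (rule continuous_on_divide[OF w_continuous continuous_on_const]) simp
  have mult: "w (s + t) / w 0 = (w s / w 0) * (w t / w 0)" if "s \<ge> 0" "t \<ge> 0" for s t
    using w_add[OF that] by (simp add: field_simps)
  have "norm (w t / w 0) = 1" for t by (simp add: norm_divide)
  then obtain l where l: "\<And>t. t \<ge> 0 \<Longrightarrow> w t / w 0 = ee (l * t)"
    using continuous_hom_ee[OF cont _ mult] by blast
  have "w t = w 0 * ee (l * t)" if "t \<ge> 0" for t
    using l[OF that] by (simp add: divide_eq_eq mult.commute)
  then show thesis by (rule that)
qed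

lemma k_add_1: "x \<in> endpoints P \<Longrightarrow> k (x + 1) = k x"
  using u_f[of "x + 1"] u_f[of x] u_add_1[of x] u_add_1[of "f x"] u_nonzero[of x]
    ee_irrational_cancel[OF beta_irrational, of "k (x + 1)" "k x"] by (simp add: f_add_1)

lemma K_add_int: "x \<in> endpoints P \<Longrightarrow> K i (x + of_int m) = K i x"
  unfolding K_def by (rule sum.cong[OF refl]) (simp add: funpow_add_int periodic_add_int[of k] k_add_1)

text \<open>The integers \<open>r\<close> and \<open>d\<close> are the exponents by which
  \<open>w\<close> changes from 0 to 1 and from 0 to \<open>\<alpha>\<close>; comparison with the
  slope gives the coordinates of \<open>l\<close> and \<open>l * \<alpha>\<close>. The last claim
  identifies the mean of \<open>k\<close> as \<open>d - r * \<alpha>\<close>, which will carry the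
  orientation of the flow.\<close>

theorem affine:
  obtains l c :: real and p q r d :: int
  where "l = of_int p + of_int r * \<beta>" "l * \<alpha> = of_int q + of_int d * \<beta>"
    and "\<And>x. x \<in> endpoints P \<Longrightarrow> \<exists>j::int. u x = ee (l * P x + c + \<beta> * of_int j)"
    and "\<And>x. x \<in> endpoints P \<Longrightarrow> \<exists>B. \<forall>i. \<bar>of_int (K i x) - real i * (of_int d - of_int r * \<alpha>)\<bar> \<le> B"
proof -
  obtain l where l: "\<And>t. t \<ge> 0 \<Longrightarrow> w t = w 0 * ee (l * t)" using w_slope by blast
  obtain r :: int where "w (0 + (real 0 * \<alpha> + of_int 1)) = w 0 * ee (\<beta> * of_int r)" by (rule w_shift)
  then have r: "ee l = ee (\<beta> * of_int r)" using l[of 1] by simp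
  then obtain p :: int where lp: "l = of_int p + of_int r * \<beta>"
    unfolding ee_eq_iff by (auto simp: algebra_simps)
  obtain d :: int where "w (0 + (real 1 * \<alpha> + of_int 0)) = w 0 * ee (\<beta> * of_int d)" by (rule w_shift)
  then have d: "ee (l * \<alpha>) = ee (\<beta> * of_int d)" using l[of \<alpha>] pos by simp
  then obtain q :: int where lq: "l * \<alpha> = of_int q + of_int d * \<beta>"
    unfolding ee_eq_iff by (auto simp: algebra_simps)
  obtain c where c: "w 0 = ee c"
  proof
    show "w 0 = ee (Arg (w 0) / (2 * pi))"
      using cis_Arg[of "w 0"] by (simp add: ee_def sgn_eq)
  qed
  have W: "W x = w 0 * ee (l * P x)" if "x \<in> endpoints P" "P x \<ge> 0" for x
    using W_eq_w[OF that] l[OF that(2)] by simp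
  \<comment> \<open>\<open>W\<close> is described only where \<open>P\<close> is nonnegative; an
    integer translation reaches that range without changing \<open>u\<close>.\<close>
  have shift: "x + of_int m \<in> endpoints P \<and> P (x + of_int m) \<ge> 0"
    if "x \<in> endpoints P" "m \<ge> \<lceil>- P x\<rceil>" for x m
    using that by (simp add: P_add_int) linarith
  have aff: "\<exists>j::int. u x = ee (l * P x + c + \<beta> * of_int j)" if x: "x \<in> endpoints P" for x
  proof -
    define m where "m = \<lceil>- P x\<rceil>"
    have s: "x + of_int m \<in> endpoints P" "P (x + of_int m) \<ge> 0" using shift[OF x] by (auto simp: m_def)
    have "u x = u (x + of_int m)" using u_add_int[OF x] by simp
    also have "\<dots> = ee c * ee (l * (P x + of_int m)) * ee (\<beta> * of_int (N (x + of_int m)))"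
      using u_eq_W[of "x + of_int m"] W[OF s] c by (simp add: P_add_int)
    also have "\<dots> = ee (l * P x + c + \<beta> * of_int (r * m + N (x + of_int m)) + of_int (p * m))"
      unfolding ee_add[symmetric] by (simp add: lp algebra_simps)
    finally show ?thesis unfolding ee_add_int by blast
  qed
  \<comment> \<open>Periodicity of \<open>u\<close> forces the count of jumps to compensate the
    factor \<open>ee l\<close> that \<open>W\<close> gains over one period.\<close>
  have N1: "N (x + 1) = N x - r" if x: "x \<in> endpoints P" "P x \<ge> 0" for x
  proof -
    have "W (x + 1) = W x * ee l"
      using W[of "x + 1"] W[OF x] x by (simp add: P_add_1 ee_add ring_distribs)
    then have "u x * ee (- (\<beta> * of_int (N (x + 1)))) = u x * (ee (- (\<beta> * of_int (N x))) * ee (\<beta> * of_int r))"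
      using r x by (simp add: W_def u_add_1)
    then have "ee (\<beta> * of_int (- N (x + 1))) = ee (\<beta> * of_int (r - N x))"
      using u_nonzero[OF x(1)] by (simp add: ee_add[symmetric] algebra_simps)
    then show ?thesis using ee_irrational_cancel[OF beta_irrational] by fastforce
  qed
  have Nm: "N (x + real m) = N x - r * int m" if x: "x \<in> endpoints P" "P x \<ge> 0" for x m
  proof (induction m)
    case (Suc m)
    have "x + real m \<in> endpoints P" "P (x + real m) \<ge> 0"
      using x endpoints_add_int[of x "int m"] P_add_int[of x "int m"] by simp_all
    then have "N (x + real m + 1) = N (x + real m) - r" by (rule N1)
    then show ?case using Suc by (simp add: algebra_simps)
  qed simp
  have kN: "k x = d + N (f x) - N x" if x: "x \<in> endpoints P" "P x \<ge> 0" for x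
  proof -
    have "W (f x) = W x * ee (l * \<alpha>)"
      using W[of "f x"] W[OF x] x pos by (simp add: P_f ee_add ring_distribs)
    then have "u x * (ee (\<beta> * of_int (k x)) * ee (- (\<beta> * of_int (N (f x))))) = u x * (ee (- (\<beta> * of_int (N x))) * ee (\<beta> * of_int d))"
      using d x by (simp add: W_def u_f)
    then have "ee (\<beta> * of_int (k x - N (f x))) = ee (\<beta> * of_int (d - N x))"
      using u_nonzero[OF x(1)] by (simp add: ee_add[symmetric] algebra_simps)
    then have "k x - N (f x) = d - N x" by (rule ee_irrational_cancel[OF beta_irrational])
    then show ?thesis by simp
  qed
  \<comment> \<open>By \<open>kN\<close>, \<open>k\<close> is the constant \<open>d\<close> plus a
    coboundary of \<open>N\<close>, so its Birkhoff sums telescope.\<close>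
  have KN: "K i x = int i * d + N ((f ^^ i) x) - N x" if x: "x \<in> endpoints P" "P x \<ge> 0" for x i
  proof (induction i)
    case (Suc i)
    have "P ((f ^^ i) x) \<ge> 0" using x pos by (simp add: P_funpow)
    then show ?case using Suc kN[of "(f ^^ i) x"] x by (simp add: K_def ring_distribs)
  qed (simp add: K_def)
  define B0 where "B0 = (\<Sum>t\<in>bad (lo P 0 + 1). \<bar>jump t\<bar>)"
  have B0: "\<bar>N y\<bar> \<le> B0" if "y \<le> lo P 0 + 1" for y
  proof -
    have "\<bar>N y\<bar> \<le> (\<Sum>t\<in>bad y. \<bar>jump t\<bar>)" unfolding N_def by (rule sum_abs)
    also have "\<dots> \<le> B0"
      unfolding B0_def using that by (intro sum_mono2 finite_bad) (auto simp: bad_def)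
    finally show ?thesis .
  qed
  have bound: "\<exists>B. \<forall>i. \<bar>of_int (K i x) - real i * (of_int d - of_int r * \<alpha>)\<bar> \<le> B"
    if x: "x \<in> endpoints P" "P x \<ge> 0" for x
  proof (intro exI allI)
    fix i
    let ?y = "(f ^^ i) x"
    have Py: "P ?y = P x + real i * \<alpha>" by (rule P_funpow)
    then have "P ?y \<ge> 0" using x pos by simp
    then have ge: "lo P 0 \<le> ?y"
      using P_less_imp[of "lo P 0" ?y] fibre[of ?y 0] by (cases "P ?y = 0") auto
    \<comment> \<open>Moving the iterate back by \<open>m\<close> into the period that starts at
      \<open>lo P 0\<close> bounds its count by \<open>B0\<close>. Each removed unit contributes
      \<open>- r\<close>, and \<open>m\<close> differs from \<open>i * \<alpha>\<close> by a bounded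
      amount.\<close>
    define m where "m = nat \<lfloor>?y - lo P 0\<rfloor>"
    have m: "real m \<le> ?y - lo P 0" "?y - lo P 0 \<le> real m + 1" using ge unfolding m_def by linarith+
    define y where "y = ?y - real m"
    have y: "y \<in> endpoints P" "P y \<ge> 0" "y \<le> lo P 0 + 1"
      using endpoints_add_int[of ?y "- int m"] x P_le[of "lo P 0" y] m by (simp_all add: y_def)
    have NN: "N ?y = N y - r * int m" using Nm[OF y(1,2), of m] by (simp add: y_def)
    have "\<bar>real m - real i * \<alpha>\<bar> \<le> \<bar>P x\<bar> + \<bar>P 0\<bar> + \<bar>lo P 0\<bar> + 2"
      using P_bound[of ?y] m unfolding Py by linarith
    then have "\<bar>of_int r * (real m - real i * \<alpha>)\<bar> \<le> \<bar>of_int r\<bar> * (\<bar>P x\<bar> + \<bar>P 0\<bar> + \<bar>lo P 0\<bar> + 2)"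
      unfolding abs_mult by (rule mult_left_mono) simp
    moreover have "\<bar>real_of_int (N y)\<bar> \<le> of_int B0" using B0[OF y(3)] by linarith
    moreover have "of_int (K i x) - real i * (of_int d - of_int r * \<alpha>)
        = of_int (N y) - of_int (N x) - of_int r * (real m - real i * \<alpha>)"
      by (simp add: KN[OF x] NN algebra_simps)
    ultimately show "\<bar>of_int (K i x) - real i * (of_int d - of_int r * \<alpha>)\<bar>
        \<le> of_int B0 + \<bar>of_int (N x)\<bar> + \<bar>of_int r\<bar> * (\<bar>P x\<bar> + \<bar>P 0\<bar> + \<bar>lo P 0\<bar> + 2)"
      by linarith
  qed
  have "\<exists>B. \<forall>i. \<bar>of_int (K i x) - real i * (of_int d - of_int r * \<alpha>)\<bar> \<le> B" if x: "x \<in> endpoints P" for x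
    using bound[OF conjunct1 conjunct2, OF shift[OF x order_refl] shift[OF x order_refl]]
    unfolding K_add_int[OF x] .
  then show thesis using that lp lq aff by blast
qed

end

section \<open>Suspension flows as integer cocycles\<close>

context denjoy_lift
begin

text \<open>Winding is no obstruction: a point \<open>c\<close> inside a gap and its translates cut
  the end points into compact pieces. A lift over one piece extends periodically and stays
  continuous because no end point lies at a cut.\<close>

lemma periodic_ee_lift:
  fixes g :: "real \<Rightarrow> complex"
  assumes cont: "continuous_on (endpoints P) g"
    and norm1: "\<And>x. x \<in> endpoints P \<Longrightarrow> norm (g x) = 1"
    and periodic: "\<And>x. x \<in> endpoints P \<Longrightarrow> g (x + 1) = g x"
  obtains s where "continuous_on (endpoints P) s" "\<And>x. x \<in> endpoints P \<Longrightarrow> s (x + 1) = s x"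
    "\<And>x. x \<in> endpoints P \<Longrightarrow> g x = ee (s x)"
proof -
  obtain t0 where t0: "lo P t0 < hi P t0" using gaps_nonempty by (auto simp: gaps_def)
  define c where "c = (lo P t0 + hi P t0) / 2"
  have c: "c + of_int n \<notin> endpoints P" for n
    using no_endpoint_between[of c t0] t0 unfolding endpoints_add_int c_def by auto
  let ?K = "endpoints P \<inter> {c..c + 1}"
  have "continuous_on ?K g" using cont by (rule continuous_on_subset) simp
  then obtain h where h: "continuous_on ?K h" "\<And>x. x \<in> ?K \<Longrightarrow> g x = ee (h x)"
    by (rule continuous_ee_lift_compact[OF compact_endpoints_Icc]) (use norm1 in auto)
  define s where "s x = h (x - of_int \<lfloor>x - c\<rfloor>)" for x
  have mem: "x - of_int n \<in> endpoints P" if "x \<in> endpoints P" for x n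
    using endpoints_add_int[of x "-n"] that by simp
  have K: "x - of_int \<lfloor>x - c\<rfloor> \<in> ?K" if "x \<in> endpoints P" for x
  proof -
    have "c \<le> x - of_int \<lfloor>x - c\<rfloor>" "x - of_int \<lfloor>x - c\<rfloor> \<le> c + 1" by linarith+
    then show ?thesis using mem[OF that] by simp
  qed
  show thesis
  proof (rule that)
    show "s (x + 1) = s x" for x
    proof -
      have "\<lfloor>x + 1 - c\<rfloor> = \<lfloor>x - c\<rfloor> + 1" by linarith
      then show ?thesis by (simp add: s_def)
    qed
    show "g x = ee (s x)" if x: "x \<in> endpoints P" for x
    proof -
      have "g (x + of_int (- \<lfloor>x - c\<rfloor>)) = g x" using periodic x by (rule periodic_add_int)
      then show ?thesis using h(2)[OF K[OF x]] by (simp add: s_def)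
    qed
    show "continuous_on (endpoints P) s"
      unfolding continuous_on_eq_continuous_within
    proof
      fix x assume x: "x \<in> endpoints P"
      define n where "n = \<lfloor>x - c\<rfloor>"
      define U where "U = {c + of_int n<..<c + of_int n + 1}"
      have "c + of_int n \<le> x" "x < c + of_int n + 1" unfolding n_def by linarith+
      moreover have "x \<noteq> c + of_int n" using c x by metis
      ultimately have xU: "x \<in> U" by (simp add: U_def)
      have seq: "s y = h (y - of_int n)" if "y \<in> U" for y
      proof -
        have "\<lfloor>y - c\<rfloor> = n" using that unfolding U_def greaterThanLessThan_iff by linarith
        then show ?thesis by (simp add: s_def)
      qed
      have "continuous_on (endpoints P \<inter> U) (\<lambda>y. h (y - of_int n))"
      proof (rule continuous_on_compose2[OF h(1)])
        show "(\<lambda>y. y - of_int n) ` (endpoints P \<inter> U) \<subseteq> ?K"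
        proof (rule image_subsetI)
          fix y assume y: "y \<in> endpoints P \<inter> U"
          then have "c \<le> y - of_int n" "y - of_int n \<le> c + 1" by (auto simp: U_def)
          then show "y - of_int n \<in> ?K" using mem y by simp
        qed
      qed (intro continuous_on_diff continuous_on_id continuous_on_const)
      then have "continuous_on (endpoints P \<inter> U) s"
        by (rule continuous_on_eq) (simp add: seq)
      then have "continuous (at x within (endpoints P \<inter> U)) s"
        using x xU by (simp add: continuous_on_eq_continuous_within)
      moreover have "at x within (endpoints P \<inter> U) = at x within endpoints P"
        by (rule at_within_nhd[of x U]) (use xU in \<open>auto simp: U_def\<close>)
      ultimately show "continuous (at x within endpoints P) s" by simp
    qed
  qed
qed

end

text \<open>Here \<open>v\<close> and \<open>z\<close> are the height and the angle, in the target suspension, of the image of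
  the point of height \<open>t\<close> over \<open>x\<close>.\<close>

locale flow_lift = denjoy_lift P f \<alpha> for P f \<alpha> +
  fixes \<beta> :: real and v z :: "real \<Rightarrow> real \<Rightarrow> complex"
  assumes beta_irrational: "\<beta> \<notin> \<rat>"
    and v_cont: "continuous_on (endpoints P \<times> UNIV) (\<lambda>(x, t). v x t)"
    and z_cont: "continuous_on (endpoints P \<times> UNIV) (\<lambda>(x, t). z x t)"
    and v_norm: "x \<in> endpoints P \<Longrightarrow> norm (v x t) = 1"
    and z_norm: "x \<in> endpoints P \<Longrightarrow> norm (z x t) = 1"
    and v_add_1: "x \<in> endpoints P \<Longrightarrow> v (x + 1) t = v x t"
    and z_add_1: "x \<in> endpoints P \<Longrightarrow> z (x + 1) t = z x t"
    and v_f: "x \<in> endpoints P \<Longrightarrow> v (f x) t = v x (t + 1)"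
    and z_f: "x \<in> endpoints P \<Longrightarrow> z (f x) t = z x (t + 1)"
    and time_change: "x \<in> endpoints P \<Longrightarrow> \<exists>\<tau>. continuous_on UNIV \<tau> \<and> strict_mono \<tau> \<and> \<tau> 0 = 0 \<and>
          (\<forall>t. v x t = v x 0 * ee (\<tau> t) \<and> z x t = z x 0 * ee (\<beta> * \<tau> t))"
begin

text \<open>If \<open>\<tau>\<close> advanced by more than 1/2 during a time step of
  \<open>1 / n\<close>, then at some moment of this step \<open>v\<close> would be opposite to its
  starting value, against uniform continuity on one period. The bound adds up \<open>n\<close> such
  half-turns.\<close>

lemma time_bound:
  obtains C where "\<And>x \<tau>. x \<in> endpoints P \<Longrightarrow> continuous_on UNIV \<tau> \<Longrightarrow> strict_mono \<tau> \<Longrightarrow> \<tau> 0 = 0 \<Longrightarrow>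
    (\<And>t. v x t = v x 0 * ee (\<tau> t)) \<Longrightarrow> \<tau> 1 \<le> C"
proof -
  let ?K = "(endpoints P \<inter> {0..1}) \<times> {0..1::real}"
  have "continuous_on ?K (\<lambda>(x, t). v x t)" using v_cont by (rule continuous_on_subset) auto
  moreover have "compact ?K" by (intro compact_Times compact_endpoints_Icc compact_Icc)
  ultimately have uc: "uniformly_continuous_on ?K (\<lambda>(x, t). v x t)"
    by (rule compact_uniformly_continuous)
  obtain d where d: "d > 0" "\<And>a b. a \<in> ?K \<Longrightarrow> b \<in> ?K \<Longrightarrow> dist b a < d \<Longrightarrow>
      dist (case b of (x, t) \<Rightarrow> v x t) (case a of (x, t) \<Rightarrow> v x t) < 1"
    using uc unfolding uniformly_continuous_on_def by (metis zero_less_one)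
  obtain n :: nat where n: "n > 0" "inverse (real n) < d"
    using d(1) by (metis real_arch_inverse gr0I)
  show thesis
  proof (rule that[of "real n / 2"])
    fix x \<tau>
    assume x: "x \<in> endpoints P" and \<tau>: "continuous_on UNIV \<tau>" "strict_mono \<tau>" "\<tau> 0 = 0"
      and v: "\<And>t. v x t = v x 0 * ee (\<tau> t)"
    define y where "y = x + of_int (- \<lfloor>x\<rfloor>)"
    have "y \<in> endpoints P" using x by (simp only: y_def endpoints_add_int)
    moreover have "0 \<le> y" "y \<le> 1" unfolding y_def by linarith+
    ultimately have y: "y \<in> endpoints P \<inter> {0..1}" by simp
    have vy: "v y t = v x t" for t
      unfolding y_def using v_add_1 x by (rule periodic_add_int)
    have step: "\<tau> (real (Suc i) / real n) - \<tau> (real i / real n) \<le> 1 / 2" if "i < n" for i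
    proof (rule ccontr)
      let ?a = "real i / real n" and ?b = "real (Suc i) / real n"
      assume "\<not> \<tau> ?b - \<tau> ?a \<le> 1 / 2"
      moreover have ab: "?a \<le> ?b" using n by (simp add: divide_right_mono)
      ultimately obtain t where t: "?a \<le> t" "t \<le> ?b" "\<tau> t = \<tau> ?a + 1 / 2"
        using IVT'[of \<tau> ?a "\<tau> ?a + 1 / 2" ?b] continuous_on_subset[OF \<tau>(1)] by auto
      have "?b - ?a = inverse (real n)" using n(1) by (simp add: field_simps)
      then have "dist (y, t) (y, ?a) < d" using t n(2) by (simp add: dist_Pair_Pair dist_real_def)
      moreover have "0 \<le> ?a" "?b \<le> 1" using that n(1) by simp_all
      then have "?a \<in> {0..1}" "t \<in> {0..1}"
        using t(1,2) ab unfolding atLeastAtMost_iff by linarith+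
      then have "(y, ?a) \<in> ?K" "(y, t) \<in> ?K" using y by simp_all
      ultimately have "dist (v x t) (v x ?a) < 1" using d(2)[of "(y, ?a)" "(y, t)"] by (simp add: vy)
      moreover have "ee (1 / 2) = -1" by (simp add: ee_def)
      then have "v x t = - v x ?a" using v[of t] v[of ?a] t(3) by (simp only: ee_add) simp
      then have "dist (v x t) (v x ?a) = norm (- 2 * v x ?a)" by (simp add: dist_norm)
      then have "dist (v x t) (v x ?a) = 2" using v_norm[OF x] by (simp add: norm_mult)
      ultimately show False by simp
    qed
    have "i \<le> n \<Longrightarrow> \<tau> (real i / real n) \<le> real i / 2" for i
    proof (induction i)
      case (Suc i)
      then show ?case using step[of i] by (simp add: add_divide_distrib)
    qed (simp add: \<tau>(3))
    from this[of n] show "\<tau> 1 \<le> real n / 2" using n(1) by simp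
  qed
qed

text \<open>Sliding images along the flow down to the base gives an \<open>int_cocycle\<close>:
  lifted heights are bounded by periodicity and return times by \<open>time_bound\<close>, so the
  crossing number \<open>k\<close> is bounded.\<close>

theorem flow_affine:
  obtains l c :: real and p q r d :: int
  where "l = of_int p + of_int r * \<beta>" "l * \<alpha> = of_int q + of_int d * \<beta>" "of_int d - of_int r * \<alpha> \<ge> 0"
    and "\<And>x \<sigma>. x \<in> endpoints P \<Longrightarrow> v x 0 = ee \<sigma> \<Longrightarrow> \<exists>j::int. z x 0 = ee (l * P x + c + \<beta> * (\<sigma> + of_int j))"
proof -
  obtain \<tau> where \<tau>: "\<And>x. x \<in> endpoints P \<Longrightarrow> continuous_on UNIV (\<tau> x)"
    "\<And>x. x \<in> endpoints P \<Longrightarrow> strict_mono (\<tau> x)" "\<And>x. x \<in> endpoints P \<Longrightarrow> \<tau> x 0 = (0::real)"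
    "\<And>x t. x \<in> endpoints P \<Longrightarrow> v x t = v x 0 * ee (\<tau> x t)"
    "\<And>x t. x \<in> endpoints P \<Longrightarrow> z x t = z x 0 * ee (\<beta> * \<tau> x t)"
    using time_change by metis
  obtain C where C: "\<And>x. x \<in> endpoints P \<Longrightarrow> \<tau> x 1 \<le> C"
    using time_bound \<tau> by metis
  have \<tau>pos: "\<tau> x 1 > 0" if "x \<in> endpoints P" for x
    using strict_monoD[OF \<tau>(2)[OF that], of 0 1] \<tau>(3)[OF that] by simp
  have slice: "continuous_on (endpoints P) (\<lambda>x. (x, 0::real))"
    by (intro continuous_on_Pair continuous_on_id continuous_on_const)
  have v0: "continuous_on (endpoints P) (\<lambda>x. v x 0)" and z0: "continuous_on (endpoints P) (\<lambda>x. z x 0)"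
    using continuous_on_compose2[OF v_cont slice] continuous_on_compose2[OF z_cont slice] by auto
  obtain s where s: "continuous_on (endpoints P) s" "\<And>x. x \<in> endpoints P \<Longrightarrow> s (x + 1) = s x"
    "\<And>x. x \<in> endpoints P \<Longrightarrow> v x 0 = ee (s x)"
    using periodic_ee_lift[OF v0 v_norm v_add_1] by metis
  obtain S where S: "\<And>x. x \<in> endpoints P \<Longrightarrow> \<bar>s x\<bar> \<le> S"
    using periodic_bounded[OF s(1,2)] by (auto simp: bounded_iff)
  define u where "u x = z x 0 * ee (- (\<beta> * s x))" for x
  define k where "k x = \<lfloor>\<tau> x 1 + s x - s (f x)\<rfloor>" for x
  have k: "\<tau> x 1 + s x - s (f x) = of_int (k x)" if x: "x \<in> endpoints P" for x
  proof -
    have "ee (s (f x)) = ee (s x + \<tau> x 1)"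
      using s(3)[of "f x"] s(3)[OF x] x v_f[OF x, of 0] \<tau>(4)[OF x, of 1] by (simp add: ee_add)
    then obtain n :: int where "s (f x) = s x + \<tau> x 1 + of_int n" unfolding ee_eq_iff by blast
    then have "\<tau> x 1 + s x - s (f x) = of_int (- n)" by simp
    then show ?thesis unfolding k_def by (metis of_int_floor_cancel)
  qed
  interpret int_cocycle P f \<alpha> \<beta> u k "\<lceil>C + 2 * S\<rceil>"
  proof unfold_locales
    show "continuous_on (endpoints P) u" unfolding u_def
      by (intro continuous_on_mult z0 continuous_on_ee continuous_on_minus continuous_on_mult_left s(1))
    show "norm (u x) = 1" if "x \<in> endpoints P" for x
      using z_norm[OF that] by (simp add: u_def norm_mult)
    show "u (x + 1) = u x" if "x \<in> endpoints P" for x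
      using z_add_1[OF that] s(2)[OF that] by (simp add: u_def)
    show "\<bar>k x\<bar> \<le> \<lceil>C + 2 * S\<rceil>" if x: "x \<in> endpoints P" for x
    proof -
      have "\<bar>real_of_int (k x)\<bar> \<le> C + 2 * S"
        using k[OF x] C[OF x] \<tau>pos[OF x] S[OF x] S[of "f x"] x by (simp add: abs_le_iff)
      then show ?thesis by linarith
    qed
    show "u (f x) = u x * ee (\<beta> * of_int (k x))" if x: "x \<in> endpoints P" for x
    proof -
      have "u (f x) = z x 0 * ee (\<beta> * \<tau> x 1 - \<beta> * s (f x))"
        using z_f[OF x, of 0] \<tau>(5)[OF x, of 1] by (simp add: u_def ee_diff ee_minus divide_inverse)
      also have "\<beta> * \<tau> x 1 - \<beta> * s (f x) = \<beta> * of_int (k x) - \<beta> * s x"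
        using k[OF x] by (simp add: algebra_simps flip: k[OF x])
      finally show ?thesis by (simp add: u_def ee_diff ee_minus divide_inverse)
    qed
  qed (rule beta_irrational)
  obtain l c p q r d where a: "l = of_int p + of_int r * \<beta>" "l * \<alpha> = of_int q + of_int d * \<beta>"
    and u: "\<And>x. x \<in> endpoints P \<Longrightarrow> \<exists>j::int. u x = ee (l * P x + c + \<beta> * of_int j)"
    and B: "\<And>x. x \<in> endpoints P \<Longrightarrow> \<exists>B. \<forall>i. \<bar>of_int (K i x) - real i * (of_int d - of_int r * \<alpha>)\<bar> \<le> B"
    using affine by metis
  \<comment> \<open>Time moves forward, so the Birkhoff sums of \<open>k\<close> are bounded below;
    a negative mean would drive them to minus infinity.\<close>
  have "of_int d - of_int r * \<alpha> \<ge> 0"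
  proof (rule ccontr)
    assume neg: "\<not> of_int d - of_int r * \<alpha> \<ge> 0"
    let ?x = "lo P 0"
    have K: "real_of_int (K i ?x) \<ge> s ?x - s ((f ^^ i) ?x)" for i
    proof (induction i)
      case (Suc i)
      then show ?case using k[of "(f ^^ i) ?x"] \<tau>pos[of "(f ^^ i) ?x"] by (simp add: K_def)
    qed (simp add: K_def)
    obtain B where B: "\<And>i. \<bar>of_int (K i ?x) - real i * (of_int d - of_int r * \<alpha>)\<bar> \<le> B"
      using B[of ?x] by auto
    obtain i :: nat where "real i * (of_int r * \<alpha> - of_int d) > B + 2 * S"
      using reals_Archimedean3[of "of_int r * \<alpha> - of_int d"] neg by auto
    moreover have "s ?x - s ((f ^^ i) ?x) \<ge> - 2 * S"
      using S[of ?x] S[of "(f ^^ i) ?x"] by (simp add: abs_le_iff)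
    ultimately show False using B[of i] K[of i] by (simp add: algebra_simps abs_le_iff)
  qed
  moreover have "\<exists>j::int. z x 0 = ee (l * P x + c + \<beta> * (\<sigma> + of_int j))"
    if x: "x \<in> endpoints P" and \<sigma>: "v x 0 = ee \<sigma>" for x \<sigma>
  proof -
    obtain j :: int where "u x = ee (l * P x + c + \<beta> * of_int j)" using u[OF x] by blast
    then have "z x 0 = ee (l * P x + c + \<beta> * of_int j) * ee (\<beta> * s x)"
      by (simp add: u_def ee_minus field_simps)
    moreover obtain n :: int where "s x = \<sigma> + of_int n"
      using s(3)[OF x] \<sigma> ee_eq_iff by metis
    ultimately have "z x 0 = ee (l * P x + c + \<beta> * (\<sigma> + of_int (j + n)))"
      by (simp add: ee_add[symmetric] algebra_simps)
    then show ?thesis by blast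
  qed
  ultimately show thesis using that a by blast
qed

end

subsection \<open>Matching the lattices of all large powers\<close>

text \<open>The translation is left unspecified because only the factors, which multiply under
  composition, are compared between different powers.\<close>

definition similar :: "real \<Rightarrow> real set \<Rightarrow> real set \<Rightarrow> bool" where
  "similar l Q R \<longleftrightarrow> (\<exists>c. R = (\<lambda>t. l * t + c) ` Q)"

lemma similar_trans: "similar l Q R \<Longrightarrow> similar l' R S \<Longrightarrow> similar (l' * l) Q S"
proof -
  assume "similar l Q R" "similar l' R S"
  then obtain c c' where "R = (\<lambda>t. l * t + c) ` Q" "S = (\<lambda>t. l' * t + c') ` R"
    by (auto simp: similar_def)
  then have "S = (\<lambda>t. (l' * l) * t + (l' * c + c')) ` Q"
    by (simp add: image_image algebra_simps)
  then show ?thesis unfolding similar_def by blast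
qed

lemma similar_inverse: "similar l Q R \<Longrightarrow> l \<noteq> 0 \<Longrightarrow> similar (inverse l) R Q"
proof -
  assume "similar l Q R" and l: "l \<noteq> 0"
  then obtain c where c: "R = (\<lambda>t. l * t + c) ` Q" by (auto simp: similar_def)
  have "Q = (\<lambda>t. inverse l * t + (- c / l)) ` R"
    unfolding c image_image using l by (simp add: field_simps)
  then show ?thesis unfolding similar_def by blast
qed

lemma similar_power_int:
  assumes "similar e Q Q" "e \<noteq> 0"
  shows "similar (e powi i) Q Q"
proof -
  have nat: "similar (e ^ n) Q Q" for n
  proof (induction n)
    case 0
    show ?case unfolding similar_def by (rule exI[of _ 0]) simp
  next
    case (Suc n)
    then show ?case using similar_trans[OF _ assms(1)] by simp
  qed
  show ?thesis
  proof (cases "i \<ge> 0")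
    case True
    then show ?thesis using nat by (simp add: power_int_def)
  next
    case False
    then show ?thesis using similar_inverse[OF nat[of "nat (-i)"]] assms(2)
      by (simp add: power_int_def power_inverse)
  qed
qed

text \<open>Multiplication by \<open>l\<close> maps \<open>\<int> + a\<int>\<close> onto \<open>\<int> + b\<int>\<close>; the sign condition says that the induced
  isomorphism of suspension flows preserves the direction of time.\<close>

locale lattice_iso =
  fixes a b l :: real and p q r d :: int
  assumes l_eq: "l = of_int p + of_int r * b" and la_eq: "l * a = of_int q + of_int d * b"
    and det: "\<bar>p * d - q * r\<bar> = 1" and det_sign: "l * of_int (p * d - q * r) > 0"
begin

text \<open>Elimination of \<open>b\<close> from the two equations. By this identity,
  \<open>det_sign\<close> expresses positivity of the second factor.\<close>

lemma l_dual: "l * (of_int d - of_int r * a) = of_int (p * d - q * r)"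
proof -
  have "l * (of_int d - of_int r * a) = of_int d * l - of_int r * (l * a)" by (simp add: algebra_simps)
  also have "\<dots> = of_int (p * d - q * r)" unfolding la_eq by (simp add: l_eq algebra_simps)
  finally show ?thesis .
qed

text \<open>The determinant is \<open>p * d\<close> here, so both factors are units, and
  \<open>det_sign\<close> excludes \<open>d = -1\<close>, the reversal of time.\<close>

lemma trivial:
  assumes "r = 0"
  shows "d = 1" "p \<in> {1, -1}" "l = of_int p"
proof -
  have "\<bar>p\<bar> * \<bar>d\<bar> = 1" using det assms by (simp add: abs_mult)
  then have pd: "p \<in> {1, -1}" "d \<in> {1, -1}" by (auto simp: zmult_eq_1_iff abs_if split: if_splits)
  show "l = of_int p" using l_eq assms by simp
  then have "real_of_int (p * (p * d)) > 0" using det_sign assms by simp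
  then have "p * (p * d) > 0" by (simp only: of_int_0_less_iff)
  then show "d = 1" "p \<in> {1, -1}" using pd by auto
qed

text \<open>A positive \<open>\<theta>\<close> that maps \<int> + b\<int> to itself with determinant
  1 respects all conditions. On coordinates it multiplies the matrix with rows \<open>p, r\<close>
  and \<open>q, d\<close> from the right.\<close>

lemma scale:
  assumes \<theta>: "\<theta> = of_int x + of_int y * b" "\<theta> * b = of_int x' + of_int y' * b"
    and "x * y' - y * x' = 1" and "\<theta> > 0"
  shows "lattice_iso a b (l * \<theta>) (p * x + r * x') (q * x + d * x') (p * y + r * y') (q * y + d * y')"
proof
  have "l * \<theta> = of_int p * \<theta> + of_int r * (\<theta> * b)" by (simp add: l_eq algebra_simps)
  then show "l * \<theta> = of_int (p * x + r * x') + of_int (p * y + r * y') * b"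
    unfolding \<theta>(2) unfolding \<theta>(1) by (simp add: algebra_simps)
  have "l * \<theta> * a = (l * a) * \<theta>" by simp
  also have "\<dots> = (of_int q + of_int d * b) * \<theta>" by (simp only: la_eq)
  also have "\<dots> = of_int q * \<theta> + of_int d * (\<theta> * b)" by (simp add: algebra_simps)
  finally show "l * \<theta> * a = of_int (q * x + d * x') + of_int (q * y + d * y') * b"
    unfolding \<theta>(2) unfolding \<theta>(1) by (simp add: algebra_simps)
  have "(p * x + r * x') * (q * y + d * y') - (q * x + d * x') * (p * y + r * y')
      = (p * d - q * r) * (x * y' - y * x')" by (simp add: algebra_simps)
  then have eq: "(p * x + r * x') * (q * y + d * y') - (q * x + d * x') * (p * y + r * y') = p * d - q * r"
    using assms(3) by simp
  show "\<bar>(p * x + r * x') * (q * y + d * y') - (q * x + d * x') * (p * y + r * y')\<bar> = 1"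
    unfolding eq by (rule det)
  have "l * of_int (p * d - q * r) * \<theta> > 0" using det_sign assms(4) by (rule mult_pos_pos)
  then show "l * \<theta> * of_int ((p * x + r * x') * (q * y + d * y') - (q * x + d * x') * (p * y + r * y')) > 0"
    unfolding eq by (simp only: mult_ac)
qed

end

text \<open>The two equations make \<open>s * \<alpha> - \<beta>\<close> a multiple of
  \<open>1 / m\<close> and \<open>s' * \<alpha> - \<beta>\<close> a multiple of
  \<open>1 / n\<close>. Irrationality identifies \<open>s\<close> and \<open>s'\<close>, and for
  coprime denominators only integers are multiples of both.\<close>

lemma sign_translation_of_coprime:
  fixes m n :: int and \<alpha> \<beta> :: real
  assumes irr: "\<alpha> \<notin> \<rat>" and mn: "m \<noteq> 0" "n \<noteq> 0" "coprime m n"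
    and m: "of_int s * (of_int m * \<alpha>) = of_int q + of_int m * \<beta>"
    and n: "of_int s' * (of_int n * \<alpha>) = of_int q' + of_int n * \<beta>"
  shows "s = s' \<and> (\<exists>k::int. \<beta> = of_int s * \<alpha> + of_int k)"
proof -
  have "of_int (m * q') + of_int (m * n * s) * \<alpha> = of_int (n * q) + of_int (m * n * s') * \<alpha>"
    using arg_cong[OF m, of "\<lambda>x. of_int n * x"] arg_cong[OF n, of "\<lambda>x. of_int m * x"]
    by (simp add: algebra_simps)
  then have "m * q' = n * q \<and> m * n * s = m * n * s'" using irrational_comb_eq[OF irr] by blast
  then have s: "s = s'" and "m dvd n * q" using mn by (auto simp: dvd_def) (metis mult.commute)
  then have "m dvd q" using mn(3) by (simp add: coprime_dvd_mult_right_iff)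
  then obtain k where "q = m * k" by blast
  then have "of_int m * \<beta> = of_int m * (of_int s * \<alpha> + of_int (- k))" using m by (simp add: algebra_simps)
  then have "\<beta> = of_int s * \<alpha> + of_int (- k)" using mn(1) by (simp del: of_int_minus)
  then show ?thesis using s by blast
qed

text \<open>Eliminating \<open>\<alpha>\<close> from the two identities \<open>l_dual\<close> leaves
  an equation for \<open>\<beta>\<close> with leading coefficient \<open>\<kappa> * x * x'\<close>.
  If \<open>\<kappa>\<close> vanishes, its linear coefficient gives
  \<open>\<bar>x\<bar> = \<bar>x'\<bar>\<close>, which \<open>ne\<close> excludes.\<close>

lemma quadratic_of_two_lattice_isos:
  fixes n n' :: nat
  assumes irr: "\<beta> \<notin> \<rat>"
    and "lattice_iso (real n * \<alpha>) (real n * \<beta>) l p q r d"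
    and "lattice_iso (real n' * \<alpha>) (real n' * \<beta>) l' p' q' r' d'"
    and ne: "\<bar>int n * r\<bar> \<noteq> \<bar>int n' * r'\<bar>" "int n * r \<noteq> 0" "int n' * r' \<noteq> 0"
  obtains A B C :: int where "A \<noteq> 0" "of_int A * \<beta>\<^sup>2 + of_int B * \<beta> + of_int C = 0"
proof -
  interpret L: lattice_iso "real n * \<alpha>" "real n * \<beta>" l p q r d by fact
  interpret L': lattice_iso "real n' * \<alpha>" "real n' * \<beta>" l' p' q' r' d' by fact
  define x x' D D' where "x = int n * r" and "x' = int n' * r'"
    and "D = p * d - q * r" and "D' = p' * d' - q' * r'"
  define \<kappa> where "\<kappa> = x' * d - x * d'"
  have l: "l = of_int p + of_int x * \<beta>" "l' = of_int p' + of_int x' * \<beta>"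
    using L.l_eq L'.l_eq by (simp_all add: x_def x'_def)
  have dual: "l * (of_int d - of_int x * \<alpha>) = of_int D" "l' * (of_int d' - of_int x' * \<alpha>) = of_int D'"
    using L.l_dual L'.l_dual by (simp_all add: x_def x'_def D_def D'_def mult_ac)
  have "of_int \<kappa> * (l * l') = of_int x' * l' * (l * (of_int d - of_int x * \<alpha>)) - of_int x * l * (l' * (of_int d' - of_int x' * \<alpha>))"
    by (simp add: \<kappa>_def algebra_simps)
  then have "of_int \<kappa> * (l * l') = of_int x' * l' * of_int D - of_int x * l * of_int D'"
    unfolding dual .
  then have quad: "of_int (\<kappa> * x * x') * \<beta>\<^sup>2 + of_int (\<kappa> * (p * x' + p' * x) - x' * x' * D + x * x * D') * \<beta>
      + of_int (\<kappa> * p * p' - x' * D * p' + x * D' * p) = 0"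
    by (simp add: l algebra_simps power2_eq_square)
  show thesis
  proof (cases "\<kappa> = 0")
    case True
    then have "of_int (- x' * D * p' + x * D' * p) + of_int (x * x * D' - x' * x' * D) * \<beta> = of_int 0 + of_int 0 * \<beta>"
      using quad by (simp add: algebra_simps)
    then have "x * x * D' = x' * x' * D" using irrational_comb_eq[OF irr] by fastforce
    then have "\<bar>x * x\<bar> * \<bar>D'\<bar> = \<bar>x' * x'\<bar> * \<bar>D\<bar>" by (metis abs_mult)
    then have "\<bar>x\<bar> * \<bar>x\<bar> = \<bar>x'\<bar> * \<bar>x'\<bar>" using L.det L'.det by (simp add: D_def D'_def abs_mult)
    then have "\<bar>x\<bar> = \<bar>x'\<bar>" 
      using power2_eq_iff_nonneg[of "\<bar>x\<bar>" "\<bar>x'\<bar>"] by (simp add: power2_eq_square)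
    then show ?thesis using ne by (simp add: x_def x'_def)
  next
    case False
    then have "\<kappa> * x * x' \<noteq> 0" using ne(2,3) by (simp add: x_def x'_def)
    then show ?thesis using quad by (rule that)
  qed
qed

text \<open>As in the classical solution of Pell's equation, among infinitely many elements of
  bounded norm two have the same norm and are congruent modulo \<open>h\<close>, so their quotient
  is integral of norm 1. Growth of \<open>x\<close> makes the quotient nontrivial.\<close>

lemma pell_unit_of_infinite_norm:
  fixes X x :: "nat \<Rightarrow> int" and \<Delta> h :: int
  assumes inf: "infinite I" and "\<Delta> > 0" and norm: "\<And>n. n \<in> I \<Longrightarrow> \<bar>(X n)\<^sup>2 - \<Delta> * (x n)\<^sup>2\<bar> = h" and "h > 0"
    and large: "\<And>n. n \<in> I \<Longrightarrow> \<bar>x n\<bar> \<ge> int n"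
  obtains a b :: int where "a > 0" "b > 0" "a\<^sup>2 - \<Delta> * b\<^sup>2 = 1"
proof -
  define g where "g n = ((X n)\<^sup>2 - \<Delta> * (x n)\<^sup>2, X n mod h, x n mod h)" for n
  have "g ` I \<subseteq> {h, -h} \<times> {0..<h} \<times> {0..<h}"
    using norm \<open>h > 0\<close> by (force simp: g_def abs_if split: if_splits)
  then have "finite (g ` I)" by (rule finite_subset) simp
  then obtain n where n: "n \<in> I" "infinite {m \<in> I. g m = g n}"
    using pigeonhole_infinite[OF inf] by blast
  obtain m where m: "m \<in> I" "g m = g n" "m > nat \<bar>x n\<bar>"
    using n(2) unfolding infinite_nat_iff_unbounded by blast
  define N where "N = (X n)\<^sup>2 - \<Delta> * (x n)\<^sup>2"
  have N: "(X m)\<^sup>2 - \<Delta> * (x m)\<^sup>2 = N" "\<bar>N\<bar> = h" using m norm[OF n(1)] by (simp_all add: g_def N_def)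
  have ne: "\<bar>x m\<bar> > \<bar>x n\<bar>" using large[OF m(1)] m(3) by linarith
  have cong: "h dvd X m - X n" "h dvd x m - x n"
    using m(2) by (simp_all add: g_def mod_eq_dvd_iff)
  have hN: "h dvd N" using N(2) by (metis dvd_abs_iff dvd_refl)
  \<comment> \<open>This and the next expression are, up to sign, the coordinates of the product of
    one element with the conjugate of the other.\<close>
  have "X n * X m - \<Delta> * x n * x m = N + X n * (X m - X n) - \<Delta> * x n * (x m - x n)"
    by (simp add: N_def algebra_simps power2_eq_square)
  then have "h dvd X n * X m - \<Delta> * x n * x m" using cong hN by simp
  then obtain a where a: "X n * X m - \<Delta> * x n * x m = h * a" by blast
  have "x n * X m - X n * x m = x n * (X m - X n) - X n * (x m - x n)" by (simp add: algebra_simps)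
  then have "h dvd x n * X m - X n * x m" using cong by simp
  then obtain b where b: "x n * X m - X n * x m = h * b" by blast
  have "(h * a)\<^sup>2 - \<Delta> * (h * b)\<^sup>2 = ((X n)\<^sup>2 - \<Delta> * (x n)\<^sup>2) * ((X m)\<^sup>2 - \<Delta> * (x m)\<^sup>2)"
    unfolding a[symmetric] b[symmetric] by (simp add: algebra_simps power2_eq_square)
  then have "(h * a)\<^sup>2 - \<Delta> * (h * b)\<^sup>2 = N * N" unfolding N(1) N_def .
  then have "h * h * (a\<^sup>2 - \<Delta> * b\<^sup>2) = h * h * 1"
    using N(2) by (metis (no_types, lifting) abs_mult_self_eq mult.left_commute mult.right_neutral power_mult_distrib right_diff_distrib power2_eq_square)
  then have ab: "a\<^sup>2 - \<Delta> * b\<^sup>2 = 1" using \<open>h > 0\<close> by simp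
  \<comment> \<open>Proportional elements of equal nonzero norm have coordinates of equal size,
    contrary to the choice of \<open>m\<close>.\<close>
  have "b \<noteq> 0"
  proof
    assume "b = 0"
    then have e: "x n * X m = X n * x m" using b by simp
    have "(x m)\<^sup>2 * N = (X n * x m)\<^sup>2 - \<Delta> * (x n)\<^sup>2 * (x m)\<^sup>2"
      by (simp add: N_def algebra_simps power_mult_distrib)
    also have "\<dots> = (x n)\<^sup>2 * N"
      unfolding e[symmetric] N(1)[symmetric] by (simp add: algebra_simps power_mult_distrib)
    finally have "(x m)\<^sup>2 * N = (x n)\<^sup>2 * N" .
    moreover have "N \<noteq> 0" using N(2) \<open>h > 0\<close> by auto
    ultimately have "(x m)\<^sup>2 = (x n)\<^sup>2" by simp
    then show False using ne by (simp add: power2_eq_iff abs_if split: if_splits)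
  qed
  moreover have "a \<noteq> 0"
  proof
    assume "a = 0"
    then have "- (\<Delta> * b\<^sup>2) = 1" using ab by simp
    moreover have "\<Delta> * b\<^sup>2 \<ge> 0" using \<open>\<Delta> > 0\<close> by simp
    ultimately show False by linarith
  qed
  ultimately show thesis using ab by (intro that[of "\<bar>a\<bar>" "\<bar>b\<bar>"]) auto
qed

text \<open>The Lucas sequence of a unit \<open>\<epsilon>\<close> of norm \<open>1\<close> and trace \<open>t\<close>. Modulo its \<open>m\<close>-th term \<open>n\<close>, the power
  \<open>\<epsilon>\<^sup>m\<close> is an integer, so that \<open>\<epsilon>\<^sup>m\<close> preserves \<open>\<int> + n\<beta>\<int>\<close>, although \<open>n\<close> is about as large as \<open>\<epsilon>\<^sup>m\<close>.\<close>

fun luc :: "int \<Rightarrow> nat \<Rightarrow> int" where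
  "luc t 0 = 0"
| "luc t (Suc 0) = 1"
| "luc t (Suc (Suc m)) = t * luc t (Suc m) - luc t m"

lemma luc_power:
  fixes e :: "'a :: comm_ring_1"
  assumes "e\<^sup>2 = of_int t * e - 1"
  shows "e ^ Suc m = of_int (luc t (Suc m)) * e - of_int (luc t m)"
proof (induction m)
  case (Suc m)
  have "e ^ Suc (Suc m) = of_int (luc t (Suc m)) * e\<^sup>2 - of_int (luc t m) * e"
    unfolding power_Suc[of e "Suc m"] Suc by (simp add: algebra_simps power2_eq_square)
  then show ?case unfolding assms by (simp add: algebra_simps)
qed simp

text \<open>The left side is the norm of \<open>e ^ Suc m\<close> in the basis \<open>e\<close>, 1,
  for a unit \<open>e\<close> of norm 1 and trace \<open>t\<close>. It gives coprimality of
  consecutive terms and determinant 1 for multiplication by the power.\<close>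

lemma luc_norm: "(luc t (Suc m))\<^sup>2 - t * luc t (Suc m) * luc t m + (luc t m)\<^sup>2 = 1"
  by (induction m) (simp_all add: algebra_simps power2_eq_square)

lemma luc_coprime: "coprime (luc t (Suc m)) (luc t m)"
proof (rule coprimeI)
  fix c assume "c dvd luc t (Suc m)" "c dvd luc t m"
  then have "c dvd (luc t (Suc m))\<^sup>2 - t * luc t (Suc m) * luc t m + (luc t m)\<^sup>2"
    by (simp add: power2_eq_square)
  then show "is_unit c" unfolding luc_norm .
qed

lemma luc_increasing:
  assumes "t \<ge> 2"
  shows "luc t m \<ge> int m \<and> luc t (Suc m) \<ge> luc t m + 1"
proof (induction m)
  case (Suc m)
  then have "luc t (Suc m) \<ge> int (Suc m)" by simp
  moreover have "2 * luc t (Suc m) \<le> t * luc t (Suc m)"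
    using assms Suc by (intro mult_right_mono) auto
  ultimately show ?case using Suc unfolding luc.simps by linarith
qed simp

section \<open>Quadratic irrationals and their units\<close>

lemma power_int_bracket:
  fixes E y :: real
  assumes "E > 1" "y > 0"
  obtains g :: int where "E powi g \<le> y" "y < E powi (g + 1)"
proof
  let ?g = "\<lfloor>log E y\<rfloor>"
  have "E powi i = E powr of_int i" for i
    using assms(1) by (simp add: powr_real_of_int')
  moreover have "E powr of_int ?g \<le> E powr log E y" "E powr log E y < E powr of_int (?g + 1)"
    using assms(1) by (auto simp del: powr_log_cancel intro!: powr_mono powr_less_mono)
  ultimately show "E powi ?g \<le> y" "y < E powi (?g + 1)" using assms by simp_all
qed

text \<open>The number \<open>s\<close> is the positive square root of the discriminant; a common
  change of sign of \<open>A\<close>, \<open>B\<close>, \<open>C\<close> arranges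
  \<open>s_pos\<close>.\<close>

locale quadratic_irrational =
  fixes \<beta> s :: real and A B C :: int
  assumes irr: "\<beta> \<notin> \<rat>" and root: "of_int A * \<beta>\<^sup>2 + of_int B * \<beta> + of_int C = 0"
    and s_eq: "s = 2 * of_int A * \<beta> + of_int B" and s_pos: "s > 0"
begin

abbreviation "\<Delta> \<equiv> B\<^sup>2 - 4 * A * C"

lemma s_square: "s * s = of_int \<Delta>"
proof -
  have "s * s = 4 * of_int A * (of_int A * \<beta>\<^sup>2 + of_int B * \<beta> + of_int C) + of_int \<Delta>"
    by (simp add: s_eq algebra_simps power2_eq_square)
  then show ?thesis unfolding root by simp
qed

lemma A_nonzero: "A \<noteq> 0"
proof
  assume "A = 0"
  then have "of_int C + of_int B * \<beta> = of_int 0 + of_int 0 * \<beta>" using root by simp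
  then have "B = 0" using irrational_comb_eq[OF irr] by blast
  then show False using s_eq s_pos \<open>A = 0\<close> by simp
qed

lemma s_irrational: "s \<notin> \<rat>"
proof
  assume "s \<in> \<rat>"
  then have "(s - of_int B) / (2 * of_int A) \<in> \<rat>" by (intro Rats_divide Rats_diff) auto
  then show False using irr A_nonzero by (simp add: s_eq)
qed

text \<open>This is \<open>4A\<^sup>2\<close> times the norm of \<open>p + x\<beta>\<close> in the quadratic field generated by \<open>\<beta>\<close>.\<close>

definition nrm :: "int \<Rightarrow> int \<Rightarrow> int" where
  "nrm p x = (2 * A * p - B * x)\<^sup>2 - \<Delta> * x\<^sup>2"

lemma nrm_factor:
  "of_int (nrm p x) = 2 * of_int A * (of_int p + of_int x * \<beta>) * (of_int (2 * A * p - B * x) - of_int x * s)"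
proof -
  have prod: "(u + w) * (u - w) = u\<^sup>2 - w\<^sup>2" for u w :: real
    by (simp add: algebra_simps power2_eq_square)
  have "2 * of_int A * (of_int p + of_int x * \<beta>) = of_int (2 * A * p - B * x) + of_int x * s"
    by (simp add: s_eq algebra_simps)
  then have "2 * of_int A * (of_int p + of_int x * \<beta>) * (of_int (2 * A * p - B * x) - of_int x * s)
      = (of_int (2 * A * p - B * x))\<^sup>2 - (of_int x)\<^sup>2 * (s * s)"
    by (simp only: prod power_mult_distrib power2_eq_square[of s])
  also have "\<dots> = of_int (nrm p x)" unfolding s_square by (simp add: nrm_def algebra_simps)
  finally show ?thesis by simp
qed

lemma nrm_nonzero:
  assumes "x \<noteq> 0"
  shows "nrm p x \<noteq> 0"
proof
  assume "nrm p x = 0"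
  then have "of_int p + of_int x * \<beta> = of_int 0 + of_int 0 * \<beta> \<or>
      of_int (2 * A * p - B * x) + of_int (- x) * s = of_int 0 + of_int 0 * s"
    using nrm_factor[of p x] A_nonzero by auto
  then show False
    using irrational_comb_eq[OF irr] irrational_comb_eq[OF s_irrational] assms by (metis neg_equal_0_iff_equal)
qed

text \<open>By \<open>l_dual\<close>, the coefficient of \<open>s\<close> in \<open>\<alpha>\<close>
  is \<open>2 * A * D / nrm p x\<close>, where \<open>D\<close> is a determinant \<plusminus>1 and
  \<open>x = n * r\<close>. It belongs to \<open>\<alpha>\<close> alone, so the norm is the same for
  all powers up to sign.\<close>

lemma nrm_constant:
  fixes n n' :: nat
  assumes "lattice_iso (real n * \<alpha>) (real n * \<beta>) l p q r d"
    and "lattice_iso (real n' * \<alpha>) (real n' * \<beta>) l' p' q' r' d'"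
    and ne: "int n * r \<noteq> 0" "int n' * r' \<noteq> 0"
  shows "\<bar>nrm p (int n * r)\<bar> = \<bar>nrm p' (int n' * r')\<bar>"
proof -
  have key: "of_int (nrm p (int n * r) * (int n * r)) * \<alpha>
      = of_int (nrm p (int n * r) * d - 2 * A * (p * d - q * r) * (2 * A * p - B * (int n * r)))
        + of_int (2 * A * (p * d - q * r) * (int n * r)) * s"
    if "lattice_iso (real n * \<alpha>) (real n * \<beta>) l p q r d" for n l p q r d
  proof -
    interpret lattice_iso "real n * \<alpha>" "real n * \<beta>" l p q r d by fact
    define x where "x = int n * r"
    have "l = of_int p + of_int x * \<beta>" using l_eq by (simp add: x_def)
    then have N: "of_int (nrm p x) = 2 * of_int A * l * (of_int (2 * A * p - B * x) - of_int x * s)"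
      using nrm_factor by simp
    have "l * (of_int d - of_int x * \<alpha>) = of_int (p * d - q * r)"
      using l_dual by (simp add: x_def mult_ac)
    moreover have "of_int (nrm p x) * (of_int d - of_int x * \<alpha>)
        = 2 * of_int A * (l * (of_int d - of_int x * \<alpha>)) * (of_int (2 * A * p - B * x) - of_int x * s)"
      unfolding N by (simp only: mult_ac)
    ultimately have "of_int (nrm p x) * (of_int d - of_int x * \<alpha>)
        = 2 * of_int A * of_int (p * d - q * r) * (of_int (2 * A * p - B * x) - of_int x * s)"
      by simp
    then show ?thesis unfolding x_def[symmetric] by (simp add: algebra_simps)
  qed
  define x x' where "x = int n * r" and "x' = int n' * r'"
  define D D' where "D = p * d - q * r" and "D' = p' * d' - q' * r'"
  define N N' where "N = nrm p x" and "N' = nrm p' x'"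
  define c c' where "c = N * d - 2 * A * D * (2 * A * p - B * x)" and "c' = N' * d' - 2 * A * D' * (2 * A * p' - B * x')"
  have k: "of_int (N * x) * \<alpha> = of_int c + of_int (2 * A * D * x) * s"
    "of_int (N' * x') * \<alpha> = of_int c' + of_int (2 * A * D' * x') * s"
    using key[OF assms(1)] key[OF assms(2)]
    unfolding x_def[symmetric] x'_def[symmetric] D_def[symmetric] D'_def[symmetric] N_def[symmetric] N'_def[symmetric] c_def c'_def
    by auto
  have "of_int (N' * x' * c) + of_int (N' * x' * (2 * A * D * x)) * s = of_int (N * x * c') + of_int (N * x * (2 * A * D' * x')) * s"
    using arg_cong[OF k(1), of "\<lambda>y. of_int (N' * x') * y"] arg_cong[OF k(2), of "\<lambda>y. of_int (N * x) * y"]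
    by (simp add: algebra_simps)
  then have "N' * x' * (2 * A * D * x) = N * x * (2 * A * D' * x')"
    using irrational_comb_eq[OF s_irrational] by blast
  then have "(2 * A * x * x') * (N' * D) = (2 * A * x * x') * (N * D')" by (simp only: mult_ac)
  then have "N' * D = N * D'" using ne A_nonzero by (simp add: x_def x'_def)
  then have "\<bar>N'\<bar> * \<bar>D\<bar> = \<bar>N\<bar> * \<bar>D'\<bar>" by (metis abs_mult)
  moreover have "\<bar>D\<bar> = 1" "\<bar>D'\<bar> = 1"
    using lattice_iso.det[OF assms(1)] lattice_iso.det[OF assms(2)] by (simp_all add: D_def D'_def)
  ultimately show ?thesis by (simp add: N_def N'_def x_def x'_def)
qed

text \<open>The coordinate \<open>x\<close> is recovered from the difference of \<open>l\<close> and
  its conjugate, and the conjugate is controlled by the norm divided by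
  \<open>\<bar>l\<bar>\<close>. Keeping \<open>\<bar>l\<bar>\<close> and its inverse below
  \<open>sqrt E\<close> bounds both terms at once.\<close>

lemma coordinate_bound:
  assumes "\<bar>nrm p x\<bar> = h" "l = of_int p + of_int x * \<beta>" "l \<noteq> 0" "E > 1" "inverse E \<le> l\<^sup>2" "l\<^sup>2 \<le> E"
  shows "\<bar>of_int x\<bar> * (2 * s) \<le> (2 * of_int \<bar>A\<bar> + of_int h) * sqrt E"
proof -
  have l: "\<bar>l\<bar> \<le> sqrt E" using assms(6) by (metis real_sqrt_abs real_sqrt_le_iff)
  have "inverse (sqrt E) \<le> \<bar>l\<bar>"
    using real_sqrt_le_mono[OF assms(5)] by (simp add: real_sqrt_inverse)
  then have il: "inverse \<bar>l\<bar> \<le> sqrt E" using assms(3,4) by (simp add: field_simps)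
  define w where "w = of_int (2 * A * p - B * x) - of_int x * s"
  have N: "of_int (nrm p x) = 2 * of_int A * l * w" using nrm_factor assms(2) by (simp add: w_def)
  have "2 * of_int x * s = 2 * of_int A * l - w"
    unfolding w_def assms(2) by (simp add: s_eq algebra_simps)
  moreover have "\<bar>2 * of_int x * s\<bar> = \<bar>of_int x\<bar> * (2 * s)" using s_pos by (simp add: abs_mult)
  ultimately have "\<bar>of_int x\<bar> * (2 * s) = \<bar>2 * of_int A * l - w\<bar>" by simp
  also have "\<dots> \<le> 2 * of_int \<bar>A\<bar> * \<bar>l\<bar> + \<bar>w\<bar>"
    using abs_triangle_ineq4[of "2 * of_int A * l" w] by (simp add: abs_mult)
  also have "\<bar>w\<bar> \<le> of_int h * inverse \<bar>l\<bar>"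
  proof -
    have "of_int h = 2 * of_int \<bar>A\<bar> * \<bar>l\<bar> * \<bar>w\<bar>" using N assms(1) by (metis abs_mult abs_numeral of_int_abs)
    moreover have "1 * (\<bar>l\<bar> * \<bar>w\<bar>) \<le> 2 * of_int \<bar>A\<bar> * (\<bar>l\<bar> * \<bar>w\<bar>)"
      using A_nonzero by (intro mult_right_mono) auto
    ultimately have "\<bar>l\<bar> * \<bar>w\<bar> \<le> of_int h" by simp
    then show ?thesis using assms(3) by (simp add: field_simps)
  qed
  also have "2 * of_int \<bar>A\<bar> * \<bar>l\<bar> + of_int h * inverse \<bar>l\<bar> \<le> 2 * of_int \<bar>A\<bar> * sqrt E + of_int h * sqrt E"
    using l il assms(1) by (intro add_mono mult_left_mono) auto
  finally show ?thesis by (simp add: algebra_simps)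
qed

end

locale pell_unit = quadratic_irrational \<beta> s A B C for \<beta> s :: real and A B C :: int +
  fixes a b :: int
  assumes a_pos: "a > 0" and b_pos: "b > 0" and pell: "a\<^sup>2 - \<Delta> * b\<^sup>2 = 1"
begin

definition \<epsilon> :: real where
  "\<epsilon> = of_int a + of_int b * s"

definition \<epsilon>' :: real where
  "\<epsilon>' = of_int a - of_int b * s"

abbreviation U :: "nat \<Rightarrow> int" where
  "U \<equiv> luc (2 * a)"

lemma unit: "\<epsilon> * \<epsilon>' = 1"
proof -
  have "\<epsilon> * \<epsilon>' = (of_int a)\<^sup>2 - (s * s) * (of_int b)\<^sup>2"
    by (simp add: \<epsilon>_def \<epsilon>'_def algebra_simps power2_eq_square)
  also have "\<dots> = of_int (a\<^sup>2 - \<Delta> * b\<^sup>2)" unfolding s_square by simp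
  finally show ?thesis unfolding pell by simp
qed

lemma trace: "\<epsilon> + \<epsilon>' = of_int (2 * a)"
  by (simp add: \<epsilon>_def \<epsilon>'_def)

lemma epsilon_square: "\<epsilon>\<^sup>2 = of_int (2 * a) * \<epsilon> - 1" "\<epsilon>'\<^sup>2 = of_int (2 * a) * \<epsilon>' - 1"
  unfolding trace[symmetric] unit[symmetric] by (simp_all add: algebra_simps power2_eq_square)

lemma epsilon_gt_1: "\<epsilon> > 1"
proof -
  have "real_of_int a \<ge> 1" "of_int b * s > 0" using a_pos b_pos s_pos by simp_all
  then show ?thesis unfolding \<epsilon>_def by linarith
qed

lemma epsilon_eq: "\<epsilon> = of_int (a + b * B) + of_int (2 * A * b) * \<beta>"
  unfolding \<epsilon>_def by (simp add: s_eq algebra_simps)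

lemma inverse_epsilon: "inverse \<epsilon> = \<epsilon>'"
  using unit by (rule inverse_unique)

lemma U_pos: "U (Suc m) \<ge> 1" and U_ge: "U m \<ge> int m"
  using luc_increasing[of "2 * a" m] luc_increasing[of "2 * a" "Suc m"] a_pos by linarith+

text \<open>Binet's formula, in which the power of the conjugate unit is at most 1.\<close>

lemma U_growth: "2 * of_int b * s * of_int (U (Suc m)) \<ge> \<epsilon> ^ Suc m - 1"
proof -
  have "\<epsilon> ^ Suc m - \<epsilon>' ^ Suc m = of_int (U (Suc m)) * (\<epsilon> - \<epsilon>')"
    using luc_power[OF epsilon_square(1), of m] luc_power[OF epsilon_square(2), of m]
    by (simp only: right_diff_distrib)
  moreover have "\<epsilon> - \<epsilon>' = 2 * of_int b * s" by (simp add: \<epsilon>_def \<epsilon>'_def)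
  moreover have "\<epsilon>' ^ Suc m \<le> 1"
    unfolding inverse_epsilon[symmetric] using epsilon_gt_1
    by (intro power_le_one) (auto intro: less_imp_le simp: inverse_le_1_iff)
  ultimately show ?thesis by (simp add: mult_ac)
qed

text \<open>Since \<open>\<epsilon> ^ Suc m\<close> equals \<open>n * \<epsilon> - U m\<close>, and
  multiplication by \<open>n * \<epsilon>\<close> maps \<int> + n\<beta>\<int> into itself, so does
  the power. The determinant is 1 by \<open>luc_norm\<close>, so negative powers are covered as
  well.\<close>

lemma lattice_iso_unit:
  assumes n: "int n = U (Suc m)"
    and "lattice_iso (real n * \<alpha>) (real n * \<beta>) l p q r d"
  shows "\<exists>p q r d. lattice_iso (real n * \<alpha>) (real n * \<beta>) (l * (\<epsilon> ^ Suc m) powi j) p q r d"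
proof -
  \<comment> \<open>Rows of multiplication by \<open>\<epsilon> ^ Suc m\<close> in the basis 1,
    \<open>n * \<beta>\<close>, reduced with the equation \<open>root\<close>.\<close>
  define x y x' y' where "x = int n * (a + b * B) - U m" and "y = 2 * A * b"
    and "x' = - 2 * b * C * int n * int n" and "y' = int n * (a - b * B) - U m"
  define \<theta> where "\<theta> = \<epsilon> ^ Suc m"
  have \<theta>pos: "\<theta> > 0" unfolding \<theta>_def using epsilon_gt_1 by (intro zero_less_power) simp
  have \<theta>: "\<theta> = real n * \<epsilon> - of_int (U m)"
    unfolding \<theta>_def luc_power[OF epsilon_square(1)] n[symmetric] by simp
  have 1: "\<theta> = of_int x + of_int y * (real n * \<beta>)"
    by (simp add: \<theta> epsilon_eq x_def y_def algebra_simps)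
  have "\<theta> * (real n * \<beta>) = of_int x' + of_int y' * (real n * \<beta>)
      + 2 * of_int b * (real n)\<^sup>2 * (of_int A * \<beta>\<^sup>2 + of_int B * \<beta> + of_int C)"
    by (simp add: \<theta> epsilon_eq x'_def y'_def algebra_simps power2_eq_square)
  then have 2: "\<theta> * (real n * \<beta>) = of_int x' + of_int y' * (real n * \<beta>)" unfolding root by simp
  have "x * y' - y * x' = (int n)\<^sup>2 * (a\<^sup>2 - \<Delta> * b\<^sup>2) - 2 * a * int n * U m + (U m)\<^sup>2"
    by (simp add: x_def y_def x'_def y'_def algebra_simps power2_eq_square)
  then have det: "x * y' - y * x' = 1" unfolding pell n using luc_norm[of "2 * a" m] by simp
  \<comment> \<open>As the determinant is 1, the inverse acts by the adjugate matrix.\<close>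
  have 3: "inverse \<theta> = of_int y' + of_int (- y) * (real n * \<beta>)"
  proof (rule inverse_unique)
    have "\<theta> * (of_int y' + of_int (- y) * (real n * \<beta>)) = of_int y' * \<theta> - of_int y * (\<theta> * (real n * \<beta>))"
      by (simp add: algebra_simps)
    also have "\<dots> = of_int (x * y' - y * x')" unfolding 2 unfolding 1 by (simp add: algebra_simps)
    finally show "\<theta> * (of_int y' + of_int (- y) * (real n * \<beta>)) = 1" unfolding det by simp
  qed
  have "\<theta> * (of_int (- x') + of_int x * (real n * \<beta>)) = of_int x * (\<theta> * (real n * \<beta>)) - of_int x' * \<theta>"
    by (simp add: algebra_simps)
  also have "\<dots> = of_int (x * y' - y * x') * (real n * \<beta>)" unfolding 2 unfolding 1 by (simp add: algebra_simps)
  finally have "\<theta> * (of_int (- x') + of_int x * (real n * \<beta>)) = real n * \<beta>" unfolding det by simp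
  then have 4: "inverse \<theta> * (real n * \<beta>) = of_int (- x') + of_int x * (real n * \<beta>)"
    using \<theta>pos by (simp add: field_simps)
  have det': "y' * x - - y * - x' = 1" using det by (simp add: algebra_simps)
  have "\<exists>p q r d. lattice_iso (real n * \<alpha>) (real n * \<beta>) (l * \<theta> powi j) p q r d"
  proof (induction j rule: int_induct[of _ 0])
    case base
    show ?case using assms(2) by auto
  next
    case (step1 i)
    then obtain p q r d where "lattice_iso (real n * \<alpha>) (real n * \<beta>) (l * \<theta> powi i) p q r d" by blast
    from lattice_iso.scale[OF this 1 2 det \<theta>pos] show ?case
      using \<theta>pos by (auto simp: power_int_add mult.assoc)
  next
    case (step2 i)
    then obtain p q r d where "lattice_iso (real n * \<alpha>) (real n * \<beta>) (l * \<theta> powi i) p q r d" by blast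
    from lattice_iso.scale[OF this 3 4 det'] show ?case
      using \<theta>pos by (auto simp: power_int_diff mult.assoc divide_inverse)
  qed
  then show ?thesis by (simp only: \<theta>_def)
qed

text \<open>A power of \<open>E = \<epsilon> ^ Suc m\<close> moves the square of the slope between
  \<open>inverse E\<close> and \<open>E\<close>. There a nonzero \<open>r\<close> would make the
  coordinate \<open>n * r\<close> at least \<open>n\<close>, which is of order \<open>E\<close> by
  \<open>U_growth\<close>, while \<open>coordinate_bound\<close> allows only order
  \<open>sqrt E\<close>.\<close>

lemma lattice_iso_reduce:
  assumes n: "int n = U (Suc m)"
    and iso: "lattice_iso (real n * \<alpha>) (real n * \<beta>) l p q r d"
    and h: "\<And>l p q r d. lattice_iso (real n * \<alpha>) (real n * \<beta>) l p q r d \<Longrightarrow> r \<noteq> 0 \<Longrightarrow> \<bar>nrm p (int n * r)\<bar> = h"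
    and large: "\<epsilon> ^ Suc m > (of_int b * (2 * of_int \<bar>A\<bar> + of_int h) + 1)\<^sup>2" and "h > 0"
  obtains \<sigma> q j :: int where "\<sigma> \<in> {1, -1}" "lattice_iso (real n * \<alpha>) (real n * \<beta>) (of_int \<sigma>) \<sigma> q 0 1"
    "l = of_int \<sigma> * \<epsilon> powi (int (Suc m) * j)"
proof -
  define E where "E = \<epsilon> ^ Suc m"
  have E: "E > 1" unfolding E_def using epsilon_gt_1 by (intro one_less_power) auto
  have l0: "l \<noteq> 0" using lattice_iso.det_sign[OF iso] by auto
  then have "l\<^sup>2 * E > 0" using E by simp
  moreover have "E\<^sup>2 > 1" using E by (simp add: one_less_power)
  \<comment> \<open>The bracket has ratio \<open>E\<^sup>2\<close>, because a factor
    \<open>E\<close> on \<open>l\<close> changes \<open>l\<^sup>2\<close> by that much.\<close>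
  ultimately obtain g where g: "(E\<^sup>2) powi g \<le> l\<^sup>2 * E" "l\<^sup>2 * E < (E\<^sup>2) powi (g + 1)"
    using power_int_bracket by blast
  define L where "L = l * E powi (- g)"
  have L0: "L \<noteq> 0" using l0 E by (simp add: L_def)
  have "(E\<^sup>2) powi g = (E powi g)\<^sup>2" by (simp add: power2_eq_square power_int_mult_distrib)
  then have L2: "L\<^sup>2 * (E\<^sup>2) powi g = l\<^sup>2"
    using E by (simp add: L_def power_mult_distrib power_int_minus power_inverse)
  have Eg: "(E\<^sup>2) powi g > 0" using E by simp
  have "(E\<^sup>2) powi g * 1 \<le> (E\<^sup>2) powi g * (L\<^sup>2 * E)"
    using g(1) unfolding L2[symmetric] by (simp add: mult_ac)
  then have "1 \<le> L\<^sup>2 * E" using Eg by (simp only: mult_le_cancel_left_pos)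
  then have lower: "inverse E \<le> L\<^sup>2" using E by (simp add: field_simps)
  have "(E\<^sup>2) powi (g + 1) = (E\<^sup>2) powi g * E\<^sup>2" using E by (simp add: power_int_add)
  then have "(E\<^sup>2) powi g * (L\<^sup>2 * E) < (E\<^sup>2) powi g * E\<^sup>2"
    using g(2) unfolding L2[symmetric] by (simp add: mult_ac)
  then have "L\<^sup>2 * E < E\<^sup>2" using Eg by (simp only: mult_less_cancel_left_pos)
  then have upper: "L\<^sup>2 \<le> E" using E by (simp add: power2_eq_square)
  obtain p q r d where iso': "lattice_iso (real n * \<alpha>) (real n * \<beta>) L p q r d"
    using lattice_iso_unit[OF n iso, of "-g"] unfolding L_def E_def by blast
  interpret I: lattice_iso "real n * \<alpha>" "real n * \<beta>" L p q r d by (rule iso')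
  have "r = 0"
  proof (rule ccontr)
    assume "r \<noteq> 0"
    have Lx: "L = of_int p + of_int (int n * r) * \<beta>" using I.l_eq by simp
    define G where "G = 2 * of_int \<bar>A\<bar> + real_of_int h"
    have Gpos: "G \<ge> 0" using \<open>h > 0\<close> by (simp add: G_def)
    have "\<bar>of_int (int n * r)\<bar> * (2 * s) \<le> G * sqrt E"
      unfolding G_def by (rule coordinate_bound[OF h[OF iso' \<open>r \<noteq> 0\<close>] Lx L0 E lower upper])
    moreover have "real n * (2 * s) \<le> \<bar>of_int (int n * r)\<bar> * (2 * s)"
      using \<open>r \<noteq> 0\<close> s_pos by (intro mult_right_mono) (auto simp: abs_mult mult_le_cancel_left1)
    ultimately have "real n * (2 * s) \<le> G * sqrt E" by linarith
    then have "of_int b * (real n * (2 * s)) \<le> of_int b * (G * sqrt E)"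
      using b_pos by (intro mult_left_mono) auto
    moreover have "E - 1 \<le> of_int b * (real n * (2 * s))"
      using U_growth[of m] unfolding n[symmetric] E_def[symmetric] by (simp add: mult_ac)
    ultimately have *: "E - 1 \<le> (of_int b * G) * sqrt E" by (simp add: mult_ac)
    have bG: "of_int b * G \<ge> 0" using b_pos Gpos by simp
    \<comment> \<open>The threshold in \<open>large\<close> is chosen so that multiplying this
      inequality by \<open>sqrt E\<close> refutes the estimate just obtained.\<close>
    have "sqrt E > of_int b * G + 1"
      using large bG unfolding E_def[symmetric] G_def[symmetric] by (intro real_less_rsqrt)
    then have "(of_int b * G + 1) * sqrt E < sqrt E * sqrt E"
      using E by (intro mult_strict_right_mono) auto
    then have "(of_int b * G) * sqrt E + sqrt E < E" using E by (simp add: algebra_simps)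
    moreover have "sqrt E \<ge> 1" using E by simp
    ultimately show False using * by linarith
  qed
  then have t: "d = 1" "p \<in> {1, -1}" "L = of_int p" using I.trivial by blast+
  have "l = of_int p * E powi g" using t(3) E by (simp add: L_def power_int_minus field_simps)
  also have "E powi g = \<epsilon> powi (int (Suc m) * g)" unfolding E_def by (simp only: power_int_mult power_int_of_nat)
  finally show thesis using iso' t \<open>r = 0\<close> by (intro that[of p q g]) auto
qed

end

theorem similar_of_eventual_lattice_iso:
  fixes \<alpha> \<beta> :: real and Q R :: "real set"
  assumes irr\<alpha>: "\<alpha> \<notin> \<rat>" and irr\<beta>: "\<beta> \<notin> \<rat>"
    and ev: "\<And>n. n \<ge> n0 \<Longrightarrow> \<exists>l p q r d. lattice_iso (real n * \<alpha>) (real n * \<beta>) l p q r d \<and> similar l Q R"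
  obtains \<sigma> k :: int where "\<sigma> \<in> {1, -1}" "\<beta> = of_int \<sigma> * \<alpha> + of_int k" "similar (of_int \<sigma>) Q R"
proof -
  obtain l p q r d where iso: "\<And>n. n \<ge> n0 \<Longrightarrow> lattice_iso (real n * \<alpha>) (real n * \<beta>) (l n) (p n) (q n) (r n) (d n)"
    and sim: "\<And>n. n \<ge> n0 \<Longrightarrow> similar (l n) Q R"
    using ev by metis
  have sign: "of_int \<sigma> * (of_int (int n) * \<alpha>) = of_int q + of_int (int n) * \<beta>"
    if "lattice_iso (real n * \<alpha>) (real n * \<beta>) (of_int \<sigma>) \<sigma> q 0 1" for n \<sigma> q
    using lattice_iso.la_eq[OF that] by simp
  define I where "I = {n. n \<ge> n0 \<and> n > 0 \<and> r n \<noteq> 0}"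
  show thesis
  proof (cases "finite I")
    case True
    then obtain N where N: "\<And>n. n \<in> I \<Longrightarrow> n < N" by (metis finite_nat_set_iff_bounded)
    define n where "n = max (max N n0) 1"
    have triv: "p m \<in> {1, -1}" "l m = of_int (p m)" "lattice_iso (real m * \<alpha>) (real m * \<beta>) (of_int (p m)) (p m) (q m) 0 1"
      if "m \<ge> n" for m
    proof -
      have m: "m \<ge> n0" "m > 0" "m \<ge> N" using that by (auto simp: n_def)
      then have "r m = 0" using N[of m] by (auto simp: I_def)
      with lattice_iso.trivial[OF iso[OF m(1)]] iso[OF m(1)]
      show "p m \<in> {1, -1}" "l m = of_int (p m)" "lattice_iso (real m * \<alpha>) (real m * \<beta>) (of_int (p m)) (p m) (q m) 0 1"
        by auto
    qed
    \<comment> \<open>Two consecutive powers have trivial slopes, and their exponents are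
      coprime.\<close>
    have cop: "coprime (int n) (int (Suc n))"
      using coprime_Suc_right_nat[of n] by (simp only: coprime_int_iff)
    have "n \<ge> 1" by (simp add: n_def)
    then obtain k :: int where "\<beta> = of_int (p n) * \<alpha> + of_int k"
      using sign_translation_of_coprime[OF irr\<alpha> _ _ cop sign[OF triv(3)[of n]] sign[OF triv(3)[of "Suc n"]]] by auto
    moreover have "similar (of_int (p n)) Q R" using sim[of n] triv(2)[of n] by (simp add: n_def)
    ultimately show thesis using triv(1)[of n] that by blast
  next
    case False
    have large: "\<bar>int n * r n\<bar> \<ge> int n" if "n \<in> I" for n
      using that by (auto simp: I_def abs_mult mult_le_cancel_left1)
    obtain n1 where n1: "n1 \<in> I" using False by fastforce
    \<comment> \<open>The coordinates \<open>n * r n\<close> are unbounded on \<open>I\<close>, so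
      two of them differ in size, which makes \<open>\<beta>\<close> quadratic.\<close>
    obtain n2 where n2: "n2 \<in> I" "n2 > nat \<bar>int n1 * r n1\<bar>"
      using False unfolding infinite_nat_iff_unbounded by blast
    have "\<bar>int n1 * r n1\<bar> \<noteq> \<bar>int n2 * r n2\<bar>" using large[OF n2(1)] n2(2) by linarith
    moreover have "int n1 * r n1 \<noteq> 0" "int n2 * r n2 \<noteq> 0" using n1 n2 by (auto simp: I_def)
    ultimately obtain A B C :: int where ABC: "A \<noteq> 0" "of_int A * \<beta>\<^sup>2 + of_int B * \<beta> + of_int C = 0"
      using quadratic_of_two_lattice_isos[OF irr\<beta> iso iso] n1 n2(1) unfolding I_def by blast
    have "2 * of_int A * \<beta> + of_int B \<noteq> 0"
    proof
      assume "2 * of_int A * \<beta> + of_int B = 0"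
      then have "of_int B + of_int (2 * A) * \<beta> = of_int 0 + of_int 0 * \<beta>" by simp
      then show False using irrational_comb_eq[OF irr\<beta>] ABC(1) by fastforce
    qed
    then have "\<exists>s A B C. quadratic_irrational \<beta> s A B C"
    proof (cases "2 * of_int A * \<beta> + of_int B > 0")
      case True
      then have "quadratic_irrational \<beta> (2 * of_int A * \<beta> + of_int B) A B C"
        using irr\<beta> ABC(2) by unfold_locales auto
      then show ?thesis by blast
    next
      case False
      assume "2 * of_int A * \<beta> + of_int B \<noteq> 0"
      with False have "quadratic_irrational \<beta> (2 * of_int (-A) * \<beta> + of_int (-B)) (-A) (-B) (-C)"
        using irr\<beta> ABC(2) by unfold_locales auto
      then show ?thesis by blast
    qed
    then obtain s A B C where "quadratic_irrational \<beta> s A B C" by blast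
    then interpret quadratic_irrational \<beta> s A B C .
    define h where "h = \<bar>nrm (p n1) (int n1 * r n1)\<bar>"
    have h_pos: "h > 0" unfolding h_def using nrm_nonzero[of "int n1 * r n1"] n1 by (auto simp: I_def)
    have h: "\<bar>nrm p (int n * r)\<bar> = h"
      if "lattice_iso (real n * \<alpha>) (real n * \<beta>) l p q r d" "r \<noteq> 0" "n > 0" for n l p q r d
      unfolding h_def by (rule nrm_constant[OF that(1) iso]) (use that n1 in \<open>auto simp: I_def\<close>)
    have "real_of_int \<Delta> > 0" unfolding s_square[symmetric] using s_pos by simp
    then have "\<Delta> > 0" by (simp only: of_int_0_less_iff)
    then obtain a b :: int where ab: "a > 0" "b > 0" "a\<^sup>2 - \<Delta> * b\<^sup>2 = 1"
    proof (rule pell_unit_of_infinite_norm[OF False _ _ h_pos large])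
      fix n assume "n \<in> I"
      then show "\<bar>(2 * A * p n - B * (int n * r n))\<^sup>2 - \<Delta> * (int n * r n)\<^sup>2\<bar> = h"
        using h[OF iso[of n]] by (simp add: I_def nrm_def)
    qed
    interpret pell_unit \<beta> s A B C a b by unfold_locales (fact ab)+
    define G :: real where "G = (of_int b * (2 * of_int \<bar>A\<bar> + of_int h) + 1)\<^sup>2"
    obtain m1 where m1: "G < \<epsilon> ^ m1" using real_arch_pow[OF epsilon_gt_1] by blast
    define M where "M = max (max m1 n0) 1"
    \<comment> \<open>From here on only Lucas terms serve as exponents: there slopes reduce to a
      sign times a power of \<open>\<epsilon> ^ m\<close>, and consecutive terms are
      coprime.\<close>
    define n where "n m = nat (U m)" for m
    have "\<exists>(\<sigma>::int) (q::int) (j::int). \<sigma> \<in> {1, -1} \<and> lattice_iso (real (n m) * \<alpha>) (real (n m) * \<beta>) (of_int \<sigma>) \<sigma> q 0 1 \<and>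
        similar (of_int \<sigma> * \<epsilon> powi (int m * j)) Q R" if m: "m \<ge> M" for m
    proof -
      obtain m' where m': "m = Suc m'" using m by (cases m) (auto simp: M_def)
      have nU: "int (n m) = U m" "n m > 0" "n m \<ge> n0"
        using U_pos[of m'] U_ge[of m] m by (auto simp: n_def m' M_def)
      have nU': "int (n m) = U (Suc m')" using nU(1) m' by simp
      have "\<epsilon> ^ m1 \<le> \<epsilon> ^ m" using m epsilon_gt_1 by (intro power_increasing) (auto simp: M_def)
      then have "\<epsilon> ^ Suc m' > G" using m1 m' by simp
      moreover have "\<bar>nrm p (int (n m) * r)\<bar> = h"
        if "lattice_iso (real (n m) * \<alpha>) (real (n m) * \<beta>) l p q r d" "r \<noteq> 0" for l p q r d
        using h[OF that nU(2)] .
      ultimately obtain \<sigma> q j :: int where "\<sigma> \<in> {1, -1}" "lattice_iso (real (n m) * \<alpha>) (real (n m) * \<beta>) (of_int \<sigma>) \<sigma> q 0 1"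
          "l (n m) = of_int \<sigma> * \<epsilon> powi (int (Suc m') * j)"
        using lattice_iso_reduce[OF nU' iso[OF nU(3)] _ _ h_pos] unfolding G_def by metis
      then show ?thesis using sim[OF nU(3)] m' by metis
    qed
    then obtain \<sigma> q j :: "nat \<Rightarrow> int" where \<sigma>: "\<And>m. m \<ge> M \<Longrightarrow> \<sigma> m \<in> {1, -1}"
      and iso\<sigma>: "\<And>m. m \<ge> M \<Longrightarrow> lattice_iso (real (n m) * \<alpha>) (real (n m) * \<beta>) (of_int (\<sigma> m)) (\<sigma> m) (q m) 0 1"
      and sim\<sigma>: "\<And>m. m \<ge> M \<Longrightarrow> similar (of_int (\<sigma> m) * \<epsilon> powi (int m * j m)) Q R"
      by metis
    have nU: "int (n m) = U m" "int (n m) \<noteq> 0" if "m \<ge> M" for m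
      using U_ge[of m] that by (auto simp: n_def M_def)
    have const: "\<sigma> m = \<sigma> (Suc m) \<and> (\<exists>k::int. \<beta> = of_int (\<sigma> m) * \<alpha> + of_int k)" if "m \<ge> M" for m
    proof (rule sign_translation_of_coprime[OF irr\<alpha> nU(2)[OF that] nU(2)[OF le_SucI[OF that]]
          _ sign[OF iso\<sigma>[OF that]] sign[OF iso\<sigma>[OF le_SucI[OF that]]]])
      show "coprime (int (n m)) (int (n (Suc m)))"
        unfolding nU(1)[OF that] nU(1)[OF le_SucI[OF that]] using luc_coprime by (simp only: coprime_commute)
    qed
    define \<sigma>0 where "\<sigma>0 = \<sigma> M"
    have \<sigma>0: "\<sigma> m = \<sigma>0" if "m \<ge> M" for m
      using that
    proof (induction m rule: dec_induct)
      case (step i)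
      then show ?case using const[OF step(1)] by metis
    qed (simp add: \<sigma>0_def)
    have sim0: "similar (of_int \<sigma>0 * \<epsilon> powi (int m * j m)) Q R" if "m \<ge> M" for m
      using sim\<sigma>[OF that] \<sigma>0[OF that] by simp
    have \<sigma>0_in: "\<sigma>0 \<in> {1, -1}" using \<sigma>[of M] by (simp add: \<sigma>0_def)
    obtain k :: int where k: "\<beta> = of_int \<sigma>0 * \<alpha> + of_int k" using const[of M] unfolding \<sigma>0_def by blast
    have \<epsilon>0: "\<epsilon> \<noteq> 0" using epsilon_gt_1 by simp
    \<comment> \<open>Following one similarity from \<open>Q\<close> to \<open>R\<close> by the
      inverse of another gives a self-similarity of \<open>Q\<close>.\<close>
    have ratio: "similar (\<epsilon> powi (x - y)) Q Q"
      if "similar (of_int \<sigma>0 * \<epsilon> powi x) Q R" "similar (of_int \<sigma>0 * \<epsilon> powi y) Q R" for x y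
    proof -
      have "similar (inverse (of_int \<sigma>0 * \<epsilon> powi y) * (of_int \<sigma>0 * \<epsilon> powi x)) Q Q"
        using similar_trans[OF that(1) similar_inverse[OF that(2)]] \<epsilon>0 \<sigma>0_in by auto
      moreover have "inverse (of_int \<sigma>0 * \<epsilon> powi y) * (of_int \<sigma>0 * \<epsilon> powi x) = \<epsilon> powi (x - y)"
        using \<epsilon>0 \<sigma>0_in by (auto simp: power_int_diff field_simps)
      ultimately show ?thesis by simp
    qed
    have "similar (of_int \<sigma>0) Q R"
    proof (cases "\<exists>m\<ge>M. j m = 0")
      case True
      then show ?thesis using sim0 by force
    next
      case False
      define K where "K = int M * j M"
      \<comment> \<open>An index beyond the size of \<open>K\<close>, with its \<open>j\<close>
        nonzero, has an exponent different from \<open>K\<close>; the difference \<open>e\<close> is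
        a nontrivial self-similarity exponent of \<open>Q\<close>.\<close>
      define m2 where "m2 = max M (Suc (nat \<bar>K\<bar>))"
      have m2: "m2 \<ge> M" "int m2 > \<bar>K\<bar>" by (auto simp: m2_def)
      have "int m2 * 1 \<le> int m2 * \<bar>j m2\<bar>" using False m2(1) by (intro mult_left_mono) auto
      then have "\<bar>int m2 * j m2\<bar> > \<bar>K\<bar>" using m2(2) by (simp add: abs_mult)
      then have "K - int m2 * j m2 \<noteq> 0" by auto
      define e where "e = K - int m2 * j m2"
      have e: "similar (\<epsilon> powi e) Q Q"
        unfolding e_def K_def by (rule ratio[OF sim0 sim0]) (use m2 in auto)
      \<comment> \<open>An index divisible by \<open>e\<close> makes the exponent
        \<open>m3 * j m3\<close> a multiple of \<open>e\<close>, which powers of the self-similarity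
        \<open>\<epsilon> powi e\<close> cancel. The factor \<open>M\<close> keeps the index in
        range.\<close>
      define m3 where "m3 = nat \<bar>e\<bar> * M"
      have "nat \<bar>e\<bar> \<ge> 1" using \<open>K - int m2 * j m2 \<noteq> 0\<close> by (simp add: e_def)
      then have "m3 \<ge> M" by (simp add: m3_def)
      define i where "i = sgn e * int M * j m3"
      have ei: "int m3 * j m3 = e * i"
      proof -
        have "int m3 = \<bar>e\<bar> * int M" by (simp add: m3_def)
        also have "\<dots> = e * sgn e * int M" by (simp only: abs_sgn)
        finally show ?thesis by (simp add: i_def mult_ac)
      qed
      have "similar ((\<epsilon> powi e) powi (- i)) Q Q" by (rule similar_power_int[OF e]) (use \<epsilon>0 in simp)
      then have "similar (of_int \<sigma>0 * \<epsilon> powi (e * i) * (\<epsilon> powi e) powi (- i)) Q R"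
        using similar_trans[OF _ sim0[OF \<open>m3 \<ge> M\<close>]] unfolding ei by blast
      moreover have "(\<epsilon> powi e) powi (- i) = inverse (\<epsilon> powi (e * i))"
        by (simp only: power_int_minus power_int_mult)
      moreover have "of_int \<sigma>0 * \<epsilon> powi (e * i) * inverse (\<epsilon> powi (e * i)) = of_int \<sigma>0"
        using \<epsilon>0 by (simp add: mult.assoc)
      ultimately show ?thesis by metis
    qed
    then show thesis using \<sigma>0_in k that by blast
  qed
qed

subsection \<open>Lifting maps of the circle\<close>

lemma int_iterate_in:
  assumes "bij_betw S (topspace X) (topspace X)" "x \<in> topspace X"
  shows "int_iterate X S k x \<in> topspace X"
proof -
  have "(S ^^ n) x \<in> topspace X" "(inv_into (topspace X) S ^^ n) x \<in> topspace X" for n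
    by (induction n)
      (use assms bij_betwE[OF assms(1)] bij_betwE[OF bij_betw_inv_into[OF assms(1)]] in auto)
  then show ?thesis by (simp add: int_iterate_def)
qed

lemma int_iterate_Suc:
  assumes S: "bij_betw S (topspace X) (topspace X)" and x: "x \<in> topspace X"
  shows "int_iterate X S (k + 1) x = S (int_iterate X S k x)"
proof (cases "k \<ge> 0")
  case True
  then have "nat (k + 1) = Suc (nat k)" by simp
  then show ?thesis using True by (simp add: int_iterate_def)
next
  case False
  define n where "n = nat (- (k + 1))"
  have n: "nat (- k) = Suc n" using False by (simp add: n_def)
  have k1: "int_iterate X S (k + 1) x = (inv_into (topspace X) S ^^ n) x"
    using False by (cases "k = -1") (simp_all add: int_iterate_def n_def)
  have "(inv_into (topspace X) S ^^ n) x \<in> topspace X"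
    using int_iterate_in[OF S x, of "k + 1"] k1 by simp
  then have "S (inv_into (topspace X) S ((inv_into (topspace X) S ^^ n) x)) = (inv_into (topspace X) S ^^ n) x"
    using S by (intro f_inv_into_f) (simp add: bij_betw_def)
  then show ?thesis using False n k1 by (simp add: int_iterate_def)
qed

lemma int_iterate_0 [simp]: "int_iterate X S 0 x = x"
  by (simp add: int_iterate_def)

lemma int_iterate_of_nat [simp]: "int_iterate X S (int n) x = (S ^^ n) x"
  by (simp add: int_iterate_def)

text \<open>A two-sided orbit is determined by one of its points, backwards by injectivity. This
  avoids computing with \<open>inv_into\<close>.\<close>

lemma int_iterate_eqI:
  assumes "\<And>k. h (k + 1) = S (h k)" and "\<And>k. h k \<in> topspace X"
    and S: "bij_betw S (topspace X) (topspace X)"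
  shows "int_iterate X S k (h 0) = h k"
proof (induction k rule: int_induct[of _ 0])
  case (step1 i)
  then show ?case using int_iterate_Suc[OF S assms(2)] assms(1) by simp
next
  case (step2 i)
  have "S (int_iterate X S (i - 1) (h 0)) = S (h (i - 1))"
    using int_iterate_Suc[OF S assms(2), of "i - 1" 0] assms(1)[of "i - 1"] step2 by simp
  then show ?case
    using S int_iterate_in[OF S assms(2)] assms(2) by (auto simp: bij_betw_def dest: inj_onD)
qed simp

lemma int_iterate_add:
  assumes S: "bij_betw S (topspace X) (topspace X)" and x: "x \<in> topspace X"
  shows "int_iterate X S (k + l) x = int_iterate X S k (int_iterate X S l x)"
proof -
  have "int_iterate X S k ((\<lambda>k. int_iterate X S (k + l) x) 0) = int_iterate X S (k + l) x"
  proof (rule int_iterate_eqI[OF _ _ S])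
    show "int_iterate X S (k + 1 + l) x = S (int_iterate X S (k + l) x)" for k
      using int_iterate_Suc[OF S x, of "k + l"] by (simp add: algebra_simps)
  qed (rule int_iterate_in[OF S x])
  then show ?thesis by simp
qed

lemma circle_proj_add_int [simp]: "circle_proj (x + of_int n) = circle_proj x"
  by (simp add: circle_proj_eq_iff)

lemma circle_proj_eqD: "circle_proj x = circle_proj y \<Longrightarrow> \<exists>n::int. x = y + of_int n"
  unfolding circle_proj_eq_iff by (metis Ints_cases add.commute diff_add_cancel)

lemma topspace_circle: "topspace circle = range circle_proj"
  by (simp add: circle_def topspace_quotient_topology)

lemma quotient_map_circle: "quotient_map euclideanreal circle circle_proj"
  unfolding circle_def by (rule quotient_map_quotient_topology)

lemma closedin_circle_iff: "closedin circle D \<longleftrightarrow> D \<subseteq> range circle_proj \<and> closed {x. circle_proj x \<in> D}"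
proof -
  have "closedin circle D \<longleftrightarrow> closed {x. circle_proj x \<in> D}" if "D \<subseteq> range circle_proj"
    using quotient_map_circle that unfolding quotient_map_closedin topspace_circle by simp
  then show ?thesis using closedin_subset topspace_circle by blast
qed

lemma saturated_vimage:
  assumes "\<And>x m. x + of_int m \<in> M \<longleftrightarrow> x \<in> M"
  shows "{x. circle_proj x \<in> circle_proj ` M} = M"
  using assms by (auto dest!: circle_proj_eqD)

lemma quotient_map_circle_subset:
  assumes "closed M" "\<And>x m. x + of_int m \<in> M \<longleftrightarrow> x \<in> M"
  shows "quotient_map (top_of_set M) (subtopology circle (circle_proj ` M)) circle_proj"
proof (rule quotient_map_restriction[OF quotient_map_circle])
  show "{x \<in> topspace euclideanreal. circle_proj x \<in> circle_proj ` M} = M"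
    using saturated_vimage[OF assms(2)] by simp
  show "openin circle (circle_proj ` M) \<or> closedin circle (circle_proj ` M)"
    using assms(1) saturated_vimage[OF assms(2)] by (auto simp: closedin_circle_iff)
qed

lemma topspace_circle_subset: "topspace (subtopology circle (circle_proj ` M)) = circle_proj ` M"
  by (auto simp: topspace_circle)

text \<open>If values to the right of \<open>x\<close> stayed away from \<open>H x\<close> while
  points of \<open>M\<close> accumulate at \<open>x\<close>, their infimum would be a value
  \<open>H z\<close> with \<open>x < z\<close>, yet a point of \<open>M\<close> between
  \<open>x\<close> and \<open>z\<close> has a smaller value. Continuity of a conjugacy will thus
  follow from order alone.\<close>

lemma strict_mono_closed_image_right:
  fixes H :: "real \<Rightarrow> real"
  assumes mono: "strict_mono_on M H" and cl: "closed (H ` M)" and x: "x \<in> M" and e: "e > 0"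
  obtains d where "d > 0" "\<And>y. y \<in> M \<Longrightarrow> x \<le> y \<Longrightarrow> y < x + d \<Longrightarrow> H y < H x + e"
proof (cases "\<exists>y\<in>M. x < y \<and> H y < H x + e")
  case True
  then obtain z where z: "z \<in> M" "x < z" "H z < H x + e" by blast
  show thesis
  proof (rule that[of "z - x"])
    fix y assume "y \<in> M" "x \<le> y" "y < x + (z - x)"
    then have "H y < H z" using mono z by (auto simp: strict_mono_on_def)
    then show "H y < H x + e" using z by simp
  qed (use z in simp)
next
  case False
  then have ge: "H y \<ge> H x + e" if "y \<in> M" "x < y" for y using that by force
  show thesis
  proof (cases "\<exists>d>0. \<forall>y\<in>M. x < y \<longrightarrow> y \<ge> x + d")
    case True
    then obtain d where d: "d > 0" "\<forall>y\<in>M. x < y \<longrightarrow> y \<ge> x + d" by blast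
    show thesis
    proof (rule that[OF d(1)])
      fix y assume "y \<in> M" "x \<le> y" "y < x + d"
      then have "y = x" using d(2) by force
      then show "H y < H x + e" using e by simp
    qed
  next
    case nd: False
    let ?S = "H ` {y \<in> M. x < y}"
    have "\<exists>y\<in>M. x < y" using nd by (metis zero_less_one)
    then have ne: "?S \<noteq> {}" by blast
    have bdd: "bdd_below ?S" using ge by (intro bdd_belowI[of _ "H x + e"]) auto
    have "Inf ?S \<in> closure ?S" by (rule closure_contains_Inf[OF ne bdd])
    moreover have "closure ?S \<subseteq> H ` M" by (rule closure_minimal[OF _ cl]) auto
    ultimately obtain z where z: "z \<in> M" "Inf ?S = H z" by auto
    have "H x + e \<le> Inf ?S" using ge by (intro cInf_greatest[OF ne]) auto
    then have "H x < H z" using z e by simp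
    then have "x < z" using mono x z(1) by (metis less_asym not_less_iff_gr_or_eq strict_mono_on_def)
    then obtain y where y: "y \<in> M" "x < y" "y < z"
      using nd by (metis add_diff_cancel_left' diff_add_cancel diff_gt_0_iff_gt not_le add.commute)
    then have "H y < H z" using mono z(1) by (auto simp: strict_mono_on_def)
    moreover have "Inf ?S \<le> H y" using y by (intro cInf_lower[OF _ bdd]) auto
    ultimately show thesis using z(2) by simp
  qed
qed

lemma strict_mono_closed_image_continuous:
  fixes H :: "real \<Rightarrow> real"
  assumes mono: "strict_mono_on M H" and cl: "closed (H ` M)"
  shows "continuous_on M H"
  unfolding continuous_on_iff
proof (intro ballI allI impI)
  fix x e :: real assume x: "x \<in> M" and e: "e > 0"
  obtain d1 where d1: "d1 > 0" "\<And>y. y \<in> M \<Longrightarrow> x \<le> y \<Longrightarrow> y < x + d1 \<Longrightarrow> H y < H x + e"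
    using strict_mono_closed_image_right[OF mono cl x e] by blast
  \<comment> \<open>The left side is the right side of the reflected function.\<close>
  have "strict_mono_on (uminus ` M) (\<lambda>y. - H (- y))" using mono by (auto simp: strict_mono_on_def)
  moreover have "closed ((\<lambda>y. - H (- y)) ` uminus ` M)"
    using closed_negations[OF cl] by (simp add: image_image)
  ultimately obtain d2 where d2: "d2 > 0"
    "\<And>y. y \<in> uminus ` M \<Longrightarrow> - x \<le> y \<Longrightarrow> y < - x + d2 \<Longrightarrow> - H (- y) < - H (- (- x)) + e"
    using strict_mono_closed_image_right[of "uminus ` M" "\<lambda>y. - H (- y)" "-x" e] x e by blast
  have "dist (H y) (H x) < e" if y: "y \<in> M" "dist y x < min d1 d2" for y
  proof (cases "x \<le> y")
    case True
    then have "H x \<le> H y" using mono x y(1) by (metis strict_mono_on_leD)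
    then show ?thesis using d1(2)[OF y(1) True] y(2) True by (simp add: dist_real_def)
  next
    case False
    then have "H y \<le> H x" using mono x y(1) by (metis strict_mono_on_leD less_imp_le not_le)
    moreover have "H x - e < H y" using d2(2)[of "-y"] y False by (simp add: dist_real_def)
    ultimately show ?thesis by (simp add: dist_real_def)
  qed
  then show "\<exists>d>0. \<forall>x'\<in>M. dist x' x < d \<longrightarrow> dist (H x') (H x) < e"
    using d1(1) d2(1) by (intro exI[of _ "min d1 d2"]) auto
qed

lemma continuous_map_circle_descend:
  assumes M: "closed M" "\<And>x m. x + of_int m \<in> M \<longleftrightarrow> x \<in> M"
    and H: "continuous_on M H" "H ` M \<subseteq> M'"
    and shift: "\<And>x m. x \<in> M \<Longrightarrow> \<exists>n::int. H (x + of_int m) = H x + of_int n"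
  obtains h where "continuous_map (subtopology circle (circle_proj ` M)) (subtopology circle (circle_proj ` M')) h"
    "\<And>x. x \<in> M \<Longrightarrow> h (circle_proj x) = circle_proj (H x)"
proof -
  have cp: "continuous_map euclideanreal circle circle_proj"
    using quotient_map_circle by (rule quotient_imp_continuous_map)
  have "continuous_map (top_of_set M) circle (circle_proj \<circ> H)"
    using H(1) cp by (intro continuous_map_compose[of _ euclideanreal]) auto
  then have "continuous_map (top_of_set M) (subtopology circle (circle_proj ` M')) (circle_proj \<circ> H)"
    using H(2) by (auto simp: continuous_map_in_subtopology)
  moreover have "(circle_proj \<circ> H) x = (circle_proj \<circ> H) y"
    if xy: "x \<in> topspace (top_of_set M)" "y \<in> topspace (top_of_set M)" "circle_proj x = circle_proj y" for x y
  proof -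
    obtain n :: int where "x = y + of_int n" using circle_proj_eqD[OF xy(3)] by blast
    then show ?thesis using shift[of y n] xy(2) by auto
  qed
  ultimately obtain h where "continuous_map (subtopology circle (circle_proj ` M)) (subtopology circle (circle_proj ` M')) h"
    "\<And>x. x \<in> topspace (top_of_set M) \<Longrightarrow> h (circle_proj x) = (circle_proj \<circ> H) x"
    using quotient_map_lift_exists[OF quotient_map_circle_subset[OF M]] by metis
  then show thesis by (intro that) auto
qed

text \<open>Monotone bijections between closed sets are continuous in both directions, and
  compatibility with integer translations lets both directions descend to the circle. The sign
  \<open>\<sigma>\<close> admits conjugacies that reverse the circle.\<close>

lemma topologically_conjugate_of_lift:
  assumes M: "closed M" "\<And>x m. x + of_int m \<in> M \<longleftrightarrow> x \<in> M"
    and M': "closed M'" "\<And>x m. x + of_int m \<in> M' \<longleftrightarrow> x \<in> M'"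
    and bij: "bij_betw H M M'"
    and mono: "strict_mono_on M H \<or> strict_mono_on M (\<lambda>x. - H x)"
    and shift: "\<And>x m. x \<in> M \<Longrightarrow> H (x + of_int m) = H x + of_int (\<sigma> * m)" and \<sigma>: "\<sigma> \<in> {1, -1}"
    and S: "\<And>x. x \<in> M \<Longrightarrow> f x \<in> M \<and> S (circle_proj x) = circle_proj (f x)"
    and T: "\<And>y. y \<in> M' \<Longrightarrow> T (circle_proj y) = circle_proj (g y)"
    and conj: "\<And>x. x \<in> M \<Longrightarrow> circle_proj (H (f x)) = circle_proj (g (H x))"
  shows "topologically_conjugate (subtopology circle (circle_proj ` M)) S (subtopology circle (circle_proj ` M')) T"
proof -
  define K where "K = inv_into M H"
  have HK: "H (K y) = y" "K y \<in> M" if "y \<in> M'" for y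
    using that bij by (auto simp: K_def bij_betw_def f_inv_into_f inv_into_into)
  have KH: "K (H x) = x" "H x \<in> M'" if "x \<in> M" for x
    using that bij by (auto simp: K_def bij_betw_def)
  have im: "H ` M = M'" "K ` M' = M"
    using bij bij_betw_inv_into[OF bij] by (auto simp: K_def bij_betw_def)
  have Kshift: "K (y + of_int m) = K y + of_int (\<sigma> * m)" if y: "y \<in> M'" for y m
  proof -
    have "\<sigma> * (\<sigma> * m) = m" using \<sigma> by auto
    moreover have "H (K y + of_int (\<sigma> * m)) = H (K y) + of_int (\<sigma> * (\<sigma> * m))"
      by (rule shift[OF HK(2)[OF y]])
    ultimately have "H (K y + of_int (\<sigma> * m)) = y + of_int m" using HK(1)[OF y] by metis
    then show ?thesis using KH(1)[of "K y + of_int (\<sigma> * m)"] HK(2)[OF y] M(2) by metis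
  qed
  have contH: "continuous_on M H" and contK: "continuous_on M' K"
  proof -
    have "continuous_on M H \<and> continuous_on M' K"
      using mono
    proof
      assume m: "strict_mono_on M H"
      have "strict_mono_on M' K"
        unfolding strict_mono_on_def using HK m
        by (metis linorder_less_linear order_less_asym strict_mono_onD)
      then show ?thesis
        using strict_mono_closed_image_continuous[OF m] strict_mono_closed_image_continuous[of M' K] im M(1) M'(1) by simp
    next
      assume m: "strict_mono_on M (\<lambda>x. - H x)"
      have "K y < K x" if "x \<in> M'" "y \<in> M'" "x < y" for x y
      proof (rule ccontr)
        assume "\<not> K y < K x"
        then have "- H (K x) \<le> - H (K y)" using m HK that by (intro strict_mono_on_leD[OF m]) auto
        then show False using HK that by simp
      qed
      then have m': "strict_mono_on M' (\<lambda>x. - K x)" by (simp add: strict_mono_on_def)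
      have "(\<lambda>x. - H x) ` M = uminus ` (H ` M)" "(\<lambda>x. - K x) ` M' = uminus ` (K ` M')"
        by (simp_all only: image_image)
      then have "closed ((\<lambda>x. - H x) ` M)" "closed ((\<lambda>x. - K x) ` M')"
        using closed_negations[OF M(1)] closed_negations[OF M'(1)] by (simp_all only: im)
      then show ?thesis
        using continuous_on_minus[OF strict_mono_closed_image_continuous[OF m]]
          continuous_on_minus[OF strict_mono_closed_image_continuous[OF m']] by simp
    qed
    then show "continuous_on M H" "continuous_on M' K" by auto
  qed
  have subset: "H ` M \<subseteq> M'" "K ` M' \<subseteq> M" using im by simp_all
  have sh: "\<exists>n::int. H (x + of_int m) = H x + of_int n" if "x \<in> M" for x m
    using shift[OF that] by metis
  have sk: "\<exists>n::int. K (y + of_int m) = K y + of_int n" if "y \<in> M'" for y m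
    using Kshift[OF that] by metis
  obtain h where h: "continuous_map (subtopology circle (circle_proj ` M)) (subtopology circle (circle_proj ` M')) h"
    "\<And>x. x \<in> M \<Longrightarrow> h (circle_proj x) = circle_proj (H x)"
    using continuous_map_circle_descend[OF M contH subset(1) sh] by blast
  obtain k where k: "continuous_map (subtopology circle (circle_proj ` M')) (subtopology circle (circle_proj ` M)) k"
    "\<And>y. y \<in> M' \<Longrightarrow> k (circle_proj y) = circle_proj (K y)"
    using continuous_map_circle_descend[OF M' contK subset(2) sk] by blast
  have "homeomorphic_maps (subtopology circle (circle_proj ` M)) (subtopology circle (circle_proj ` M')) h k"
    unfolding homeomorphic_maps_def topspace_circle_subset
  proof (intro conjI ballI h(1) k(1))
    show "k (h c) = c" if "c \<in> circle_proj ` M" for c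
      using that h(2) k(2) KH by force
    show "h (k c) = c" if "c \<in> circle_proj ` M'" for c
      using that h(2) k(2) HK by force
  qed
  then have "homeomorphic_map (subtopology circle (circle_proj ` M)) (subtopology circle (circle_proj ` M')) h"
    by (rule homeomorphic_maps_imp_map)
  moreover have "\<forall>c \<in> topspace (subtopology circle (circle_proj ` M)). h (S c) = T (h c)"
    unfolding topspace_circle_subset
  proof
    fix c assume "c \<in> circle_proj ` M"
    then obtain x where x: "x \<in> M" "c = circle_proj x" by blast
    have "h (S c) = circle_proj (H (f x))" using S[OF x(1)] h(2) x(2) by metis
    also have "\<dots> = T (circle_proj (H x))" using conj[OF x(1)] T[OF KH(2)[OF x(1)]] by simp
    finally show "h (S c) = T (h c)" using h(2)[OF x(1)] x(2) by simp
  qed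
  ultimately show ?thesis unfolding topologically_conjugate_def by blast
qed

subsection \<open>The semiconjugacy onto the rotation\<close>

locale circle_lift = degree_one f for f +
  fixes \<alpha> :: real
  assumes strict: "strict_mono f" and rot: "\<And>x. (\<lambda>n. ((f ^^ n) x - x) / real n) \<longlonglongrightarrow> \<alpha>"
    and irr: "\<alpha> \<notin> \<rat>"
begin

lemma f_inj: "f x = f y \<longleftrightarrow> x = y"
  using strict strict_mono_eq by blast

lemma f_bij: "bij_betw f (topspace euclideanreal) (topspace euclideanreal)"
  using P_surj f_inj by (auto simp: bij_betw_def inj_on_def image_iff) metis

lemma funpow_shift: "(f ^^ n) (x + of_int m) = (f ^^ n) x + of_int m"
  by (induction n) (auto simp: P_add_int)

lemma funpow_mono: "x \<le> y \<Longrightarrow> (f ^^ n) x \<le> (f ^^ n) y"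
  by (induction n) (auto simp: P_le)

lemma funpow_degree_one: "degree_one (f ^^ n)"
proof
  show "mono (f ^^ n)" using funpow_mono by (auto intro: monoI)
  show "continuous_on UNIV (f ^^ n)"
  proof (induction n)
    case (Suc n)
    have "continuous_on UNIV (\<lambda>x. f ((f ^^ n) x))" by (rule continuous_on_compose2[OF P_cont Suc]) simp
    then show ?case by (simp add: o_def)
  qed (simp add: id_def)
  show "(f ^^ n) (x + 1) = (f ^^ n) x + 1" for x using funpow_shift[of n x 1] by simp
qed

text \<open>The map \<open>f ^^ n\<close> moves all points by \<open>c\<close> up to 1, so
  \<open>f ^^ (n * k)\<close> moves 0 by \<open>k * c\<close> up to \<open>k\<close>. Dividing by
  \<open>k\<close> and passing to the limit leaves an error of 1; the other 1 comes from replacing 0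
  by \<open>x\<close>.\<close>

lemma displacement: "\<bar>(f ^^ n) x - x - real n * \<alpha>\<bar> \<le> 2"
proof (cases "n = 0")
  case False
  define c where "c = (f ^^ n) 0"
  have near: "\<bar>(f ^^ n) y - y - c\<bar> \<le> 1" for y
    using degree_one.P_bound[OF funpow_degree_one] by (simp add: c_def)
  have it: "\<bar>(f ^^ (n * k)) 0 - real k * c\<bar> \<le> real k" for k
  proof (induction k)
    case (Suc k)
    have "(f ^^ (n * Suc k)) 0 = (f ^^ n) ((f ^^ (n * k)) 0)" by (simp add: funpow_add)
    then show ?case using Suc near[of "(f ^^ (n * k)) 0"] by (simp add: algebra_simps abs_le_iff)
  qed simp
  have "(\<lambda>k. ((f ^^ (n * Suc k)) 0 - 0) / real (n * Suc k)) \<longlonglongrightarrow> \<alpha>"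
    using LIMSEQ_subseq_LIMSEQ[OF rot[of 0], of "\<lambda>k. n * Suc k"] False by (simp add: o_def strict_mono_def)
  then have lim: "(\<lambda>k. \<bar>real n * (((f ^^ (n * Suc k)) 0 - 0) / real (n * Suc k)) - c\<bar>) \<longlonglongrightarrow> \<bar>real n * \<alpha> - c\<bar>"
    by (intro tendsto_intros)
  have "\<bar>real n * (((f ^^ (n * Suc k)) 0 - 0) / real (n * Suc k)) - c\<bar> \<le> 1" for k
  proof -
    have "real n * (((f ^^ (n * Suc k)) 0 - 0) / real (n * Suc k)) = (f ^^ (n * Suc k)) 0 / real (Suc k)"
      using False by (simp del: of_nat_Suc mult_Suc_right)
    moreover have "(f ^^ (n * Suc k)) 0 / real (Suc k) - c = ((f ^^ (n * Suc k)) 0 - real (Suc k) * c) / real (Suc k)"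
      by (simp add: field_simps del: of_nat_Suc)
    moreover have "\<bar>((f ^^ (n * Suc k)) 0 - real (Suc k) * c) / real (Suc k)\<bar> \<le> 1"
      using it[of "Suc k"] unfolding abs_divide by (simp add: divide_le_eq del: of_nat_Suc)
    ultimately show ?thesis by simp
  qed
  then have "\<bar>real n * \<alpha> - c\<bar> \<le> 1" by (intro LIMSEQ_le_const2[OF lim]) auto
  then show ?thesis using near[of x] by linarith
qed simp

abbreviation it :: "int \<Rightarrow> real \<Rightarrow> real" where
  "it k \<equiv> int_iterate euclideanreal f k"

lemma it_Suc: "it (k + 1) x = f (it k x)"
  using int_iterate_Suc[OF f_bij] by simp

lemma it_f: "it k (f x) = it (k + 1) x"
  using int_iterate_add[OF f_bij, of x k 1] int_iterate_of_nat[of euclideanreal f 1 x] by simp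

lemma it_add_1: "it k (x + 1) = it k x + 1"
  using int_iterate_eqI[of "\<lambda>k. it k x + 1" f euclideanreal k] f_bij by (simp add: it_Suc P_add_1)

lemma it_le_iff: "it k x \<le> it k y \<longleftrightarrow> x \<le> y"
proof (induction k rule: int_induct[of _ 0])
  case (step1 i)
  then show ?case using strict by (simp add: it_Suc strict_mono_less_eq)
next
  case (step2 i)
  have "it i z = f (it (i - 1) z)" for z using it_Suc[of "i - 1"] by simp
  then show ?case using strict step2 by (simp add: strict_mono_less_eq)
qed simp

lemma it_displacement: "\<bar>it k x - x - of_int k * \<alpha>\<bar> \<le> 2"
proof (cases "k \<ge> 0")
  case True
  then show ?thesis using displacement[of "nat k" x] by (simp add: int_iterate_def)
next
  case False
  then have "x = (f ^^ nat (- k)) (it k x)"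
    using int_iterate_add[OF f_bij, of x "- k" k] int_iterate_of_nat[of euclideanreal f "nat (- k)" "it k x"] by simp
  then show ?thesis using displacement[of "nat (- k)" "it k x"] False by (simp add: abs_le_iff)
qed

text \<open>The supremum over all integers, not only the positive ones, makes the equation \<open>semi_f\<close> exact.\<close>

definition semi :: "real \<Rightarrow> real" where
  "semi x = (SUP k. it k x - of_int k * \<alpha>)"

lemma semi_le_iff: "semi x \<le> c \<longleftrightarrow> (\<forall>k. it k x - of_int k * \<alpha> \<le> c)"
proof -
  have "bdd_above (range (\<lambda>k. it k x - of_int k * \<alpha>))"
    using it_displacement[of _ x] by (intro bdd_aboveI[of _ "x + 2"]) (auto simp: abs_le_iff algebra_simps)
  then show ?thesis unfolding semi_def by (subst cSUP_le_iff) auto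
qed

text \<open>The supremum is handled only through its upper bounds, so equations for
  \<open>semi\<close> become reindexings of \<open>semi_le_iff\<close>.\<close>

lemma semi_eqI: "(\<And>c. semi x \<le> c \<longleftrightarrow> y \<le> c) \<Longrightarrow> semi x = y"
  by (meson antisym order_refl)

lemma semi_add_1: "semi (x + 1) = semi x + 1"
proof (rule semi_eqI)
  fix c
  have "semi (x + 1) \<le> c \<longleftrightarrow> (\<forall>k. it k x - of_int k * \<alpha> \<le> c - 1)"
    unfolding semi_le_iff it_add_1 by (simp add: algebra_simps)
  then show "semi (x + 1) \<le> c \<longleftrightarrow> semi x + 1 \<le> c" unfolding semi_le_iff[symmetric] by (simp add: algebra_simps)
qed

lemma semi_f: "semi (f x) = semi x + \<alpha>"
proof (rule semi_eqI)
  fix c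
  have "semi (f x) \<le> c \<longleftrightarrow> (\<forall>k. it (k + 1) x - of_int (k + 1) * \<alpha> \<le> c - \<alpha>)"
    unfolding semi_le_iff it_f by (simp add: algebra_simps)
  also have "\<dots> \<longleftrightarrow> (\<forall>k. it k x - of_int k * \<alpha> \<le> c - \<alpha>)" by (metis diff_add_cancel)
  finally show "semi (f x) \<le> c \<longleftrightarrow> semi x + \<alpha> \<le> c" unfolding semi_le_iff[symmetric] by (simp add: algebra_simps)
qed

lemma semi_mono: "x \<le> y \<Longrightarrow> semi x \<le> semi y"
proof -
  assume "x \<le> y"
  then have "it k x \<le> it k y" for k by (simp add: it_le_iff)
  moreover have "it k y - of_int k * \<alpha> \<le> semi y" for k using semi_le_iff[of y "semi y"] by simp
  ultimately have "it k x - of_int k * \<alpha> \<le> semi y" for k by (meson diff_right_mono order_trans)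
  then show ?thesis by (simp add: semi_le_iff)
qed

lemma semi_dense:
  assumes "a < b"
  obtains y where "a < semi y" "semi y < b"
proof -
  have "a - semi 0 < b - semi 0" using assms by simp
  then obtain i :: nat and m :: int where im: "a - semi 0 < real i * \<alpha> + of_int m" "real i * \<alpha> + of_int m < b - semi 0"
    using int_dense_irrational[OF irr] by metis
  have "semi ((f ^^ i) x) = semi x + real i * \<alpha>" for x
    by (induction i) (simp_all add: semi_f algebra_simps)
  moreover have "semi (x + of_int m) = semi x + of_int m" for x
    using semi_add_1 by (rule add_int_of_add_1)
  ultimately have "semi ((f ^^ i) 0 + of_int m) = semi 0 + real i * \<alpha> + of_int m" by simp
  then show thesis using im by (intro that[of "(f ^^ i) 0 + of_int m"]) auto
qed

text \<open>A monotone function with dense range cannot jump.\<close>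

lemma semi_degree_one: "degree_one semi"
proof
  show "mono semi" using semi_mono by (rule monoI)
  show "continuous_on UNIV semi"
    unfolding continuous_on_iff
  proof (intro ballI allI impI)
    fix x e :: real assume e: "e > 0"
    obtain y z where yz: "semi x < semi y" "semi y < semi x + e" "semi x - e < semi z" "semi z < semi x"
      using semi_dense[of "semi x" "semi x + e"] semi_dense[of "semi x - e" "semi x"] e
      by (metis diff_gt_0_iff_gt diff_less_eq less_add_same_cancel1)
    then have "x < y" "z < x" using semi_mono by (meson not_le)+
    moreover have "dist (semi x') (semi x) < e" if "dist x' x < min (y - x) (x - z)" for x'
    proof -
      have "z \<le> x'" "x' \<le> y" using that by (auto simp: dist_real_def abs_less_iff)
      then have "semi z \<le> semi x'" "semi x' \<le> semi y" using semi_mono by auto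
      then show ?thesis using yz by (simp add: dist_real_def)
    qed
    ultimately show "\<exists>d>0. \<forall>x'\<in>UNIV. dist x' x < d \<longrightarrow> dist (semi x') (semi x) < e"
      by (intro exI[of _ "min (y - x) (x - z)"]) auto
  qed
qed (rule semi_add_1)

end

text \<open>The \<open>P\<close>-values of one orbit and its translates are dense. Orbit points with
  values just below \<open>t\<close> accumulate at \<open>lo P t\<close>, those with values just
  above at \<open>hi P t\<close>.\<close>

lemma (in denjoy_lift) endpoints_subset_closed_invariant:
  assumes cl: "closed E" and x0: "x0 \<in> E" and shift: "\<And>x m. x \<in> E \<Longrightarrow> x + of_int m \<in> E"
    and inv: "\<And>x. x \<in> E \<Longrightarrow> f x \<in> E"
  shows "endpoints P \<subseteq> E"
proof -
  have fi: "(f ^^ i) x0 \<in> E" for i by (induction i) (use x0 inv in auto)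
  have dense: "\<exists>y\<in>E. s < P y \<and> P y < t" if st: "s < t" for s t
  proof -
    have "s - P x0 < t - P x0" using st by simp
    then obtain i :: nat and m :: int where "s - P x0 < real i * \<alpha> + of_int m" "real i * \<alpha> + of_int m < t - P x0"
      using int_dense_irrational[OF irrational] by metis
    then have "s < P ((f ^^ i) x0 + of_int m)" "P ((f ^^ i) x0 + of_int m) < t"
      by (simp_all add: P_add_int P_funpow)
    then show ?thesis using shift[OF fi] by blast
  qed
  have "lo P t \<in> E" for t
  proof (rule closed_approachable[OF cl, THEN iffD1], intro allI impI)
    fix e :: real assume e: "e > 0"
    have "P (lo P t - e) < t" using P_le[of "lo P t - e" "lo P t"] fibre[of "lo P t - e" t] e by force
    then obtain y where y: "y \<in> E" "P (lo P t - e) < P y" "P y < P (lo P t)" using dense by force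
    then have "lo P t - e < y" "y < lo P t" using P_less_imp by blast+
    then show "\<exists>y\<in>E. dist y (lo P t) < e" using y(1) by (intro bexI[of _ y]) (auto simp: dist_real_def)
  qed
  moreover have "hi P t \<in> E" for t
  proof (rule closed_approachable[OF cl, THEN iffD1], intro allI impI)
    fix e :: real assume e: "e > 0"
    have "t < P (hi P t + e)" using P_le[of "hi P t" "hi P t + e"] fibre[of "hi P t + e" t] e by force
    then obtain y where y: "y \<in> E" "P (hi P t) < P y" "P y < P (hi P t + e)" using dense by force
    then have "hi P t < y" "y < hi P t + e" using P_less_imp by blast+
    then show "\<exists>y\<in>E. dist y (hi P t) < e" using y(1) by (intro bexI[of _ y]) (auto simp: dist_real_def)
  qed
  ultimately show ?thesis by (auto simp: endpoints_def)
qed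

text \<open>The increment over a period is a positive integer. If it exceeded 1, some point strictly
  inside the period would have the same image on the circle as \<open>x\<close>.\<close>

lemma increasing_lift_add_1:
  assumes F: "inj_on F (range circle_proj)" and lift: "increasing_lift f F"
  shows "f (x + 1) = f x + 1"
proof -
  have f: "continuous_on UNIV f" "strict_mono f" "\<And>x. F (circle_proj x) = circle_proj (f x)"
    using lift by (auto simp: increasing_lift_def)
  have "circle_proj (x + 1) = circle_proj x" using circle_proj_add_int[of x 1] by simp
  then have "circle_proj (f (x + 1)) = circle_proj (f x)" using f(3) by metis
  then obtain n :: int where n: "f (x + 1) = f x + of_int n" using circle_proj_eqD by blast
  have "f x < f (x + 1)" using f(2) by (simp add: strict_mono_less)
  then have "n \<ge> 1" using n by simp
  moreover have "\<not> n > 1"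
  proof
    assume "n > 1"
    then have "f x + 1 < f (x + 1)" using n by simp
    then obtain y where y: "x \<le> y" "y \<le> x + 1" "f y = f x + 1"
      using IVT'[of f x "f x + 1" "x + 1"] continuous_on_subset[OF f(1)] by auto
    have "circle_proj (f y) = circle_proj (f x)" using circle_proj_add_int[of "f x" 1] y(3) by simp
    then have "circle_proj y = circle_proj x" using F f(3) by (metis inj_onD rangeI)
    then obtain k :: int where k: "y = x + of_int k" using circle_proj_eqD by blast
    have "y \<noteq> x" using y(3) by auto
    moreover have "y \<noteq> x + 1" using y(3) \<open>f x + 1 < f (x + 1)\<close> by auto
    ultimately have "0 < real_of_int k" "real_of_int k < 1" using y(1,2) k by linarith+
    then show False by simp
  qed
  ultimately have "n = 1" by simp
  then show ?thesis using n by simp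
qed

text \<open>Without gaps \<open>semi\<close> would conjugate \<open>F\<close> to the rotation, so
  failure of this conjugacy enters as nonemptiness of the set of gaps.\<close>

lemma denjoy_homeo_lift:
  assumes "denjoy_homeo F"
  obtains f P \<alpha> where "denjoy_lift P f \<alpha>" "\<And>x. F (circle_proj x) = circle_proj (f x)"
proof -
  obtain \<alpha> f where \<alpha>: "\<alpha> \<notin> \<rat>" and hF: "homeomorphic_map circle circle F"
    and lift: "increasing_lift f F" and rot: "\<And>x. (\<lambda>n. ((f ^^ n) x - x) / real n) \<longlonglongrightarrow> \<alpha>"
    and nconj: "\<not> topologically_conjugate circle F circle (circle_rotation \<alpha>)"
    using assms unfolding denjoy_homeo_def orientation_preserving_homeo_def has_rotation_number_def by metis
  have f: "continuous_on UNIV f" "strict_mono f" "\<And>x. F (circle_proj x) = circle_proj (f x)"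
    using lift by (auto simp: increasing_lift_def)
  have "inj_on F (range circle_proj)"
    using hF unfolding homeomorphic_eq_everything_map topspace_circle by blast
  then have f1: "f (x + 1) = f x + 1" for x using lift by (rule increasing_lift_add_1)
  interpret circle_lift f \<alpha>
    using f f1 \<alpha> rot by unfold_locales (auto intro: strict_mono_mono)
  interpret S: degree_one semi by (rule semi_degree_one)
  have gaps: "gaps semi \<noteq> {}"
  proof
    assume "gaps semi = {}"
    then have sm: "strict_mono semi" by (rule S.no_gaps_imp_strict_mono)
    have "topologically_conjugate (subtopology circle (circle_proj ` UNIV)) F (subtopology circle (circle_proj ` UNIV)) (circle_rotation \<alpha>)"
    proof (rule topologically_conjugate_of_lift[where H = semi and f = f and g = "\<lambda>t. t + \<alpha>" and \<sigma> = 1])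
      show "bij_betw semi UNIV UNIV"
        using strict_mono_imp_inj_on[OF sm] S.P_surj by (auto simp: bij_betw_def) (metis rangeI)
      show "strict_mono_on UNIV semi \<or> strict_mono_on UNIV (\<lambda>x. - semi x)" using sm by simp
    qed (auto simp: S.P_add_int f(3) circle_rotation_proj semi_f)
    moreover have "subtopology circle (circle_proj ` UNIV) = circle"
      unfolding topspace_circle[symmetric] by simp
    ultimately show False using nconj by simp
  qed
  obtain N :: nat where N: "real N > - \<alpha>" using reals_Archimedean2 by blast
  have "denjoy_lift semi (\<lambda>x. f x + real N) (\<alpha> + real N)"
  proof unfold_locales
    show "strict_mono (\<lambda>x. f x + real N)" using f(2) by (simp add: strict_mono_def)
    show "continuous_on UNIV (\<lambda>x. f x + real N)" by (intro continuous_on_add f(1) continuous_on_const)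
    show "f (x + 1) + real N = f x + real N + 1" for x by (simp add: f1)
    show "semi (f x + real N) = semi x + (\<alpha> + real N)" for x
      using S.P_add_int[of "f x" "int N"] by (simp add: semi_f)
    show "\<alpha> + real N \<notin> \<rat>" using \<alpha> by (metis Rats_diff Rats_of_nat add_diff_cancel_right')
    show "\<alpha> + real N > 0" using N by simp
  qed (rule gaps)
  moreover have "F (circle_proj x) = circle_proj (f x + real N)" for x
    using f(3) circle_proj_add_int[of "f x" "int N"] by simp
  ultimately show thesis by (rule that)
qed

text \<open>The end points project into \<open>D\<close> because its lift is closed and invariant.
  Their projection is itself closed, invariant and nonempty, so minimality makes it equal to
  \<open>D\<close>.\<close>

lemma denjoy_system_lift:
  assumes "denjoy_system X S"
  obtains f P \<alpha> where "denjoy_lift P f \<alpha>" "X = subtopology circle (circle_proj ` endpoints P)"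
    "\<And>x. x \<in> endpoints P \<Longrightarrow> S (circle_proj x) = circle_proj (f x)"
proof -
  obtain F D where F: "denjoy_homeo F" and D: "minimal_set circle F D"
    and X: "X = subtopology circle D" and S: "\<And>x. x \<in> D \<Longrightarrow> S x = F x"
    using assms unfolding denjoy_system_def by metis
  obtain f P \<alpha> where "denjoy_lift P f \<alpha>" and Ff: "\<And>x. F (circle_proj x) = circle_proj (f x)"
    using denjoy_homeo_lift[OF F] by metis
  then interpret denjoy_lift P f \<alpha> by simp
  let ?E = "{x. circle_proj x \<in> D}"
  have D': "D \<noteq> {}" "D \<subseteq> range circle_proj" "closed ?E" "F ` D = D"
    using D unfolding minimal_set_def closedin_circle_iff by blast+
  obtain x0 where "x0 \<in> ?E" using D'(1,2) by blast
  then have sub: "endpoints P \<subseteq> ?E"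
  proof (rule endpoints_subset_closed_invariant[OF D'(3)])
    show "f x \<in> ?E" if "x \<in> ?E" for x
      using imageI[of "circle_proj x" D F] that D'(4) Ff[of x] by simp
  qed simp
  have minimal: "E = D" if "E \<noteq> {}" "closedin circle E" "F ` E = E" "E \<subseteq> D" for E
    using D that unfolding minimal_set_def by (elim conjE allE[of _ E]) simp
  have "circle_proj ` endpoints P = D"
  proof -
    have "closedin circle (circle_proj ` endpoints P)"
      unfolding closedin_circle_iff saturated_vimage[OF endpoints_add_int] using closed_endpoints by blast
    moreover have "circle_proj ` endpoints P \<noteq> {}" using lo_in by blast
    moreover have "F ` circle_proj ` endpoints P = circle_proj ` endpoints P"
    proof -
      have "F ` circle_proj ` endpoints P = circle_proj ` f ` endpoints P"
        by (simp only: image_image Ff)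
      then show ?thesis by (simp only: f_image_endpoints)
    qed
    moreover have "circle_proj ` endpoints P \<subseteq> D" using sub by (intro image_subsetI) auto
    ultimately show ?thesis by (metis minimal)
  qed
  note eq = this
  show thesis
  proof (rule that[OF \<open>denjoy_lift P f \<alpha>\<close>])
    show "X = subtopology circle (circle_proj ` endpoints P)" unfolding eq by (rule X)
    show "S (circle_proj x) = circle_proj (f x)" if "x \<in> endpoints P" for x
    proof -
      have "circle_proj x \<in> circle_proj ` endpoints P" using that by (rule imageI)
      then have "circle_proj x \<in> D" unfolding eq .
      then show ?thesis by (simp only: S Ff)
    qed
  qed
qed

subsection \<open>Conjugacy from the rotation number and the gaps\<close>

lemma (in degree_one) endpoints_same_fibre:
  "x \<in> endpoints P \<Longrightarrow> y \<in> endpoints P \<Longrightarrow> P x = P y \<Longrightarrow> x < y \<Longrightarrow> x = lo P (P x) \<and> y = hi P (P x)"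
  using lo_le[of x] hi_ge[of y] by (auto simp: endpoints_iff)

text \<open>The affine bijection of \<open>P\<close>-values matches gaps with gaps, so it lifts to
  end points, with left and right exchanged for \<open>\<sigma> = -1\<close>. The lift is monotone,
  and \<open>topologically_conjugate_of_lift\<close> supplies continuity.\<close>

lemma topologically_conjugate_of_similar_gaps:
  fixes \<sigma> k :: int
  assumes "denjoy_lift P f \<alpha>" and "denjoy_lift P' g \<beta>"
    and \<sigma>: "\<sigma> \<in> {1, -1}" and \<beta>: "\<beta> = of_int \<sigma> * \<alpha> + of_int k" and sim: "similar (of_int \<sigma>) (gaps P) (gaps P')"
    and S: "\<And>x. x \<in> endpoints P \<Longrightarrow> S (circle_proj x) = circle_proj (f x)"
    and T: "\<And>y. y \<in> endpoints P' \<Longrightarrow> T (circle_proj y) = circle_proj (g y)"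
  shows "topologically_conjugate (subtopology circle (circle_proj ` endpoints P)) S
    (subtopology circle (circle_proj ` endpoints P')) T"
proof -
  interpret X: denjoy_lift P f \<alpha> by fact
  interpret Y: denjoy_lift P' g \<beta> by fact
  obtain c where c: "gaps P' = (\<lambda>t. of_int \<sigma> * t + c) ` gaps P" using sim by (auto simp: similar_def)
  define \<phi> where "\<phi> t = of_int \<sigma> * t + c" for t :: real
  have \<phi>_inj: "s = t" if "\<phi> s = \<phi> t" for s t using that \<sigma> by (auto simp: \<phi>_def)
  have gap: "\<phi> t \<in> gaps P' \<longleftrightarrow> t \<in> gaps P" for t
    unfolding c \<phi>_def[symmetric] using \<phi>_inj by (auto dest: \<phi>_inj)
  define a b where "a = (if \<sigma> = 1 then lo P' else hi P')" and "b = (if \<sigma> = 1 then hi P' else lo P')"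
  have Pab [simp]: "P' (a s) = s" "P' (b s) = s" for s by (simp_all add: a_def b_def)
  have ab_in [simp]: "a s \<in> endpoints P'" "b s \<in> endpoints P'" for s by (simp_all add: a_def b_def)
  have ab_eq: "a (\<phi> t) = b (\<phi> t)" if "lo P t = hi P t" for t
  proof -
    have "\<phi> t \<notin> gaps P'" unfolding gap using that by (simp add: gaps_def)
    then have "lo P' (\<phi> t) = hi P' (\<phi> t)" using Y.lo_le_hi[of "\<phi> t"] by (simp add: gaps_def)
    then show ?thesis by (simp add: a_def b_def)
  qed
  have ab_add: "a (s + of_int m) = a s + of_int m" "b (s + of_int m) = b s + of_int m" for s m
    by (simp_all add: a_def b_def Y.lo_add_int Y.hi_add_int)
  have ab_g: "a (s + \<beta>) = g (a s)" "b (s + \<beta>) = g (b s)" for s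
    by (simp_all add: a_def b_def Y.lo_f Y.hi_f)
  define H where "H x = (if x = lo P (P x) then a (\<phi> (P x)) else b (\<phi> (P x)))" for x
  have H_lo: "H (lo P t) = a (\<phi> t)" and H_hi: "H (hi P t) = b (\<phi> t)" for t
    using ab_eq[of t] by (simp_all add: H_def)
  have PH: "P' (H x) = \<phi> (P x)" for x by (simp add: H_def)
  have H_in: "H x \<in> endpoints P'" for x by (simp add: H_def)
  have order: "of_int \<sigma> * H x < of_int \<sigma> * H y"
    if xy: "x \<in> endpoints P" "y \<in> endpoints P" "x < y" for x y
  proof (cases "P x = P y")
    case True
    then have e: "x = lo P (P x)" "y = hi P (P x)" using X.endpoints_same_fibre xy by blast+
    then have "P x \<in> gaps P" using xy(3) by (simp add: gaps_def)
    then have "lo P' (\<phi> (P x)) < hi P' (\<phi> (P x))" using gap by (simp add: gaps_def)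
    moreover have "H x = a (\<phi> (P x))" "H y = b (\<phi> (P x))" using e H_lo H_hi by metis+
    ultimately show ?thesis using \<sigma> by (auto simp: a_def b_def)
  next
    case False
    then have lt: "P x < P y" using X.P_le[of x y] xy(3) by simp
    show ?thesis
    proof (cases "\<sigma> = 1")
      case True
      then have "P' (H x) < P' (H y)" using lt by (simp add: PH \<phi>_def)
      then show ?thesis using True Y.P_less_imp by simp
    next
      case False
      then have "P' (H y) < P' (H x)" using lt \<sigma> by (simp add: PH \<phi>_def)
      then show ?thesis using False \<sigma> Y.P_less_imp by simp
    qed
  qed
  show ?thesis
  proof (rule topologically_conjugate_of_lift[where H = H and f = f and g = g and \<sigma> = \<sigma>])
    show "strict_mono_on (endpoints P) H \<or> strict_mono_on (endpoints P) (\<lambda>x. - H x)"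
      using order \<sigma> by (auto simp: strict_mono_on_def)
    show "bij_betw H (endpoints P) (endpoints P')"
      unfolding bij_betw_def
    proof
      show "inj_on H (endpoints P)"
      proof (rule linorder_inj_onI)
        show "H x \<noteq> H y" if "x < y" "x \<in> endpoints P" "y \<in> endpoints P" for x y
          using order[OF that(2,3,1)] by auto
      qed auto
      show "H ` endpoints P = endpoints P'"
      proof
        show "endpoints P' \<subseteq> H ` endpoints P"
        proof
          fix y assume "y \<in> endpoints P'"
          then have y: "y = a (P' y) \<or> y = b (P' y)" by (auto simp: Y.endpoints_iff a_def b_def)
          have "\<phi> (of_int \<sigma> * (P' y - c)) = P' y" using \<sigma> by (auto simp: \<phi>_def)
          then show "y \<in> H ` endpoints P" using y H_lo H_hi X.lo_in X.hi_in by (metis imageI)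
        qed
      qed (use H_in in blast)
    qed
    show "H (x + of_int m) = H x + of_int (\<sigma> * m)" if "x \<in> endpoints P" for x m
    proof -
      have "\<phi> (P x + of_int m) = \<phi> (P x) + of_int (\<sigma> * m)" by (simp add: \<phi>_def algebra_simps)
      then show ?thesis by (simp only: H_def X.P_add_int X.lo_add_int add_right_cancel ab_add if_distrib split: if_split) simp
    qed
    show "circle_proj (H (f x)) = circle_proj (g (H x))" if "x \<in> endpoints P" for x
    proof -
      have "\<phi> (P x + \<alpha>) = \<phi> (P x) + \<beta> + of_int (- k)" by (simp add: \<phi>_def \<beta> algebra_simps)
      then have "a (\<phi> (P x + \<alpha>)) = g (a (\<phi> (P x))) + of_int (- k)" "b (\<phi> (P x + \<alpha>)) = g (b (\<phi> (P x))) + of_int (- k)"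
        by (simp_all only: ab_add ab_g)
      then have "H (f x) = g (H x) + of_int (- k)"
        unfolding H_def X.P_f X.lo_f X.f_eq_iff by simp
      then show ?thesis using circle_proj_add_int by metis
    qed
  qed (use \<sigma> S T X.closed_endpoints Y.closed_endpoints in auto)
qed

subsection \<open>Suspensions\<close>

lemma suspension_proj_eq_iff:
  assumes S: "bij_betw S (topspace X) (topspace X)" and x: "x \<in> topspace X"
  shows "suspension_proj X S (x, s) = suspension_proj X S (y, t) \<longleftrightarrow>
    (\<exists>n::int. y = int_iterate X S n x \<and> t = s - of_int n)" (is "?L \<longleftrightarrow> ?R")
proof
  assume ?L
  moreover have "(y, t) \<in> suspension_proj X S (y, t)"
    unfolding suspension_proj_def prod.case by (intro CollectI exI[of _ 0]) simp
  ultimately have "(y, t) \<in> suspension_proj X S (x, s)" by simp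
  then show ?R by (auto simp: suspension_proj_def)
next
  assume ?R
  then obtain n :: int where n: "y = int_iterate X S n x" "t = s - of_int n" by blast
  define F where "F k = (int_iterate X S k x, s - of_int k)" for k
  have "(int_iterate X S k y, t - of_int k) = F (k + n)" for k
    using int_iterate_add[OF S x, of k n] n by (simp add: F_def)
  then have "suspension_proj X S (y, t) = {F (k + n) | k. True}"
    by (simp add: suspension_proj_def)
  also have "\<dots> = F ` range (\<lambda>k. k + n)" by blast
  also have "range (\<lambda>k. k + n) = UNIV" by (rule surjI[of _ "\<lambda>k. k - n"]) simp
  also have "range F = suspension_proj X S (x, s)"
    by (simp add: suspension_proj_def F_def full_SetCompr_eq)
  finally show ?L by simp
qed

lemma suspension_proj_map:
  assumes S: "bij_betw S (topspace X) (topspace X)" and x: "x \<in> topspace X"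
  shows "suspension_proj X S (S x, s) = suspension_proj X S (x, s + 1)"
proof -
  have "suspension_proj X S (x, s + 1) = suspension_proj X S (S x, s)"
    unfolding suspension_proj_eq_iff[OF S x] by (rule exI[of _ 1]) (simp add: int_iterate_def)
  then show ?thesis by simp
qed

lemma quotient_map_suspension:
  "quotient_map (prod_topology X euclideanreal) (suspension X S) (suspension_proj X S)"
  unfolding suspension_def by (rule quotient_map_quotient_topology)

lemma topspace_suspension: "topspace (suspension X S) = {suspension_proj X S (x, s) | x s. x \<in> topspace X}"
  unfolding suspension_def topspace_quotient_topology by auto

lemma suspension_proj_in: "x \<in> topspace X \<Longrightarrow> suspension_proj X S (x, s) \<in> topspace (suspension X S)"
  unfolding topspace_suspension by blast

lemma suspension_flow_in:
  assumes "c \<in> topspace (suspension X S)"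
  shows "suspension_flow t c \<in> topspace (suspension X S)"
proof -
  obtain x s where "c = suspension_proj X S (x, s)" "x \<in> topspace X"
    using assms unfolding topspace_suspension by blast
  then show ?thesis by (simp add: suspension_flow_proj suspension_proj_in)
qed

lemma suspension_lift:
  assumes S: "bij_betw S (topspace X) (topspace X)"
    and cont: "continuous_map (prod_topology X euclideanreal) Z g"
    and inv: "\<And>x s n. x \<in> topspace X \<Longrightarrow> g (int_iterate X S n x, s - of_int n) = g (x, s)"
  obtains h where "continuous_map (suspension X S) Z h"
    "\<And>x s. x \<in> topspace X \<Longrightarrow> h (suspension_proj X S (x, s)) = g (x, s)"
proof -
  have "g p = g p'"
    if in_prod: "p \<in> topspace (prod_topology X euclideanreal)"
      and eq: "suspension_proj X S p = suspension_proj X S p'" for p p'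
  proof -
    obtain x s y t where p: "p = (x, s)" "p' = (y, t)" by (metis surj_pair)
    have x: "x \<in> topspace X" using in_prod p by simp
    obtain n :: int where "y = int_iterate X S n x" "t = s - of_int n"
      using eq unfolding p suspension_proj_eq_iff[OF S x] by blast
    then show ?thesis using inv[OF x, of n s] p by simp
  qed
  then obtain h where h: "continuous_map (suspension X S) Z h"
    "\<And>p. p \<in> topspace (prod_topology X euclideanreal) \<Longrightarrow> h (suspension_proj X S p) = g p"
    using quotient_map_lift_exists[OF quotient_map_suspension cont, of S] by metis
  then show thesis by (intro that[OF h(1)]) auto
qed

lemma conjugate_suspension_map:
  assumes S: "bij_betw S (topspace X) (topspace X)" and T: "bij_betw T (topspace Y) (topspace Y)"
    and h: "continuous_map X Y h" and conj: "\<And>x. x \<in> topspace X \<Longrightarrow> h (S x) = T (h x)"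
  obtains H where "continuous_map (suspension X S) (suspension Y T) H"
    "\<And>x s. x \<in> topspace X \<Longrightarrow> H (suspension_proj X S (x, s)) = suspension_proj Y T (h x, s)"
proof -
  have hY: "h x \<in> topspace Y" if "x \<in> topspace X" for x
    using h that by (auto simp: continuous_map_def Pi_iff)
  have iter: "h (int_iterate X S n x) = int_iterate Y T n (h x)" if x: "x \<in> topspace X" for n x
  proof -
    have "int_iterate Y T n (h (int_iterate X S 0 x)) = h (int_iterate X S n x)"
    proof (rule int_iterate_eqI[OF _ _ T])
      show "h (int_iterate X S (k + 1) x) = T (h (int_iterate X S k x))" for k
        using int_iterate_Suc[OF S x] conj[OF int_iterate_in[OF S x]] by simp
    qed (rule hY[OF int_iterate_in[OF S x]])
    then show ?thesis by simp
  qed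
  have prod: "continuous_map (prod_topology X euclideanreal) (prod_topology Y euclideanreal) (\<lambda>p. (h (fst p), snd p))"
    using continuous_map_compose[OF continuous_map_fst h, of euclideanreal]
    by (intro continuous_map_pairedI continuous_map_snd) (simp add: o_def)
  have cont: "continuous_map (prod_topology X euclideanreal) (suspension Y T) (suspension_proj Y T \<circ> (\<lambda>p. (h (fst p), snd p)))"
    by (rule continuous_map_compose[OF prod quotient_imp_continuous_map[OF quotient_map_suspension]])
  have inv: "(suspension_proj Y T \<circ> (\<lambda>p. (h (fst p), snd p))) (int_iterate X S n x, s - of_int n)
      = (suspension_proj Y T \<circ> (\<lambda>p. (h (fst p), snd p))) (x, s)" if x: "x \<in> topspace X" for x s n
  proof -
    have "suspension_proj Y T (h x, s) = suspension_proj Y T (int_iterate Y T n (h x), s - of_int n)"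
      unfolding suspension_proj_eq_iff[OF T hY[OF x]] by blast
    then show ?thesis by (simp add: iter[OF x])
  qed
  obtain H where "continuous_map (suspension X S) (suspension Y T) H"
    "\<And>x s. x \<in> topspace X \<Longrightarrow> H (suspension_proj X S (x, s)) = (suspension_proj Y T \<circ> (\<lambda>p. (h (fst p), snd p))) (x, s)"
    using suspension_lift[OF S cont inv] by blast
  then show thesis by (intro that[of H]) auto
qed

lemma flow_equivalent_of_conjugate:
  assumes S: "bij_betw S (topspace X) (topspace X)" and T: "bij_betw T (topspace Y) (topspace Y)"
    and "topologically_conjugate X S Y T"
  shows "flow_equivalent X S Y T"
proof -
  obtain h where h: "homeomorphic_map X Y h" "\<And>x. x \<in> topspace X \<Longrightarrow> h (S x) = T (h x)"
    using assms(3) by (auto simp: topologically_conjugate_def)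
  obtain k where k: "homeomorphic_maps X Y h k" using h(1) homeomorphic_map_maps by blast
  then have ch: "continuous_map X Y h" and ck: "continuous_map Y X k"
    and kh: "\<And>x. x \<in> topspace X \<Longrightarrow> k (h x) = x" and hk: "\<And>y. y \<in> topspace Y \<Longrightarrow> h (k y) = y"
    by (auto simp: homeomorphic_maps_def)
  have hY: "h x \<in> topspace Y" if "x \<in> topspace X" for x using ch that by (auto simp: continuous_map_def Pi_iff)
  have kX: "k y \<in> topspace X" if "y \<in> topspace Y" for y using ck that by (auto simp: continuous_map_def Pi_iff)
  have kconj: "k (T y) = S (k y)" if y: "y \<in> topspace Y" for y
    using h(2)[OF kX[OF y]] kh[of "S (k y)"] hk[OF y] bij_betwE[OF S] kX[OF y] by metis
  obtain H where H: "continuous_map (suspension X S) (suspension Y T) H"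
    "\<And>x s. x \<in> topspace X \<Longrightarrow> H (suspension_proj X S (x, s)) = suspension_proj Y T (h x, s)"
    using conjugate_suspension_map[OF S T ch h(2)] by metis
  obtain K where K: "continuous_map (suspension Y T) (suspension X S) K"
    "\<And>y s. y \<in> topspace Y \<Longrightarrow> K (suspension_proj Y T (y, s)) = suspension_proj X S (k y, s)"
    using conjugate_suspension_map[OF T S ck kconj] by metis
  have "homeomorphic_maps (suspension X S) (suspension Y T) H K"
    unfolding homeomorphic_maps_def
  proof (intro conjI ballI H(1) K(1))
    fix c assume "c \<in> topspace (suspension X S)"
    then obtain x s where "c = suspension_proj X S (x, s)" "x \<in> topspace X"
      unfolding topspace_suspension by blast
    then show "K (H c) = c" using H(2) K(2) hY kh by simp
  next
    fix c assume "c \<in> topspace (suspension Y T)"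
    then obtain y s where "c = suspension_proj Y T (y, s)" "y \<in> topspace Y"
      unfolding topspace_suspension by blast
    then show "H (K c) = c" using H(2) K(2) kX hk by simp
  qed
  then have "homeomorphic_map (suspension X S) (suspension Y T) H" by (rule homeomorphic_maps_imp_map)
  moreover have flow: "H (suspension_flow t c) = suspension_flow t (H c)"
    if "c \<in> topspace (suspension X S)" for c t
  proof -
    obtain x s where "c = suspension_proj X S (x, s)" "x \<in> topspace X"
      using \<open>c \<in> topspace (suspension X S)\<close> unfolding topspace_suspension by blast
    then show ?thesis by (simp add: suspension_flow_proj H(2))
  qed
  moreover have "H ` flow_orbit c = flow_orbit (H c)" if "c \<in> topspace (suspension X S)" for c
    unfolding flow_orbit_def image_image by (simp only: flow[OF that])
  moreover have "continuous_on UNIV (\<lambda>t::real. t)" "strict_mono (\<lambda>t::real. t)"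
    by (auto intro: continuous_on_id simp: strict_mono_def)
  ultimately show ?thesis unfolding flow_equivalent_def by blast
qed

lemma topologically_conjugate_funpow:
  assumes S: "bij_betw S (topspace X) (topspace X)" and "topologically_conjugate X S Y T"
  shows "topologically_conjugate X (S ^^ n) Y (T ^^ n)"
proof -
  obtain h where h: "homeomorphic_map X Y h" "\<And>x. x \<in> topspace X \<Longrightarrow> h (S x) = T (h x)"
    using assms(2) by (auto simp: topologically_conjugate_def)
  have "(S ^^ n) x \<in> topspace X \<and> h ((S ^^ n) x) = (T ^^ n) (h x)" if "x \<in> topspace X" for x
    by (induction n) (use that h(2) bij_betwE[OF S] in auto)
  then show ?thesis unfolding topologically_conjugate_def using h(1) by blast
qed

text \<open>The witness of a flow equivalence gets a name so that it can be inverted and its effect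
  on gaps traced.\<close>

definition orbit_homeo :: "'a topology \<Rightarrow> ('a \<Rightarrow> 'a) \<Rightarrow> 'b topology \<Rightarrow> ('b \<Rightarrow> 'b) \<Rightarrow>
    (('a \<times> real) set \<Rightarrow> ('b \<times> real) set) \<Rightarrow> bool" where
  "orbit_homeo X S Y T h \<longleftrightarrow> homeomorphic_map (suspension X S) (suspension Y T) h \<and>
    (\<forall>c \<in> topspace (suspension X S). h ` flow_orbit c = flow_orbit (h c) \<and>
       (\<exists>\<tau> :: real \<Rightarrow> real. continuous_on UNIV \<tau> \<and> strict_mono \<tau> \<and>
          (\<forall>t. h (suspension_flow t c) = suspension_flow (\<tau> t) (h c))))"

lemma flow_equivalent_iff: "flow_equivalent X S Y T \<longleftrightarrow> (\<exists>h. orbit_homeo X S Y T h)"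
  unfolding flow_equivalent_def orbit_homeo_def ..

text \<open>Orbits are mapped onto orbits and flow times in the target are unique, so each
  \<open>\<tau>\<close> is onto. Its inverse is increasing with full range and therefore
  continuous.\<close>

lemma orbit_homeo_inverse:
  assumes h: "orbit_homeo X S Y T h"
    and aperiodic: "\<And>c a b. c \<in> topspace (suspension Y T) \<Longrightarrow> suspension_flow a c = suspension_flow b c \<Longrightarrow> a = b"
  obtains k where "orbit_homeo Y T X S k" "\<And>c. c \<in> topspace (suspension X S) \<Longrightarrow> k (h c) = c"
proof -
  obtain k where hk: "homeomorphic_maps (suspension X S) (suspension Y T) h k"
    using h unfolding orbit_homeo_def homeomorphic_map_maps by blast
  then have kh: "\<And>c. c \<in> topspace (suspension X S) \<Longrightarrow> k (h c) = c"
    and hk': "\<And>c. c \<in> topspace (suspension Y T) \<Longrightarrow> h (k c) = c"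
    and k_in: "\<And>c. c \<in> topspace (suspension Y T) \<Longrightarrow> k c \<in> topspace (suspension X S)"
    by (auto simp: homeomorphic_maps_def continuous_map_def Pi_iff)
  have "k ` flow_orbit c' = flow_orbit (k c') \<and>
       (\<exists>\<tau> :: real \<Rightarrow> real. continuous_on UNIV \<tau> \<and> strict_mono \<tau> \<and>
          (\<forall>t. k (suspension_flow t c') = suspension_flow (\<tau> t) (k c')))"
    if c': "c' \<in> topspace (suspension Y T)" for c'
  proof -
    define c where "c = k c'"
    have c: "c \<in> topspace (suspension X S)" "h c = c'" using k_in[OF c'] hk'[OF c'] by (simp_all add: c_def)
    obtain \<tau> :: "real \<Rightarrow> real" where orb: "h ` flow_orbit c = flow_orbit c'"
      and \<tau>: "strict_mono \<tau>" "\<And>t. h (suspension_flow t c) = suspension_flow (\<tau> t) c'"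
      using h c unfolding orbit_homeo_def by metis
    have "\<exists>t. \<tau> t = b" for b
    proof -
      have "suspension_flow b c' \<in> h ` flow_orbit c" unfolding orb by (auto simp: flow_orbit_def)
      then obtain t where "suspension_flow b c' = h (suspension_flow t c)" by (auto simp: flow_orbit_def)
      then show ?thesis using aperiodic[OF c'] \<tau>(2) by metis
    qed
    then have "surj \<tau>" by (metis surj_def)
    define \<tau>' where "\<tau>' = inv \<tau>"
    have inv: "\<tau> (\<tau>' t) = t" "\<tau>' (\<tau> t) = t" for t
      using \<open>surj \<tau>\<close> strict_mono_imp_inj_on[OF \<tau>(1)] by (simp_all add: \<tau>'_def surj_f_inv_f)
    have mono': "strict_mono \<tau>'"
    proof (rule strict_monoI)
      show "\<tau>' s < \<tau>' t" if "s < t" for s t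
        using that strict_mono_less[OF \<tau>(1), of "\<tau>' s" "\<tau>' t"] by (simp add: inv)
    qed
    have "range \<tau>' = UNIV" using inv(2) by (metis surj_def)
    then have cont': "continuous_on UNIV \<tau>'"
      using strict_mono_closed_image_continuous[of UNIV \<tau>'] mono' by simp
    have flow: "k (suspension_flow t c') = suspension_flow (\<tau>' t) c" for t
      using \<tau>(2)[of "\<tau>' t"] kh[OF suspension_flow_in[OF c(1)], of "\<tau>' t"] by (simp add: inv)
    moreover have "k ` flow_orbit c' = flow_orbit c"
    proof -
      have "k ` h ` flow_orbit c = (\<lambda>c. c) ` flow_orbit c"
        unfolding image_image
        by (rule image_cong[OF refl]) (use kh suspension_flow_in[OF c(1)] in \<open>auto simp: flow_orbit_def\<close>)
      then show ?thesis using orb by simp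
    qed
    ultimately show ?thesis using mono' cont' unfolding c_def by blast
  qed
  moreover have "homeomorphic_map (suspension Y T) (suspension X S) k"
    using hk homeomorphic_maps_sym homeomorphic_maps_imp_map by blast
  ultimately have "orbit_homeo Y T X S k" unfolding orbit_homeo_def by blast
  then show thesis using kh that by blast
qed

subsection \<open>Flow equivalences of Denjoy systems\<close>

locale denjoy_model = denjoy_lift P f \<alpha> for P f \<alpha> +
  fixes X :: "real set topology" and S :: "real set \<Rightarrow> real set"
  assumes X_eq: "X = subtopology circle (circle_proj ` endpoints P)"
    and S_eq: "x \<in> endpoints P \<Longrightarrow> S (circle_proj x) = circle_proj (f x)"
begin

lemma topspace_X: "topspace X = circle_proj ` endpoints P"
  unfolding X_eq by (rule topspace_circle_subset)

lemma circle_proj_in [simp]: "x \<in> endpoints P \<Longrightarrow> circle_proj x \<in> topspace X"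
  by (simp add: topspace_X)

lemma S_bij: "bij_betw S (topspace X) (topspace X)"
  unfolding bij_betw_def
proof
  show "inj_on S (topspace X)"
  proof (rule inj_onI)
    fix c c' assume "c \<in> topspace X" "c' \<in> topspace X" and eq: "S c = S c'"
    then obtain x y where xy: "x \<in> endpoints P" "c = circle_proj x" "y \<in> endpoints P" "c' = circle_proj y"
      by (auto simp: topspace_X)
    then obtain n :: int where "f x = f y + of_int n" using eq S_eq circle_proj_eqD by metis
    then have "f x = f (y + of_int n)" by (simp only: f.P_add_int)
    then show "c = c'" using xy circle_proj_add_int by simp
  qed
  show "S ` topspace X = topspace X"
  proof -
    have "S ` topspace X = circle_proj ` f ` endpoints P"
      unfolding topspace_X image_image by (rule image_cong[OF refl]) (rule S_eq)
    then show ?thesis by (simp only: topspace_X f_image_endpoints)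
  qed
qed

lemma power_model: "n > 0 \<Longrightarrow> denjoy_model P (f ^^ n) (real n * \<alpha>) X (S ^^ n)"
proof -
  assume "n > 0"
  then interpret p: denjoy_lift P "f ^^ n" "real n * \<alpha>" by (rule power)
  have "(S ^^ i) (circle_proj x) = circle_proj ((f ^^ i) x)" if "x \<in> endpoints P" for x i
    by (induction i) (use that S_eq in auto)
  then show ?thesis by unfold_locales (simp_all add: X_eq)
qed

abbreviation it :: "int \<Rightarrow> real \<Rightarrow> real" where
  "it n \<equiv> int_iterate euclideanreal f n"

lemma f_bij_euclidean: "bij_betw f (topspace euclideanreal) (topspace euclideanreal)"
  using bij_f by simp

lemma it_Suc: "it (n + 1) x = f (it n x)"
  using int_iterate_Suc[OF f_bij_euclidean] by simp

lemma it_Suc': "it n x = f (it (n - 1) x)"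
  using it_Suc[of "n - 1" x] by simp

lemma it_in [simp]: "it n x \<in> endpoints P \<longleftrightarrow> x \<in> endpoints P"
proof (induction n rule: int_induct[of _ 0])
  case (step1 i)
  then show ?case by (simp add: it_Suc)
next
  case (step2 i)
  then show ?case using it_Suc'[of i x] by simp
qed simp

lemma P_it: "P (it n x) = P x + of_int n * \<alpha>"
proof (induction n rule: int_induct[of _ 0])
  case (step1 i)
  then show ?case unfolding it_Suc P_f by (simp add: algebra_simps)
next
  case (step2 i)
  then show ?case using it_Suc'[of i x] by (simp add: P_f algebra_simps)
qed simp

lemma S_it: "x \<in> endpoints P \<Longrightarrow> int_iterate X S n (circle_proj x) = circle_proj (it n x)"
  using int_iterate_eqI[of "\<lambda>n. circle_proj (it n x)" S X n] S_bij by (simp add: it_Suc S_eq)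

text \<open>Many-to-one coordinates on the suspension by end points in the line;
  \<open>pt_add_1\<close> and \<open>pt_f\<close> generate the identifications.\<close>

definition pt :: "real \<Rightarrow> real \<Rightarrow> (real set \<times> real) set" where
  "pt x t = suspension_proj X S (circle_proj x, t)"

lemma pt_in: "x \<in> endpoints P \<Longrightarrow> pt x t \<in> topspace (suspension X S)"
  unfolding pt_def by (rule suspension_proj_in) simp

lemma ptE:
  assumes "c \<in> topspace (suspension X S)"
  obtains x t where "x \<in> endpoints P" "c = pt x t"
  using assms unfolding topspace_suspension topspace_X pt_def by blast

lemma flow_pt [simp]: "suspension_flow t (pt x s) = pt x (s + t)"
  by (simp add: pt_def suspension_flow_proj)

lemma pt_add_1: "pt (x + 1) t = pt x t"
  using circle_proj_add_int[of x 1] by (simp add: pt_def)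

lemma pt_f: "x \<in> endpoints P \<Longrightarrow> pt (f x) t = pt x (t + 1)"
  unfolding pt_def using suspension_proj_map[OF S_bij, of "circle_proj x" t] S_eq[of x] by simp

lemma pt_eqD:
  assumes "x \<in> endpoints P" "y \<in> endpoints P" "pt x s = pt y t"
  obtains n m :: int where "y = it n x + of_int m" "t = s - of_int n"
proof -
  obtain n :: int where n: "circle_proj y = int_iterate X S n (circle_proj x)" "t = s - of_int n"
    using assms(3) unfolding pt_def suspension_proj_eq_iff[OF S_bij circle_proj_in[OF assms(1)]] by blast
  then have "circle_proj y = circle_proj (it n x)" using S_it[OF assms(1)] by simp
  then show thesis using circle_proj_eqD n(2) that by blast
qed

lemma pt_it: "x \<in> endpoints P \<Longrightarrow> pt (it n x + of_int m) t = pt x (t + of_int n)"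
proof -
  assume x: "x \<in> endpoints P"
  have "suspension_proj X S (circle_proj x, t + of_int n) = suspension_proj X S (circle_proj (it n x), t)"
    unfolding suspension_proj_eq_iff[OF S_bij circle_proj_in[OF x]] S_it[OF x] by (rule exI[of _ n]) simp
  then show ?thesis by (simp add: pt_def)
qed

text \<open>A return of an orbit to itself would show in \<open>P\<close> as an integer relation
  between 1 and \<open>\<alpha>\<close>.\<close>

lemma aperiodic:
  assumes "c \<in> topspace (suspension X S)" "suspension_flow a c = suspension_flow b c"
  shows "a = b"
proof -
  obtain x t where x: "x \<in> endpoints P" "c = pt x t" using assms(1) by (rule ptE)
  then have "pt x (t + a) = pt x (t + b)" using assms(2) by simp
  then obtain n m :: int where nm: "x = it n x + of_int m" "t + b = t + a - of_int n"
    by (rule pt_eqD[OF x(1) x(1)])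
  have "P x = P x + of_int n * \<alpha> + of_int m" using arg_cong[OF nm(1), of P] by (simp only: P_add_int P_it)
  then have "of_int m + of_int n * \<alpha> = of_int 0 + of_int 0 * \<alpha>" by simp
  then have "n = 0" using irrational_comb_eq[OF irrational] by blast
  then show ?thesis using nm(2) by simp
qed

lemma continuous_map_pt:
  "continuous_map (top_of_set (endpoints P \<times> UNIV)) (suspension X S) (\<lambda>(x, t). pt x t)"
proof -
  have "continuous_map (top_of_set (endpoints P)) X circle_proj"
    unfolding X_eq by (rule quotient_imp_continuous_map[OF quotient_map_circle_subset[OF closed_endpoints endpoints_add_int]])
  from continuous_map_compose[OF continuous_map_fst this, of euclideanreal]
  have "continuous_map (prod_topology (top_of_set (endpoints P)) euclideanreal) (prod_topology X euclideanreal) (\<lambda>p. (circle_proj (fst p), snd p))"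
    by (intro continuous_map_pairedI continuous_map_snd) (simp add: o_def)
  from continuous_map_compose[OF this quotient_imp_continuous_map[OF quotient_map_suspension]]
  have "continuous_map (prod_topology (top_of_set (endpoints P)) euclideanreal) (suspension X S) (\<lambda>(x, t). pt x t)"
    by (simp add: o_def pt_def case_prod_unfold)
  moreover have "prod_topology (top_of_set (endpoints P)) euclideanreal = top_of_set (endpoints P \<times> UNIV)"
    using prod_topology_subtopology_eu[of "endpoints P" UNIV] by simp
  ultimately show ?thesis by simp
qed

lemma height_function:
  obtains v where "continuous_map (suspension X S) euclidean v"
    "\<And>x t. x \<in> endpoints P \<Longrightarrow> v (pt x t) = ee t"
proof -
  have "continuous_map (prod_topology X euclideanreal) euclidean (ee \<circ> snd)"
    by (rule continuous_map_compose[OF continuous_map_snd]) (simp add: continuous_on_ee continuous_on_id)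
  moreover have "(ee \<circ> snd) (int_iterate X S n x, s - of_int n) = (ee \<circ> snd) (x, s)" for x s n
    by (simp add: ee_diff)
  ultimately obtain v where "continuous_map (suspension X S) euclidean v"
    "\<And>x s. x \<in> topspace X \<Longrightarrow> v (suspension_proj X S (x, s)) = (ee \<circ> snd) (x, s)"
    using suspension_lift[OF S_bij] by metis
  then show thesis by (intro that[of v]) (simp_all add: pt_def)
qed

text \<open>On the suspension the angle of the base point has to advance at rate \<open>\<alpha>\<close> along the flow.\<close>

lemma angle_function:
  obtains z where "continuous_map (suspension X S) euclidean z"
    "\<And>x t. x \<in> endpoints P \<Longrightarrow> z (pt x t) = ee (P x + \<alpha> * t)"
proof -
  have contP: "continuous_on (endpoints P) (\<lambda>x. ee (P x))"
    by (intro continuous_on_ee continuous_on_subset[OF P_cont]) simp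
  then have contP': "continuous_map (top_of_set (endpoints P)) euclidean (\<lambda>x. ee (P x))" by simp
  have well: "ee (P x) = ee (P y)"
    if "x \<in> topspace (top_of_set (endpoints P))" "y \<in> topspace (top_of_set (endpoints P))"
      and eq: "circle_proj x = circle_proj y" for x y
  proof -
    obtain n :: int where "x = y + of_int n" using circle_proj_eqD[OF eq] by blast
    then show ?thesis by (simp add: P_add_int)
  qed
  obtain e where "continuous_map (subtopology circle (circle_proj ` endpoints P)) euclidean e"
    and "e ` topspace (subtopology circle (circle_proj ` endpoints P)) = (\<lambda>x. ee (P x)) ` topspace (top_of_set (endpoints P))"
    and "\<And>x. x \<in> topspace (top_of_set (endpoints P)) \<Longrightarrow> e (circle_proj x) = ee (P x)"
  proof (rule quotient_map_lift_exists[OF quotient_map_circle_subset[OF closed_endpoints endpoints_add_int] contP'])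
    show "ee (P x) = ee (P y)"
      if "x \<in> topspace (top_of_set (endpoints P))" "y \<in> topspace (top_of_set (endpoints P))"
        "circle_proj x = circle_proj y" for x y
      using that by (rule well)
  next
    fix g
    assume "continuous_map (subtopology circle (circle_proj ` endpoints P)) euclidean g"
      "g ` topspace (subtopology circle (circle_proj ` endpoints P)) = (\<lambda>x. ee (P x)) ` topspace (top_of_set (endpoints P))"
      "\<And>x. x \<in> topspace (top_of_set (endpoints P)) \<Longrightarrow> g (circle_proj x) = ee (P x)"
    then show thesis by (rule that)
  qed
  then have e: "continuous_map X euclidean e" "\<And>x. x \<in> endpoints P \<Longrightarrow> e (circle_proj x) = ee (P x)"
    by (simp_all only: X_eq topspace_euclidean_subtopology)
  define g where "g p = e (fst p) * ee (\<alpha> * snd p)" for p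
  have "continuous_map (prod_topology X euclideanreal) euclidean ((\<lambda>(a, b). a * b) \<circ> (\<lambda>p. (e (fst p), ee (\<alpha> * snd p))))"
  proof (rule continuous_map_compose)
    have "continuous_map (prod_topology X euclideanreal) euclidean (e \<circ> fst)"
      by (rule continuous_map_compose[OF continuous_map_fst e(1)])
    moreover have "continuous_on UNIV (\<lambda>t. ee (\<alpha> * t))"
      by (intro continuous_on_ee continuous_on_mult continuous_on_const continuous_on_id)
    then have "continuous_map (prod_topology X euclideanreal) euclidean ((\<lambda>t. ee (\<alpha> * t)) \<circ> snd)"
      by (intro continuous_map_compose[OF continuous_map_snd]) simp
    ultimately show "continuous_map (prod_topology X euclideanreal) (prod_topology euclidean euclidean) (\<lambda>p. (e (fst p), ee (\<alpha> * snd p)))"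
      by (intro continuous_map_pairedI) (simp_all only: o_def)
    have "continuous_on UNIV (\<lambda>(a :: complex, b). a * b)"
      unfolding case_prod_unfold by (intro continuous_on_mult continuous_on_fst continuous_on_snd continuous_on_id)
    then show "continuous_map (prod_topology euclidean euclidean) euclidean (\<lambda>(a :: complex, b). a * b)"
      by simp
  qed
  then have cont: "continuous_map (prod_topology X euclideanreal) euclidean g"
    unfolding g_def[abs_def] by (simp add: o_def)
  have inv: "g (int_iterate X S n c, s - of_int n) = g (c, s)" if c: "c \<in> topspace X" for c s n
  proof -
    obtain x where x: "x \<in> endpoints P" "c = circle_proj x" using c by (auto simp: topspace_X)
    have "e (int_iterate X S n c) = ee (P x + of_int n * \<alpha>)" using e(2)[of "it n x"] x by (simp add: S_it P_it)
    then have "g (int_iterate X S n c, s - of_int n) = ee (P x + of_int n * \<alpha> + \<alpha> * (s - of_int n))"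
      by (simp only: g_def fst_conv snd_conv ee_add)
    also have "P x + of_int n * \<alpha> + \<alpha> * (s - of_int n) = P x + \<alpha> * s" by (simp add: algebra_simps)
    finally show ?thesis using e(2)[OF x(1)] x(2) by (simp add: g_def ee_add)
  qed
  obtain z where z: "continuous_map (suspension X S) euclidean z"
    "\<And>c s. c \<in> topspace X \<Longrightarrow> z (suspension_proj X S (c, s)) = g (c, s)"
    using suspension_lift[OF S_bij cont inv] by blast
  have "z (pt x t) = ee (P x + \<alpha> * t)" if "x \<in> endpoints P" for x t
    using z(2)[of "circle_proj x" t] that e(2)[OF that] by (simp add: pt_def g_def ee_add)
  then show thesis using z(1) that by blast
qed

end

text \<open>Height and angle of the target, pulled back along \<open>h\<close>, form a
  \<open>flow_lift\<close>: along each orbit they change together at rates 1 and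
  \<open>\<beta>\<close>, whatever its time change is.\<close>

theorem orbit_homeo_affine:
  assumes "denjoy_model P f \<alpha> X S" and "denjoy_model P' g \<beta> Y T" and h: "orbit_homeo X S Y T h"
  obtains l c :: real and p q r d :: int
  where "l = of_int p + of_int r * \<beta>" "l * \<alpha> = of_int q + of_int d * \<beta>" "of_int d - of_int r * \<alpha> \<ge> 0"
    and "\<And>x y \<sigma>. x \<in> endpoints P \<Longrightarrow> y \<in> endpoints P' \<Longrightarrow>
      h (denjoy_model.pt X S x 0) = denjoy_model.pt Y T y \<sigma> \<Longrightarrow>
      \<exists>i j :: int. P' y = l * P x + c + of_int i + of_int j * \<beta>"
proof -
  interpret X: denjoy_model P f \<alpha> X S by fact
  interpret Y: denjoy_model P' g \<beta> Y T by fact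
  have hom: "homeomorphic_map (suspension X S) (suspension Y T) h"
    using h by (simp add: orbit_homeo_def)
  have conth: "continuous_map (suspension X S) (suspension Y T) h"
    using hom by (rule homeomorphic_imp_continuous_map)
  have h_in: "h (X.pt x t) \<in> topspace (suspension Y T)" if "x \<in> endpoints P" for x t
    using conth X.pt_in[OF that] by (auto simp: continuous_map_def Pi_iff)
  obtain v0 where v0: "continuous_map (suspension Y T) euclidean v0"
    "\<And>y t. y \<in> endpoints P' \<Longrightarrow> v0 (Y.pt y t) = ee t" using Y.height_function by blast
  obtain z0 where z0: "continuous_map (suspension Y T) euclidean z0"
    "\<And>y t. y \<in> endpoints P' \<Longrightarrow> z0 (Y.pt y t) = ee (P' y + \<beta> * t)" using Y.angle_function by blast
  define v z where "v x t = v0 (h (X.pt x t))" and "z x t = z0 (h (X.pt x t))" for x t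
  have cont: "continuous_on (endpoints P \<times> UNIV) (\<lambda>(x, t). g0 (h (X.pt x t)))"
    if g0: "continuous_map (suspension Y T) euclidean g0" for g0 :: "(real set \<times> real) set \<Rightarrow> complex"
    using continuous_map_compose[OF continuous_map_compose[OF X.continuous_map_pt conth] g0]
    by (simp add: o_def case_prod_unfold)
  interpret F: flow_lift P f \<alpha> \<beta> v z
  proof unfold_locales
    show "\<beta> \<notin> \<rat>" by (rule Y.irrational)
    show "continuous_on (endpoints P \<times> UNIV) (\<lambda>(x, t). v x t)" unfolding v_def by (rule cont[OF v0(1)])
    show "continuous_on (endpoints P \<times> UNIV) (\<lambda>(x, t). z x t)" unfolding z_def by (rule cont[OF z0(1)])
    show "norm (v x t) = 1" "norm (z x t) = 1" if "x \<in> endpoints P" for x t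
      using Y.ptE[OF h_in[OF that, of t]] v0(2) z0(2) unfolding v_def z_def by (metis norm_ee)+
    show "v (x + 1) t = v x t" "z (x + 1) t = z x t" for x t by (simp_all add: v_def z_def X.pt_add_1)
    show "v (f x) t = v x (t + 1)" "z (f x) t = z x (t + 1)" if "x \<in> endpoints P" for x t
      by (simp_all add: v_def z_def X.pt_f[OF that])
    show "\<exists>\<tau>. continuous_on UNIV \<tau> \<and> strict_mono \<tau> \<and> \<tau> 0 = 0 \<and>
        (\<forall>t. v x t = v x 0 * ee (\<tau> t) \<and> z x t = z x 0 * ee (\<beta> * \<tau> t))" if x: "x \<in> endpoints P" for x
    proof -
      obtain \<tau> :: "real \<Rightarrow> real" where \<tau>: "continuous_on UNIV \<tau>" "strict_mono \<tau>"
        "\<And>t. h (suspension_flow t (X.pt x 0)) = suspension_flow (\<tau> t) (h (X.pt x 0))"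
        using h X.pt_in[OF x] unfolding orbit_homeo_def by metis
      have "suspension_flow (\<tau> 0) (h (X.pt x 0)) = h (X.pt x 0)" using \<tau>(3)[of 0] by simp
      moreover obtain y s where y: "y \<in> endpoints P'" "h (X.pt x 0) = Y.pt y s"
        using Y.ptE[OF h_in[OF x]] by blast
      ultimately have "suspension_flow (\<tau> 0) (Y.pt y s) = suspension_flow 0 (Y.pt y s)" by simp
      then have "\<tau> 0 = 0" using Y.aperiodic[OF Y.pt_in[OF y(1)]] by blast
      moreover have "h (X.pt x t) = Y.pt y (s + \<tau> t)" for t using \<tau>(3)[of t] y(2) by simp
      then have "v x t = v x 0 * ee (\<tau> t) \<and> z x t = z x 0 * ee (\<beta> * \<tau> t)" for t
        using v0(2)[OF y(1)] z0(2)[OF y(1)] y(2) by (simp add: v_def z_def ee_add ring_distribs)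
      ultimately show ?thesis using \<tau>(1,2) by blast
    qed
  qed
  obtain l c :: real and p q r d :: int
    where 1: "l = of_int p + of_int r * \<beta>" "l * \<alpha> = of_int q + of_int d * \<beta>" "of_int d - of_int r * \<alpha> \<ge> 0"
      and 2: "\<And>x \<sigma>. x \<in> endpoints P \<Longrightarrow> v x 0 = ee \<sigma> \<Longrightarrow> \<exists>j::int. z x 0 = ee (l * P x + c + \<beta> * (\<sigma> + of_int j))"
    using F.flow_affine by metis
  show thesis
  proof (rule that[OF 1])
    fix x y \<sigma> assume x: "x \<in> endpoints P" and y: "y \<in> endpoints P'" and eq: "h (X.pt x 0) = Y.pt y \<sigma>"
    have "v x 0 = ee \<sigma>" "z x 0 = ee (P' y + \<beta> * \<sigma>)"
      using v0(2)[OF y] z0(2)[OF y] eq by (simp_all add: v_def z_def)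
    then obtain j :: int where "ee (P' y + \<beta> * \<sigma>) = ee (l * P x + c + \<beta> * (\<sigma> + of_int j))"
      using 2[OF x] by metis
    then obtain i :: int where "P' y + \<beta> * \<sigma> = l * P x + c + \<beta> * (\<sigma> + of_int j) + of_int i"
      unfolding ee_eq_iff by blast
    then have "P' y = l * P x + c + of_int i + of_int j * \<beta>" by (simp add: algebra_simps)
    then show "\<exists>i j :: int. P' y = l * P x + c + of_int i + of_int j * \<beta>" by blast
  qed
qed

context denjoy_model
begin

lemma gaps_add_lattice: "t + of_int i + of_int j * \<alpha> \<in> gaps P \<longleftrightarrow> t \<in> gaps P"
proof -
  have "s + of_int j * \<alpha> \<in> gaps P \<longleftrightarrow> s \<in> gaps P" for s
  proof (induction j rule: int_induct[of _ 0])
    case (step1 j)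
    then show ?case using gaps_add_alpha[of "s + of_int j * \<alpha>"] by (simp add: algebra_simps)
  next
    case (step2 j)
    then show ?case using gaps_add_alpha[of "s + of_int (j - 1) * \<alpha>"] by (simp add: algebra_simps)
  qed simp
  then show ?thesis by simp
qed

lemma gap_of_distinct:
  assumes "x \<in> endpoints P" "y \<in> endpoints P" "P x = P y" "x \<noteq> y"
  shows "P x \<in> gaps P"
proof (cases x y rule: linorder_cases)
  case less
  then have "x = lo P (P x) \<and> y = hi P (P x)" by (rule endpoints_same_fibre[OF assms(1-3)])
  then have "lo P (P x) < hi P (P x)" using less by metis
  then show ?thesis by (simp add: gaps_def)
next
  case greater
  then have "y = lo P (P x) \<and> x = hi P (P x)"
    using endpoints_same_fibre[OF assms(2,1) assms(3)[symmetric]] assms(3) by metis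
  then have "lo P (P x) < hi P (P x)" using greater by metis
  then show ?thesis by (simp add: gaps_def)
qed (use assms(4) in simp)

lemma pt_same_orbit:
  assumes x: "x \<in> endpoints P" and y: "y \<in> endpoints P" and "P x = P y" "pt x s = pt y t"
  shows "x = y"
proof -
  obtain n m :: int where nm: "y = it n x + of_int m" and "t = s - of_int n" by (rule pt_eqD[OF x y assms(4)])
  have "P y = P (it n x + of_int m)" unfolding nm[symmetric] ..
  then have "P y = P x + of_int n * \<alpha> + of_int m" by (simp only: P_add_int P_it)
  then have "of_int m + of_int n * \<alpha> = of_int 0 + of_int 0 * \<alpha>" using assms(3) by simp
  then have mn: "m = 0 \<and> n = 0" by (rule irrational_comb_eq[OF irrational])
  show ?thesis using nm unfolding conjunct1[OF mn] conjunct2[OF mn] by simp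
qed

end

text \<open>A gap is visible in the flow as two different orbits whose \<open>P\<close>-values agree
  modulo the lattice. The map \<open>h\<close> keeps the orbits different, and \<open>aff\<close>
  keeps the values congruent.\<close>

lemma orbit_homeo_gap:
  assumes "denjoy_model P f \<alpha> X S" and "denjoy_model P' g \<beta> Y T" and h: "orbit_homeo X S Y T h"
    and aff: "\<And>x y \<sigma>. x \<in> endpoints P \<Longrightarrow> y \<in> endpoints P' \<Longrightarrow>
      h (denjoy_model.pt X S x 0) = denjoy_model.pt Y T y \<sigma> \<Longrightarrow>
      \<exists>i j :: int. P' y = l * P x + c + of_int i + of_int j * \<beta>"
    and t: "t \<in> gaps P"
  shows "l * t + c \<in> gaps P'"
proof -
  interpret X: denjoy_model P f \<alpha> X S by fact
  interpret Y: denjoy_model P' g \<beta> Y T by fact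
  have hom: "homeomorphic_map (suspension X S) (suspension Y T) h"
    using h by (simp add: orbit_homeo_def)
  then have conth: "continuous_map (suspension X S) (suspension Y T) h"
    by (rule homeomorphic_imp_continuous_map)
  have inj: "inj_on h (topspace (suspension X S))"
    using hom unfolding homeomorphic_eq_everything_map by blast
  have h_in: "h (X.pt x s) \<in> topspace (suspension Y T)" if "x \<in> endpoints P" for x s
    using conth X.pt_in[OF that] by (auto simp: continuous_map_def Pi_iff)
  let ?a = "lo P t" and ?b = "hi P t"
  obtain y \<sigma> where y: "y \<in> endpoints P'" "h (X.pt ?a 0) = Y.pt y \<sigma>" using Y.ptE[OF h_in[OF X.lo_in]] by metis
  obtain y' \<sigma>' where y': "y' \<in> endpoints P'" "h (X.pt ?b 0) = Y.pt y' \<sigma>'" using Y.ptE[OF h_in[OF X.hi_in]] by metis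
  obtain i j :: int where ij: "P' y = l * t + c + of_int i + of_int j * \<beta>"
    using aff[OF X.lo_in y] unfolding X.P_lo by blast
  obtain i' j' :: int where ij': "P' y' = l * t + c + of_int i' + of_int j' * \<beta>"
    using aff[OF X.hi_in y'] unfolding X.P_hi by blast
  \<comment> \<open>A representative of the same orbit as \<open>y\<close>, moved so that its value
    is equal to \<open>P' y'\<close> and not only congruent to it.\<close>
  define y'' where "y'' = Y.it (j' - j) y + of_int (i' - i)"
  have "y'' \<in> endpoints P'" unfolding y''_def using y(1) by (simp only: Y.endpoints_add_int Y.it_in)
  moreover have "P' y'' = P' y + of_int (j' - j) * \<beta> + of_int (i' - i)"
    unfolding y''_def by (simp only: Y.P_add_int Y.P_it)
  then have "P' y'' = P' y'" using ij ij' by (simp add: algebra_simps)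
  moreover have "y'' \<noteq> y'"
  proof
    assume "y'' = y'"
    then have "Y.pt y' \<sigma>' = Y.pt y (\<sigma>' + of_int (j' - j))"
      using Y.pt_it[OF y(1), of "j' - j" "i' - i" \<sigma>'] unfolding y''_def by metis
    also have "\<dots> = suspension_flow (\<sigma>' + of_int (j' - j) - \<sigma>) (Y.pt y \<sigma>)"
      unfolding Y.flow_pt by (rule arg_cong) linarith
    finally have "h (X.pt ?b 0) \<in> flow_orbit (h (X.pt ?a 0))"
      unfolding y(2) y'(2) flow_orbit_def by (rule range_eqI)
    also have "flow_orbit (h (X.pt ?a 0)) = h ` flow_orbit (X.pt ?a 0)"
      using h X.pt_in[OF X.lo_in] unfolding orbit_homeo_def by metis
    finally obtain s where "h (X.pt ?b 0) = h (X.pt ?a s)" by (auto simp: flow_orbit_def)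
    then have "X.pt ?b 0 = X.pt ?a s"
      by (rule inj_onD[OF inj _ X.pt_in[OF X.hi_in] X.pt_in[OF X.lo_in]])
    then have "?b = ?a" by (rule X.pt_same_orbit[OF X.hi_in X.lo_in, rotated]) simp
    then show False using t by (simp add: gaps_def)
  qed
  ultimately have "P' y' \<in> gaps P'" using Y.gap_of_distinct[of y'' y'] y'(1) by simp
  then show ?thesis unfolding ij' by (simp only: Y.gaps_add_lattice)
qed

theorem orbit_homeo_lattice_iso:
  assumes X: "denjoy_model P f \<alpha> X S" and Y: "denjoy_model P' g \<beta> Y T" and h: "orbit_homeo X S Y T h"
  shows "\<exists>l p q r d. lattice_iso \<alpha> \<beta> l p q r d \<and> similar l (gaps P) (gaps P')"
proof -
  interpret X: denjoy_model P f \<alpha> X S by fact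
  interpret Y: denjoy_model P' g \<beta> Y T by fact
  obtain k where k: "orbit_homeo Y T X S k" and kh: "\<And>c. c \<in> topspace (suspension X S) \<Longrightarrow> k (h c) = c"
  proof (rule orbit_homeo_inverse[OF h])
    show "a = b" if "c \<in> topspace (suspension Y T)" "suspension_flow a c = suspension_flow b c" for c a b
      using that by (rule Y.aperiodic)
  next
    fix k assume "orbit_homeo Y T X S k" "\<And>c. c \<in> topspace (suspension X S) \<Longrightarrow> k (h c) = c"
    then show thesis by (rule that)
  qed
  obtain l c :: real and p q r d :: int
    where l: "l = of_int p + of_int r * \<beta>" "l * \<alpha> = of_int q + of_int d * \<beta>" "of_int d - of_int r * \<alpha> \<ge> 0"
      and aff: "\<And>x y \<sigma>. x \<in> endpoints P \<Longrightarrow> y \<in> endpoints P' \<Longrightarrow> h (X.pt x 0) = Y.pt y \<sigma> \<Longrightarrow>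
        \<exists>i j :: int. P' y = l * P x + c + of_int i + of_int j * \<beta>"
    using orbit_homeo_affine[OF X Y h] by metis
  obtain l' c' :: real and p' q' r' d' :: int
    where l': "l' = of_int p' + of_int r' * \<alpha>" "l' * \<beta> = of_int q' + of_int d' * \<alpha>"
      and aff': "\<And>y x \<sigma>. y \<in> endpoints P' \<Longrightarrow> x \<in> endpoints P \<Longrightarrow> k (Y.pt y 0) = X.pt x \<sigma> \<Longrightarrow>
        \<exists>i j :: int. P x = l' * P' y + c' + of_int i + of_int j * \<alpha>"
    using orbit_homeo_affine[OF Y X k] by metis
  have h_in: "h (X.pt x s) \<in> topspace (suspension Y T)" if "x \<in> endpoints P" for x s
    using h X.pt_in[OF that] unfolding orbit_homeo_def homeomorphic_eq_everything_map
    by (auto simp: continuous_map_def Pi_iff)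
  \<comment> \<open>Going to the target and back returns to the same orbit, so the composed affine
    map is the identity modulo the countable group \<int> + \<alpha>\<int>.\<close>
  have round: "\<exists>m n :: int. t = l' * l * t + (l' * c + c') + of_int m + of_int n * \<alpha>" for t
  proof -
    let ?x = "lo P t"
    obtain y \<sigma> where y: "y \<in> endpoints P'" "h (X.pt ?x 0) = Y.pt y \<sigma>" using Y.ptE[OF h_in[OF X.lo_in]] by metis
    obtain i j :: int where ij: "P' y = l * t + c + of_int i + of_int j * \<beta>"
      using aff[OF X.lo_in y] unfolding X.P_lo by blast
    obtain \<tau> :: "real \<Rightarrow> real" where \<tau>: "\<And>s. k (suspension_flow s (Y.pt y \<sigma>)) = suspension_flow (\<tau> s) (k (Y.pt y \<sigma>))"
      using k Y.pt_in[OF y(1)] unfolding orbit_homeo_def by metis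
    have "k (Y.pt y \<sigma>) = X.pt ?x 0" using kh[OF X.pt_in[OF X.lo_in]] y(2) by metis
    then have "k (Y.pt y 0) = X.pt ?x (\<tau> (- \<sigma>))" using \<tau>[of "- \<sigma>"] by simp
    then obtain i' j' :: int where "t = l' * P' y + c' + of_int i' + of_int j' * \<alpha>"
      using aff'[OF y(1) X.lo_in] X.P_lo by metis
    then have "t = l' * l * t + (l' * c + c') + (of_int i * l' + of_int j * (l' * \<beta>)) + of_int i' + of_int j' * \<alpha>"
      unfolding ij by (simp add: algebra_simps)
    then have "t = l' * l * t + (l' * c + c') + of_int (i * p' + j * q' + i') + of_int (i * r' + j * d' + j') * \<alpha>"
      unfolding l'(2) unfolding l'(1) by (simp add: algebra_simps)
    then show ?thesis by blast
  qed
  \<comment> \<open>Otherwise \<open>round\<close> would determine every real \<open>t\<close> from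
    two integers, and the reals would be countable.\<close>
  have ll: "l' * l = 1"
  proof (rule ccontr)
    assume ne: "l' * l \<noteq> 1"
    have "UNIV \<subseteq> range (\<lambda>(m :: int, n :: int). ((l' * c + c') + of_int m + of_int n * \<alpha>) / (1 - l' * l))"
    proof
      fix t :: real
      obtain m n :: int where "t = l' * l * t + (l' * c + c') + of_int m + of_int n * \<alpha>" using round by blast
      then have "(1 - l' * l) * t = (l' * c + c') + of_int m + of_int n * \<alpha>" by (simp add: algebra_simps)
      then have "t = ((l' * c + c') + of_int m + of_int n * \<alpha>) / (1 - l' * l)"
        using ne by (simp add: eq_divide_eq mult.commute)
      then show "t \<in> range (\<lambda>(m :: int, n :: int). ((l' * c + c') + of_int m + of_int n * \<alpha>) / (1 - l' * l))"
        by (intro range_eqI[of _ _ "(m, n)"]) simp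
    qed
    then have "countable (UNIV :: real set)" by (rule countable_subset) simp
    then show False using uncountable_UNIV_real by blast
  qed
  obtain a b :: int where "0 = l' * l * 0 + (l' * c + c') + of_int a + of_int b * \<alpha>" using round by blast
  then have mn: "l' * c + c' = of_int (- a) + of_int (- b) * \<alpha>" by simp
  have "l' * l = of_int p * l' + of_int r * (l' * \<beta>)" by (simp add: l(1) algebra_simps)
  also have "\<dots> = of_int (p * p' + r * q') + of_int (p * r' + r * d') * \<alpha>"
    unfolding l'(2) unfolding l'(1) by (simp add: algebra_simps)
  finally have "of_int (p * p' + r * q') + of_int (p * r' + r * d') * \<alpha> = of_int 1 + of_int 0 * \<alpha>" using ll by simp
  then have e1: "p * p' + r * q' = 1" "p * r' + r * d' = 0" using irrational_comb_eq[OF X.irrational] by blast+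
  have "l' * l * \<alpha> = l' * (l * \<alpha>)" by simp
  also have "\<dots> = of_int q * l' + of_int d * (l' * \<beta>)" unfolding l(2) by (simp add: algebra_simps)
  also have "\<dots> = of_int (q * p' + d * q') + of_int (q * r' + d * d') * \<alpha>"
    unfolding l'(2) unfolding l'(1) by (simp add: algebra_simps)
  finally have "of_int (q * p' + d * q') + of_int (q * r' + d * d') * \<alpha> = of_int 0 + of_int 1 * \<alpha>" using ll by simp
  then have e2: "q * p' + d * q' = 0" "q * r' + d * d' = 1" using irrational_comb_eq[OF X.irrational] by blast+
  \<comment> \<open>The integer matrices of \<open>l\<close> and \<open>l'\<close> are inverse to
    each other, so their determinants are units.\<close>
  have "(p * d - q * r) * (p' * d' - q' * r') = (p * p' + r * q') * (q * r' + d * d') - (p * r' + r * d') * (q * p' + d * q')"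
    by (simp add: algebra_simps)
  then have "(p * d - q * r) * (p' * d' - q' * r') = 1" unfolding e1 e2 by simp
  then have det: "\<bar>p * d - q * r\<bar> = 1" using zmult_eq_1_iff by auto
  have dual: "l * (of_int d - of_int r * \<alpha>) = of_int (p * d - q * r)"
  proof -
    have "l * (of_int d - of_int r * \<alpha>) = of_int d * l - of_int r * (l * \<alpha>)" by (simp add: algebra_simps)
    also have "\<dots> = of_int (p * d - q * r)" unfolding l(2) unfolding l(1) by (simp add: algebra_simps)
    finally show ?thesis .
  qed
  \<comment> \<open>Invertibility makes the orientation inequality strict.\<close>
  have "p * d - q * r \<noteq> 0" using det by auto
  then have "l * (of_int d - of_int r * \<alpha>) \<noteq> 0" unfolding dual by (simp only: of_int_eq_0_iff not_False_eq_True)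
  then have l0: "l \<noteq> 0" and pos: "of_int d - of_int r * \<alpha> > 0" using l(3) by auto
  have "l * of_int (p * d - q * r) = l * l * (of_int d - of_int r * \<alpha>)" unfolding dual[symmetric] by simp
  also have "\<dots> > 0" by (rule mult_pos_pos[OF _ pos]) (use l0 zero_less_power2[of l] in \<open>simp add: power2_eq_square\<close>)
  finally have iso: "lattice_iso \<alpha> \<beta> l p q r d" using l(1,2) det by unfold_locales
  have fwd: "l * t + c \<in> gaps P'" if t: "t \<in> gaps P" for t
  proof (rule orbit_homeo_gap[OF X Y h _ t])
    show "\<exists>i j :: int. P' y = l * P x + c + of_int i + of_int j * \<beta>"
      if "x \<in> endpoints P" "y \<in> endpoints P'" "h (X.pt x 0) = Y.pt y \<sigma>" for x y \<sigma>
      using that by (rule aff)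
  qed
  have bwd: "l' * s + c' \<in> gaps P" if s: "s \<in> gaps P'" for s
  proof (rule orbit_homeo_gap[OF Y X k _ s])
    show "\<exists>i j :: int. P x = l' * P' y + c' + of_int i + of_int j * \<alpha>"
      if "y \<in> endpoints P'" "x \<in> endpoints P" "k (Y.pt y 0) = X.pt x \<sigma>" for y x \<sigma>
      using that by (rule aff')
  qed
  have "gaps P' = (\<lambda>t. l * t + c) ` gaps P"
  proof
    show "(\<lambda>t. l * t + c) ` gaps P \<subseteq> gaps P'" using fwd by (rule image_subsetI)
    show "gaps P' \<subseteq> (\<lambda>t. l * t + c) ` gaps P"
    proof
      fix s assume "s \<in> gaps P'"
      then have "l' * s + c' \<in> gaps P" by (rule bwd)
      moreover have "l' * s + c' = l' * (s - c) + of_int (- a) + of_int (- b) * \<alpha>" using mn by (simp add: algebra_simps)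
      ultimately have "l' * (s - c) \<in> gaps P" by (simp only: X.gaps_add_lattice)
      moreover have "l * (l' * (s - c)) + c = s" using ll by (simp add: mult.assoc[symmetric] mult.commute[of l])
      ultimately show "s \<in> (\<lambda>t. l * t + c) ` gaps P" by (metis imageI)
    qed
  qed
  then have "similar l (gaps P) (gaps P')" unfolding similar_def by (rule exI)
  then show ?thesis using iso by metis
qed

theorem theorem1p8:
  fixes X Y :: "real set topology" and S T :: "real set \<Rightarrow> real set"
  assumes "denjoy_system X S" and "denjoy_system Y T"
  shows "eventually_flow_equivalent X S Y T \<longleftrightarrow> topologically_conjugate X S Y T"
proof -
  obtain f P \<alpha> where fP: "denjoy_lift P f \<alpha>" and X_eq: "X = subtopology circle (circle_proj ` endpoints P)"
    and S: "\<And>x. x \<in> endpoints P \<Longrightarrow> S (circle_proj x) = circle_proj (f x)"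
    using denjoy_system_lift[OF assms(1)] by metis
  obtain g P' \<beta> where gP: "denjoy_lift P' g \<beta>" and Y_eq: "Y = subtopology circle (circle_proj ` endpoints P')"
    and T: "\<And>y. y \<in> endpoints P' \<Longrightarrow> T (circle_proj y) = circle_proj (g y)"
    using denjoy_system_lift[OF assms(2)] by metis
  interpret X: denjoy_model P f \<alpha> X S
    by (intro denjoy_model.intro denjoy_model_axioms.intro fP X_eq S)
  interpret Y: denjoy_model P' g \<beta> Y T
    by (intro denjoy_model.intro denjoy_model_axioms.intro gP Y_eq T)
  show ?thesis
  proof
    assume "topologically_conjugate X S Y T"
    then have "topologically_conjugate X (S ^^ n) Y (T ^^ n)" for n
      by (rule topologically_conjugate_funpow[OF X.S_bij])
    then have "flow_equivalent X (S ^^ n) Y (T ^^ n)" for n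
      by (intro flow_equivalent_of_conjugate bij_betw_funpow X.S_bij Y.S_bij)
    then show "eventually_flow_equivalent X S Y T" by (simp add: eventually_flow_equivalent_def)
  next
    assume "eventually_flow_equivalent X S Y T"
    then obtain n0 where n0: "\<And>n. \<not> flow_equivalent X (S ^^ n) Y (T ^^ n) \<Longrightarrow> n < n0"
      unfolding eventually_flow_equivalent_def finite_nat_set_iff_bounded by auto
    have "\<exists>l p q r d. lattice_iso (real n * \<alpha>) (real n * \<beta>) l p q r d \<and> similar l (gaps P) (gaps P')"
      if n: "n \<ge> Suc n0" for n
    proof -
      have "flow_equivalent X (S ^^ n) Y (T ^^ n)" using n0[of n] n by force
      then obtain h where "orbit_homeo X (S ^^ n) Y (T ^^ n) h" unfolding flow_equivalent_iff by blast
      moreover have "n > 0" using n by simp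
      ultimately show ?thesis
        using orbit_homeo_lattice_iso[OF X.power_model Y.power_model] by blast
    qed
    then obtain \<sigma> k :: int where "\<sigma> \<in> {1, -1}" "\<beta> = of_int \<sigma> * \<alpha> + of_int k"
      "similar (of_int \<sigma>) (gaps P) (gaps P')"
      using similar_of_eventual_lattice_iso[OF X.irrational Y.irrational] by metis
    then show "topologically_conjugate X S Y T"
      unfolding X_eq Y_eq by (rule topologically_conjugate_of_similar_gaps[OF fP gP _ _ _ S T])
  qed
qed

end
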